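(* Let $(E,\mathscr{E})$ be a measurable space, $\mathscr{G}\subseteq\mathscr{F}$ a sub-$\sigma$-algebra, $\xi:\Omega\to E$ a random variable, and let $\nu_{\xi,\mathscr{G}}$ be the unique $\mathscr{G}$-stable probability measure on $(L^0_{m,\mathscr{G}}(E),\Sigma_{\mathscr{G}}(\mathcal{R}_{\mathscr{G}}))$ with $\mathbb{P}[\xi\in F|\mathscr{G}]=\nu_{\xi,\mathscr{G}}(L^0_{m,\mathscr{G}}(F))$ a.s. for all $F\in\mathscr{E}$. Let $f:E\to\mathbb{R}$ be a Borel measurable function with $\mathbb{E}[|f(\xi)|]<\infty$. Then $f$ extends to a $\mathscr{G}$-stable integrable function $\hat f:L^0_{m,\mathscr{G}}(E)\to L^0_{\mathscr{G}}$ such that $$\mathbb{E}[f(\xi)|\mathscr{G}](\omega)=\left(\int_{L^0_{m,\mathscr{G}}(E)}\hat f\,d\nu_{\xi,\mathscr{G}}\right)(\omega)\quad\text{a.s.}$$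
   Context: $(\Omega,\mathscr{F},\mathbb{P})$ is a complete probability space. The following notions are defined relative to a probability space $(\Omega,\mathscr{F},\mathbb{P})$; the prefix "$\mathscr{G}$-" (and subscript $\mathscr{G}$) means that they are taken relative to $(\Omega,\mathscr{G},\mathbb{P})$ instead (all sets $A$, $A_k$ in $\mathscr{G}$, all random variables $\mathscr{G}$-measurable). $A,B\in\mathscr{F}$ are identified if $\mathbb{P}(A\Delta B)=0$, and inclusions and (in)equalities between (extended) random variables are understood a.s. $L^0$, $L^0_+$, $\bar L^0_+$ are the sets of measurable functions on $\Omega$ with values in $\mathbb{R}$, $[0,\infty)$, $[0,\infty]$; $L^0_{++}=\{x\in L^0:x>0\}$. The supremum of a family of measurable sets is its essential supremum. A partition (of $\Omega$) is a countable pairwise disjoint family $(A_k)$ in $\mathscr{F}$ with union $\Omega$. For a function $x$ on $\Omega$ and $A\in\mathscr{F}$, $x|A$ is the restriction to $A$; $x|A$ and $y|B$ are identified if $\mathbb{P}(A\Delta B)=0$ and $x=y$ a.e. on $A\cap B$. $\sum x_k|A_k$ is the function equal to $x_k$ on $A_k$ for each $k$ (so $r|A+0|A^c$ equals $r$ on $A$ and $0$ on $A^c$). For a set $X$ of functions on $\Omega$, $X|A:=\{x|A: x\in X\}$, $(X|A)|B:=X|A\cap B$, $X|\emptyset=\{\ast\}$, $X|\Omega=X$. A set $X$ of functions on $\Omega$ with values in a fixed set is stable if $X\neq\emptyset$ and $\sum x_k|A_k\in X$ for all partitions $(A_k)$ and sequences $(x_k)$ in $X$. $\mathcal{P}(X)$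 is the collection of all conditional subsets $V|A$, $V\subseteq X$ stable, $A\in\mathscr{F}$. For stable $V_k\subseteq X$, $\sum V_k|A_k:=\{\sum x_k|A_k: x_k\in V_k\ \forall k\}$, and $\sum (V_k|B_k)|A_k:=(\sum V_k|A_k)|\bigcup_k(A_k\cap B_k)$. A subset of $\mathcal{P}(X)$ is a stable collection if nonempty and closed under such countable concatenations. $V|A\sqsubseteq W|B$ iff $A\subseteq B$ and $V|A\subseteq W|A$. $(\mathcal{P}(X),\sqsubseteq)$ is a complete Boolean algebra with greatest element $X$ and least element $\{\ast\}$; $\sqcup,\sqcap,{}^\sqsubset$ are its supremum, infimum, complement; disjoint means $V|A\sqcap W|B=\{\ast\}$. A stable collection $\mathcal{X}$ is a stable $\sigma$-algebra if $X\in\mathcal{X}$ and it is closed under ${}^\sqsubset$ and countable $\sqcup$; $\Sigma(\mathcal{E})$ is the smallest one containing $\mathcal{E}$. A stable measure on a stable $\sigma$-algebra $\mathcal{X}$ is a function $\mu:\mathcal{X}\to\bar L^0_+$ with $\mu(\sum(V_k|B_k)|A_k)=\sum\mu(V_k|B_k)|A_k$ (stability), (M1) $\mu(V|A)=\mu(V|A)|A+0|A^c$, and (M2) $\mu(\sqcup_k(V_k|A_k))=\sum_{k}\mu(V_k|A_k)$ for sequences of pairwise disjoint elements of $\mathcal{X}$; it is a stable probability measure if $\mu(X)=1$. A function $f:X\to Y$ between stable sets is stable if $f(\sum x_k|A_k)=\sum f(x_k)|A_k$. For $W|A\in\mathcal{P}(Y)$, with $C_\ast:=\sup\{A'\subseteq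 A:\exists x\in X,\ f(x)|A'\in W|A'\}$ (attained), $f^{-1}(W|A):=\{x\in X:f(x)|C_\ast\in W|C_\ast\}|C_\ast$. $f$ is stably measurable if preimages of elements of the stable $\sigma$-algebra on $Y$ belong to that on $X$; $L^0$ carries the stable Borel $\sigma$-algebra $\mathcal{B}(L^0)$ generated by the balls $\{y\in L^0:|x-y|<r\}$, $x\in L^0$, $r\in L^0_{++}$. The stable indicator function is $1_{V|A}(x):=1|A_x+0|A_x^c$, with $A_x:=\sup\{A'\subseteq A: x|A'\in V|A'\}$. A stable elementary function is $\sum_{k\le n}r_k1_{V_k|A_k}$ with $r_k\in L^0_+$ and pairwise disjoint $V_k|A_k\in\mathcal{X}$ with $\sqcup_kV_k|A_k=X$; its integral is $\sum_{k\le n}r_k\mu(V_k|A_k)\in\bar L^0_+$ ($0\cdot\infty=0$). For stably measurable $f:X\to L^0_+$, $\int_Xf\,d\mu:=\sup_n\int_Xf_n\,d\mu$ for any increasing sequence $(f_n)$ of stable elementary functions with $\sup_nf_n=f$ pointwise (exists; independent of the choice). A stably measurable $f:X\to L^0$ is integrable if $\int_X f^\pm d\mu\in L^0$, and then $\int_Xf\,d\mu:=\int_Xf^+d\mu-\int_Xf^-d\mu$. $L^0_{m,\mathscr{G}}(E)$ is the set of all $\mathscr{G}$-measurable functions $\Omega\to E$; $L^0_{\mathscr{G}}$ the set of real-valued $\mathscr{G}$-measurable functions. For a sequence $(F_k)$ in $\mathscr{E}$ and a partition $(A_k)$ in $\mathscr{G}$, $\sum L^0_{m,\mathscr{G}}(F_k)|A_k:=\{x\in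 L^0_{m,\mathscr{G}}(E): x\in F_k\text{ a.s. on }A_k\text{ for all }k\}$ (if some $F_k$ are empty, it denotes the conditional subset given by the conditions for the $k$ with $F_k\ne\emptyset$, restricted to the union of the corresponding $A_k$); $L^0_{m,\mathscr{G}}(F)$ is the case of constant sequence $F$. $\mathcal{R}_{\mathscr{G}}$ is the $\mathscr{G}$-stable ring of all $(\sum L^0_{m,\mathscr{G}}(F_k)|A_k)|A$, $A\in\mathscr{G}$, and $\Sigma_{\mathscr{G}}(\mathcal{R}_{\mathscr{G}})$ the smallest $\mathscr{G}$-stable $\sigma$-algebra on $L^0_{m,\mathscr{G}}(E)$ containing it. The paper establishes, for arbitrary $(E,\mathscr{E})$, existence and uniqueness of the $\mathscr{G}$-stable probability measure $\nu_{\xi,\mathscr{G}}$ with the stated property. "$\hat f$ extends $f$" means that $\hat f$ maps the constant function $e$ to the constant function $f(e)$ for each $e\in E$. Random variable means $\mathscr{F}/\mathscr{E}$-measurable. *)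

theory Defs
  imports "HOL-Probability.Probability" "HOL-Algebra.Complete_Lattice"
begin

text \<open>
  All notions are relative to a probability space \<open>N\<close>; the \<open>\<G>\<close>-relative notions are obtained by
  taking for \<open>N\<close> the restriction of the ambient space to the sub-\<open>\<sigma>\<close>-algebra \<open>\<G>\<close>.

  Functions on \<open>\<Omega>\<close> are represented by honest functions, with equations between them read
  almost surely. Conditional elements \<open>x|A\<close>, and therefore conditional sets \<open>V|A\<close>, are genuine
  quotient objects, so that \<open>=\<close> and \<open>\<in>\<close> carry the identifications.
\<close>

section \<open>Conditional elements and conditional sets\<close>

type_synonym ('w, 'v) cond_elem = "(('w \<Rightarrow> 'v) \<times> 'w set) set"
type_synonym ('w, 'v) cond_set = "('w, 'v) cond_elem set"

text \<open>The restriction \<open>x|A\<close>, as the class of all \<open>(y, B)\<close> with \<open>P(A \<Delta> B) = 0\<close> and \<open>x = y\<close> a.e. on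
  \<open>A \<inter> B\<close>.\<close>

definition restr_elem :: "'w measure \<Rightarrow> ('w \<Rightarrow> 'v) \<Rightarrow> 'w set \<Rightarrow> ('w, 'v) cond_elem" where
  "restr_elem N x A =
     {(y, B). B \<in> sets N \<and> (AE w in N. w \<in> A \<longleftrightarrow> w \<in> B) \<and> (AE w in N. w \<in> A \<inter> B \<longrightarrow> x w = y w)}"

definition restr_set :: "'w measure \<Rightarrow> ('w \<Rightarrow> 'v) set \<Rightarrow> 'w set \<Rightarrow> ('w, 'v) cond_set" where
  "restr_set N V A = (\<lambda>x. restr_elem N x A) ` V"

lemma restr_elem_eq_iff:
  assumes "A \<in> sets N" "B \<in> sets N"
  shows "restr_elem N x A = restr_elem N y B \<longleftrightarrow>
    (AE w in N. w \<in> A \<longleftrightarrow> w \<in> B) \<and> (AE w in N. w \<in> A \<inter> B \<longrightarrow> x w = y w)"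
proof
  assume eq: "restr_elem N x A = restr_elem N y B"
  have "(y, B) \<in> restr_elem N y B"
    using assms by (simp add: restr_elem_def)
  then have "(y, B) \<in> restr_elem N x A"
    using eq by simp
  then show "(AE w in N. w \<in> A \<longleftrightarrow> w \<in> B) \<and> (AE w in N. w \<in> A \<inter> B \<longrightarrow> x w = y w)"
    by (simp add: restr_elem_def)
next
  assume *: "(AE w in N. w \<in> A \<longleftrightarrow> w \<in> B) \<and> (AE w in N. w \<in> A \<inter> B \<longrightarrow> x w = y w)"
  have "(AE w in N. w \<in> A \<longleftrightarrow> w \<in> C) \<and> (AE w in N. w \<in> A \<inter> C \<longrightarrow> x w = z w) \<longleftrightarrow>
        (AE w in N. w \<in> B \<longleftrightarrow> w \<in> C) \<and> (AE w in N. w \<in> B \<inter> C \<longrightarrow> y w = z w)" for z C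
    using * unfolding AE_conj_iff[symmetric]
    by (intro iffI; elim AE_mp[OF _ AE_mp]) (auto elim!: eventually_mono)
  then show "restr_elem N x A = restr_elem N y B"
    unfolding restr_elem_def by auto
qed

definition omega_partition :: "'w measure \<Rightarrow> (nat \<Rightarrow> 'w set) \<Rightarrow> bool" where
  "omega_partition N A \<longleftrightarrow> range A \<subseteq> sets N \<and> disjoint_family A \<and> (\<Union>k. A k) = space N"

text \<open>The function \<open>\<Sum> x\<^sub>k|A\<^sub>k\<close>. Its values outside of \<open>\<Omega>\<close> are irrelevant.\<close>

definition glue :: "(nat \<Rightarrow> 'w set) \<Rightarrow> (nat \<Rightarrow> 'w \<Rightarrow> 'v) \<Rightarrow> 'w \<Rightarrow> 'v" where
  "glue A x = (\<lambda>w. x (LEAST k. w \<in> A k) w)"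

definition stable_set :: "'w measure \<Rightarrow> ('w \<Rightarrow> 'v) set \<Rightarrow> bool" where
  "stable_set N X \<longleftrightarrow>
     X \<noteq> {} \<and> (\<forall>A x. omega_partition N A \<and> (\<forall>k. x k \<in> X) \<longrightarrow> glue A x \<in> X)"

definition stable_subsets :: "'w measure \<Rightarrow> ('w \<Rightarrow> 'v) set \<Rightarrow> ('w \<Rightarrow> 'v) set set" where
  "stable_subsets N X = {V. V \<subseteq> X \<and> stable_set N V}"

definition glue_sets :: "(nat \<Rightarrow> 'w set) \<Rightarrow> (nat \<Rightarrow> ('w \<Rightarrow> 'v) set) \<Rightarrow> ('w \<Rightarrow> 'v) set" where
  "glue_sets A V = {glue A x | x. \<forall>k. x k \<in> V k}"

definition cond_power :: "'w measure \<Rightarrow> ('w \<Rightarrow> 'v) set \<Rightarrow> ('w, 'v) cond_set set" where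
  "cond_power N X = {restr_set N V A | V A. V \<in> stable_subsets N X \<and> A \<in> sets N}"

definition cond_le ::
  "'w measure \<Rightarrow> ('w \<Rightarrow> 'v) set \<Rightarrow> ('w, 'v) cond_set \<Rightarrow> ('w, 'v) cond_set \<Rightarrow> bool" where
  "cond_le N X C D \<longleftrightarrow>
     (\<exists>V\<in>stable_subsets N X. \<exists>W\<in>stable_subsets N X. \<exists>A\<in>sets N. \<exists>B\<in>sets N.
        C = restr_set N V A \<and> D = restr_set N W B \<and>
        (AE w in N. w \<in> A \<longrightarrow> w \<in> B) \<and> restr_set N V A \<subseteq> restr_set N W A)"

definition cond_order :: "'w measure \<Rightarrow> ('w \<Rightarrow> 'v) set \<Rightarrow> ('w, 'v) cond_set gorder" where
  "cond_order N X = \<lparr>carrier = cond_power N X, eq = (=), le = cond_le N X\<rparr>"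

text \<open>The conditional sets \<open>X\<close> and \<open>{*}\<close>, which are the greatest and least elements of the order.\<close>

definition cond_full :: "'w measure \<Rightarrow> ('w \<Rightarrow> 'v) set \<Rightarrow> ('w, 'v) cond_set" where
  "cond_full N X = restr_set N X (space N)"

definition cond_empty :: "'w measure \<Rightarrow> ('w \<Rightarrow> 'v) set \<Rightarrow> ('w, 'v) cond_set" where
  "cond_empty N X = restr_set N X {}"

definition cond_compl ::
  "'w measure \<Rightarrow> ('w \<Rightarrow> 'v) set \<Rightarrow> ('w, 'v) cond_set \<Rightarrow> ('w, 'v) cond_set" where
  "cond_compl N X C =
     (THE D. D \<in> cond_power N X \<and> C \<squnion>\<^bsub>cond_order N X\<^esub> D = cond_full N X \<and>
             C \<sqinter>\<^bsub>cond_order N X\<^esub> D = cond_empty N X)"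

definition cond_disjoint ::
  "'w measure \<Rightarrow> ('w \<Rightarrow> 'v) set \<Rightarrow> ('w, 'v) cond_set \<Rightarrow> ('w, 'v) cond_set \<Rightarrow> bool" where
  "cond_disjoint N X C D \<longleftrightarrow> C \<sqinter>\<^bsub>cond_order N X\<^esub> D = cond_empty N X"


section \<open>Stable \<open>\<sigma>\<close>-algebras and stable measures\<close>

text \<open>The concatenation of \<open>V\<^sub>k|B\<^sub>k\<close> along \<open>A\<^sub>k\<close> is \<open>(\<Sum> V\<^sub>k|A\<^sub>k)|\<Union>\<^sub>k (A\<^sub>k \<inter> B\<^sub>k)\<close>.\<close>

definition stable_collection ::
  "'w measure \<Rightarrow> ('w \<Rightarrow> 'v) set \<Rightarrow> ('w, 'v) cond_set set \<Rightarrow> bool" where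
  "stable_collection N X \<X> \<longleftrightarrow>
     \<X> \<subseteq> cond_power N X \<and> \<X> \<noteq> {} \<and>
     (\<forall>A V B. omega_partition N A \<and>
        (\<forall>k. V k \<in> stable_subsets N X \<and> B k \<in> sets N \<and> restr_set N (V k) (B k) \<in> \<X>) \<longrightarrow>
        restr_set N (glue_sets A V) (\<Union>k. A k \<inter> B k) \<in> \<X>)"

definition stable_sigma_algebra ::
  "'w measure \<Rightarrow> ('w \<Rightarrow> 'v) set \<Rightarrow> ('w, 'v) cond_set set \<Rightarrow> bool" where
  "stable_sigma_algebra N X \<X> \<longleftrightarrow>
     stable_collection N X \<X> \<and> cond_full N X \<in> \<X> \<and>
     (\<forall>C\<in>\<X>. cond_compl N X C \<in> \<X>) \<and>
     (\<forall>C :: nat \<Rightarrow> ('w, 'v) cond_set. range C \<subseteq> \<X> \<longrightarrow> \<Squnion>\<^bsub>cond_order N X\<^esub> (range C) \<in> \<X>)"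

definition stable_sigma ::
  "'w measure \<Rightarrow> ('w \<Rightarrow> 'v) set \<Rightarrow> ('w, 'v) cond_set set \<Rightarrow> ('w, 'v) cond_set set" where
  "stable_sigma N X \<E> = \<Inter>{\<X>. stable_sigma_algebra N X \<X> \<and> \<E> \<subseteq> \<X>}"

definition stable_measure ::
  "'w measure \<Rightarrow> ('w \<Rightarrow> 'v) set \<Rightarrow> ('w, 'v) cond_set set \<Rightarrow>
   (('w, 'v) cond_set \<Rightarrow> 'w \<Rightarrow> ennreal) \<Rightarrow> bool" where
  "stable_measure N X \<X> \<mu> \<longleftrightarrow>
     stable_sigma_algebra N X \<X> \<and>
     (\<forall>C\<in>\<X>. \<mu> C \<in> borel_measurable N) \<and>
     (\<forall>A V B. omega_partition N A \<and>
        (\<forall>k. V k \<in> stable_subsets N X \<and> B k \<in> sets N \<and> restr_set N (V k) (B k) \<in> \<X>) \<longrightarrow>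
        (AE w in N. \<mu> (restr_set N (glue_sets A V) (\<Union>k. A k \<inter> B k)) w =
                    glue A (\<lambda>k. \<mu> (restr_set N (V k) (B k))) w)) \<and>
     (\<forall>V\<in>stable_subsets N X. \<forall>A\<in>sets N. restr_set N V A \<in> \<X> \<longrightarrow>
        (AE w in N. w \<notin> A \<longrightarrow> \<mu> (restr_set N V A) w = 0)) \<and>
     (\<forall>C :: nat \<Rightarrow> ('w, 'v) cond_set.
        range C \<subseteq> \<X> \<and> (\<forall>i j. i \<noteq> j \<longrightarrow> cond_disjoint N X (C i) (C j)) \<longrightarrow>
        (AE w in N. \<mu> (\<Squnion>\<^bsub>cond_order N X\<^esub> (range C)) w = (\<Sum>k. \<mu> (C k) w)))"

definition stable_prob_measure ::
  "'w measure \<Rightarrow> ('w \<Rightarrow> 'v) set \<Rightarrow> ('w, 'v) cond_set set \<Rightarrow>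
   (('w, 'v) cond_set \<Rightarrow> 'w \<Rightarrow> ennreal) \<Rightarrow> bool" where
  "stable_prob_measure N X \<X> \<mu> \<longleftrightarrow>
     stable_measure N X \<X> \<mu> \<and> (AE w in N. \<mu> (cond_full N X) w = 1)"


section \<open>Stably measurable functions\<close>

text \<open>A representative of the essential supremum of a family of measurable sets.\<close>

definition ess_Union :: "'w measure \<Rightarrow> 'w set set \<Rightarrow> 'w set" where
  "ess_Union N \<A> =
     (SOME C. C \<in> sets N \<and> (\<forall>A\<in>\<A>. AE w in N. w \<in> A \<longrightarrow> w \<in> C) \<and>
        (\<forall>D\<in>sets N. (\<forall>A\<in>\<A>. AE w in N. w \<in> A \<longrightarrow> w \<in> D) \<longrightarrow> (AE w in N. w \<in> C \<longrightarrow> w \<in> D)))"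

text \<open>The second conjunct says that \<open>f\<close> respects the identification of a.s. equal functions.\<close>

definition stable_fun ::
  "'w measure \<Rightarrow> ('w \<Rightarrow> 'v) set \<Rightarrow> ('w \<Rightarrow> 'u) set \<Rightarrow> (('w \<Rightarrow> 'v) \<Rightarrow> 'w \<Rightarrow> 'u) \<Rightarrow> bool" where
  "stable_fun N X Y f \<longleftrightarrow>
     f ` X \<subseteq> Y \<and>
     (\<forall>x\<in>X. \<forall>y\<in>X. (AE w in N. x w = y w) \<longrightarrow> (AE w in N. f x w = f y w)) \<and>
     (\<forall>A x. omega_partition N A \<and> (\<forall>k. x k \<in> X) \<longrightarrow>
        (AE w in N. f (glue A x) w = glue A (\<lambda>k. f (x k)) w))"

text \<open>The preimage of \<open>W|A\<close>; it depends on \<open>W\<close> and \<open>A\<close> only through \<open>W|A\<close>.\<close>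

definition stable_preimage ::
  "'w measure \<Rightarrow> ('w \<Rightarrow> 'v) set \<Rightarrow> (('w \<Rightarrow> 'v) \<Rightarrow> 'w \<Rightarrow> 'u) \<Rightarrow> ('w \<Rightarrow> 'u) set \<Rightarrow> 'w set \<Rightarrow>
   ('w, 'v) cond_set" where
  "stable_preimage N X f W A =
     (let C = ess_Union N {A' \<in> sets N. A' \<subseteq> A \<and> (\<exists>x\<in>X. restr_elem N (f x) A' \<in> restr_set N W A')}
      in restr_set N {x \<in> X. restr_elem N (f x) C \<in> restr_set N W C} C)"

definition stably_measurable ::
  "'w measure \<Rightarrow> ('w \<Rightarrow> 'v) set \<Rightarrow> ('w, 'v) cond_set set \<Rightarrow>
   ('w \<Rightarrow> 'u) set \<Rightarrow> ('w, 'u) cond_set set \<Rightarrow> (('w \<Rightarrow> 'v) \<Rightarrow> 'w \<Rightarrow> 'u) \<Rightarrow> bool" where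
  "stably_measurable N X \<X> Y \<Y> f \<longleftrightarrow>
     stable_fun N X Y f \<and>
     (\<forall>W\<in>stable_subsets N Y. \<forall>A\<in>sets N.
        restr_set N W A \<in> \<Y> \<longrightarrow> stable_preimage N X f W A \<in> \<X>)"

abbreviation (input) L0 :: "'w measure \<Rightarrow> ('w \<Rightarrow> real) set" where
  "L0 N \<equiv> borel_measurable N"

definition stable_borel :: "'w measure \<Rightarrow> ('w, real) cond_set set" where
  "stable_borel N =
     stable_sigma N (L0 N)
       {restr_set N {y \<in> L0 N. AE w in N. \<bar>x w - y w\<bar> < r w} (space N) | x r.
          x \<in> L0 N \<and> r \<in> L0 N \<and> (AE w in N. 0 < r w)}"


section \<open>Stable integration\<close>

definition stable_indicator ::
  "'w measure \<Rightarrow> ('w \<Rightarrow> 'v) set \<Rightarrow> 'w set \<Rightarrow> ('w \<Rightarrow> 'v) \<Rightarrow> 'w \<Rightarrow> real" where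
  "stable_indicator N V A x =
     indicator (ess_Union N {A' \<in> sets N. A' \<subseteq> A \<and> restr_elem N x A' \<in> restr_set N V A'})"

text \<open>\<open>g\<close> is the stable elementary function \<open>\<Sum>\<^bsub>k\<le>n\<^esub> r\<^sub>k 1\<^bsub>V\<^sub>k|A\<^sub>k\<^esub>\<close> on \<open>X\<close> and \<open>I\<close> is its integral.\<close>

definition has_elementary_integral ::
  "'w measure \<Rightarrow> ('w \<Rightarrow> 'v) set \<Rightarrow> ('w, 'v) cond_set set \<Rightarrow>
   (('w, 'v) cond_set \<Rightarrow> 'w \<Rightarrow> ennreal) \<Rightarrow> (('w \<Rightarrow> 'v) \<Rightarrow> 'w \<Rightarrow> real) \<Rightarrow> ('w \<Rightarrow> ennreal) \<Rightarrow> bool" where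
  "has_elementary_integral N X \<X> \<mu> g I \<longleftrightarrow>
     (\<exists>(n::nat) r V A.
        (\<forall>k\<le>n. r k \<in> L0 N \<and> (AE w in N. 0 \<le> r k w) \<and>
               V k \<in> stable_subsets N X \<and> A k \<in> sets N \<and> restr_set N (V k) (A k) \<in> \<X>) \<and>
        (\<forall>i\<le>n. \<forall>j\<le>n. i \<noteq> j \<longrightarrow>
           cond_disjoint N X (restr_set N (V i) (A i)) (restr_set N (V j) (A j))) \<and>
        \<Squnion>\<^bsub>cond_order N X\<^esub> ((\<lambda>k. restr_set N (V k) (A k)) ` {..n}) = cond_full N X \<and>
        (\<forall>x\<in>X. AE w in N. g x w = (\<Sum>k\<le>n. r k w * stable_indicator N (V k) (A k) x w)) \<and>
        (AE w in N. I w = (\<Sum>k\<le>n. ennreal (r k w) * \<mu> (restr_set N (V k) (A k)) w)))"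

text \<open>\<open>I\<close> is the supremum of the integrals of an increasing sequence of stable elementary functions
  with pointwise supremum \<open>f\<close>, where \<open>f\<close> is nonnegative.\<close>

definition has_stable_nn_integral ::
  "'w measure \<Rightarrow> ('w \<Rightarrow> 'v) set \<Rightarrow> ('w, 'v) cond_set set \<Rightarrow>
   (('w, 'v) cond_set \<Rightarrow> 'w \<Rightarrow> ennreal) \<Rightarrow> (('w \<Rightarrow> 'v) \<Rightarrow> 'w \<Rightarrow> real) \<Rightarrow> ('w \<Rightarrow> ennreal) \<Rightarrow> bool" where
  "has_stable_nn_integral N X \<X> \<mu> f I \<longleftrightarrow>
     I \<in> borel_measurable N \<and>
     (\<exists>(g :: nat \<Rightarrow> ('w \<Rightarrow> 'v) \<Rightarrow> 'w \<Rightarrow> real) J.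
        (\<forall>n. has_elementary_integral N X \<X> \<mu> (g n) (J n)) \<and>
        (\<forall>n. \<forall>x\<in>X. AE w in N. g n x w \<le> g (Suc n) x w) \<and>
        (\<forall>x\<in>X. AE w in N. (SUP n. ereal (g n x w)) = ereal (f x w)) \<and>
        (AE w in N. I w = (SUP n. J n w)))"

definition stable_nn_integral ::
  "'w measure \<Rightarrow> ('w \<Rightarrow> 'v) set \<Rightarrow> ('w, 'v) cond_set set \<Rightarrow>
   (('w, 'v) cond_set \<Rightarrow> 'w \<Rightarrow> ennreal) \<Rightarrow> (('w \<Rightarrow> 'v) \<Rightarrow> 'w \<Rightarrow> real) \<Rightarrow> 'w \<Rightarrow> ennreal" where
  "stable_nn_integral N X \<X> \<mu> f = (SOME I. has_stable_nn_integral N X \<X> \<mu> f I)"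

definition stable_integrable ::
  "'w measure \<Rightarrow> ('w \<Rightarrow> 'v) set \<Rightarrow> ('w, 'v) cond_set set \<Rightarrow>
   (('w, 'v) cond_set \<Rightarrow> 'w \<Rightarrow> ennreal) \<Rightarrow> (('w \<Rightarrow> 'v) \<Rightarrow> 'w \<Rightarrow> real) \<Rightarrow> bool" where
  "stable_integrable N X \<X> \<mu> f \<longleftrightarrow>
     stably_measurable N X \<X> (L0 N) (stable_borel N) f \<and>
     (AE w in N. stable_nn_integral N X \<X> \<mu> (\<lambda>x w. max 0 (f x w)) w < \<infinity>) \<and>
     (AE w in N. stable_nn_integral N X \<X> \<mu> (\<lambda>x w. max 0 (- f x w)) w < \<infinity>)"

definition stable_integral ::
  "'w measure \<Rightarrow> ('w \<Rightarrow> 'v) set \<Rightarrow> ('w, 'v) cond_set set \<Rightarrow>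
   (('w, 'v) cond_set \<Rightarrow> 'w \<Rightarrow> ennreal) \<Rightarrow> (('w \<Rightarrow> 'v) \<Rightarrow> 'w \<Rightarrow> real) \<Rightarrow> 'w \<Rightarrow> real" where
  "stable_integral N X \<X> \<mu> f = (\<lambda>w.
     enn2real (stable_nn_integral N X \<X> \<mu> (\<lambda>x w. max 0 (f x w)) w) -
     enn2real (stable_nn_integral N X \<X> \<mu> (\<lambda>x w. max 0 (- f x w)) w))"


section \<open>The stable ring generated by a measurable space\<close>

text \<open>The conditional subset \<open>\<Sum> L\<^sup>0(F\<^sub>k)|A\<^sub>k\<close> of \<open>measurable N E\<close>. An empty \<open>F\<^sub>k\<close> imposes no condition,
  but removes \<open>A\<^sub>k\<close> from the set on which the conditional subset lives.\<close>

definition L0m_glue ::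
  "'w measure \<Rightarrow> 'e measure \<Rightarrow> (nat \<Rightarrow> 'w set) \<Rightarrow> (nat \<Rightarrow> 'e set) \<Rightarrow> 'w set \<Rightarrow> ('w, 'e) cond_set" where
  "L0m_glue N E A F B =
     restr_set N {x \<in> measurable N E. \<forall>k. F k \<noteq> {} \<longrightarrow> (AE w in N. w \<in> A k \<longrightarrow> x w \<in> F k)}
       ((\<Union>k\<in>{k. F k \<noteq> {}}. A k) \<inter> B)"

definition L0m_cond :: "'w measure \<Rightarrow> 'e measure \<Rightarrow> 'e set \<Rightarrow> ('w, 'e) cond_set" where
  "L0m_cond N E F = L0m_glue N E (\<lambda>k. if k = 0 then space N else {}) (\<lambda>_. F) (space N)"

definition L0m_ring :: "'w measure \<Rightarrow> 'e measure \<Rightarrow> ('w, 'e) cond_set set" where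
  "L0m_ring N E =
     {L0m_glue N E A F B | A F B. omega_partition N A \<and> range F \<subseteq> sets E \<and> B \<in> sets N}"

definition L0m_sigma :: "'w measure \<Rightarrow> 'e measure \<Rightarrow> ('w, 'e) cond_set set" where
  "L0m_sigma N E = stable_sigma N (measurable N E) (L0m_ring N E)"

text \<open>\<open>\<nu>\<close> is a stable probability measure on \<open>L\<^sup>0\<^sub>m\<^sub>,\<^sub>\<G>(E)\<close> with \<open>P[\<xi> \<in> F | \<G>] = \<nu>(L\<^sup>0\<^sub>m\<^sub>,\<^sub>\<G>(F))\<close> a.s.\<close>

definition stable_cond_distribution ::
  "'w measure \<Rightarrow> 'w measure \<Rightarrow> 'e measure \<Rightarrow> ('w \<Rightarrow> 'e) \<Rightarrow>
   (('w, 'e) cond_set \<Rightarrow> 'w \<Rightarrow> ennreal) \<Rightarrow> bool" where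
  "stable_cond_distribution M G E \<xi> \<nu> \<longleftrightarrow>
     (let N = restr_to_subalg M G in
        stable_prob_measure N (measurable N E) (L0m_sigma N E) \<nu> \<and>
        (\<forall>F\<in>sets E. AE w in M.
           ennreal (real_cond_exp M G (\<lambda>v. indicator F (\<xi> v)) w) = \<nu> (L0m_cond N E F) w))"

end

theory Submission
  imports Defs
begin

text \<open>Write \<open>N\<close> for the restriction of the probability space to \<open>\<G>\<close>. The extension of \<open>f\<close> is composition,
  \<open>x \<mapsto> f \<circ> x\<close>. Two reductions turn the statement about stable integrals into one about ordinary
  conditional expectations.

  \<^bold>\<open>Conditional sets as families of events.\<close> A conditional set \<open>C\<close> is determined by its membership
  regions: for each \<open>x\<close> in \<open>X\<close>, the largest event on which \<open>x\<close> lies in \<open>C\<close>. The map \<open>x \<mapsto> region N C x\<close>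
  is local, that is, compatible with restriction to events; the order of conditional sets is
  inclusion of regions; and every local map is the region map of a conditional set. Hence suprema,
  infima, complements, concatenations and preimages of conditional sets are computed on regions,
  event by event (\<open>Sup_eq_cond_set_of\<close>, \<open>cond_compl_eq_cond_set_of\<close>, \<open>region_glue_sets\<close>,
  \<open>stable_preimage_eq_graph_cond\<close>).

  \<^bold>\<open>Conditional sets as subsets of \<open>\<Omega> \<times> E\<close>.\<close> A set \<open>H\<close> in the product \<open>\<sigma>\<close>-algebra of \<open>N\<close> and \<open>E\<close> defines
  the local map \<open>x \<mapsto> {w. (w, x w) \<in> H}\<close>, hence a conditional set \<open>graph_cond N E H\<close>. As \<open>H\<close> varies
  these form exactly \<open>\<Sigma>(\<R>)\<close> (\<open>L0m_sigma_eq_graphs\<close>): they are a stable \<open>\<sigma>\<close>-algebra, the elements of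
  the ring come from countable unions of rectangles, and rectangles generate the product
  \<open>\<sigma>\<close>-algebra. For \<open>E\<close> the real line, every ball of \<open>L\<^sup>0\<close> has this form, so that every stable Borel
  set does; the preimage of such a set under \<open>x \<mapsto> f \<circ> x\<close> is the conditional set of \<open>{(w, e). (w, f e) \<in> H}\<close>, which gives stable
  measurability.

  By a Dynkin argument \<open>\<nu> (graph_cond N E H)\<close> is the conditional probability of \<open>(w, \<xi> w) \<in> H\<close> given
  \<open>\<G>\<close> (\<open>\<nu>_eq_nn_cond_exp\<close>): on rectangles this combines the defining property of \<open>\<nu>\<close> with its
  vanishing off the event on which a conditional set lives. Consequently a stable elementary function
  is of the form \<open>x \<mapsto> \<gamma>(w, x w)\<close> and its integral is the conditional expectation of \<open>\<gamma>(w, \<xi> w)\<close>.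
  If such functions increase to \<open>f \<circ> x\<close> for each \<open>x\<close>, then the set of exceptional \<open>(w, e)\<close> is almost
  surely met by no \<open>\<G>\<close>-measurable \<open>x\<close>, so its conditional set is empty and has measure zero, which means that
  \<open>(w, \<xi> w)\<close> avoids it almost surely (\<open>AE_graph_of_sections\<close>). Conditional monotone
  convergence then identifies the stable integral of \<open>f \<circ> x\<close> with the conditional expectation of \<open>f \<circ> \<xi>\<close>, independently of the approximating sequence.\<close>

section \<open>Essential unions\<close>

text \<open>If the family has a largest member up to null sets, then that member meets the specification of
  the essential union, and any two sets that meet it agree almost surely.\<close>

lemma ess_Union_attained:
  assumes "\<A> \<subseteq> sets N" "B \<in> \<A>" "\<And>A. A \<in> \<A> \<Longrightarrow> AE w in N. w \<in> A \<longrightarrow> w \<in> B"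
  shows "ess_Union N \<A> \<in> sets N" "AE w in N. w \<in> ess_Union N \<A> \<longleftrightarrow> w \<in> B"
proof -
  let ?P = "\<lambda>C. C \<in> sets N \<and> (\<forall>A\<in>\<A>. AE w in N. w \<in> A \<longrightarrow> w \<in> C) \<and>
        (\<forall>D\<in>sets N. (\<forall>A\<in>\<A>. AE w in N. w \<in> A \<longrightarrow> w \<in> D) \<longrightarrow> (AE w in N. w \<in> C \<longrightarrow> w \<in> D))"
  have B: "?P B"
    using assms by auto
  then have E: "?P (ess_Union N \<A>)"
    unfolding ess_Union_def by (rule someI)
  show "ess_Union N \<A> \<in> sets N"
    using E by blast
  have "AE w in N. w \<in> B \<longrightarrow> w \<in> ess_Union N \<A>"
    using E assms(2) by blast
  moreover have "AE w in N. w \<in> ess_Union N \<A> \<longrightarrow> w \<in> B"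
    using E B by blast
  ultimately show "AE w in N. w \<in> ess_Union N \<A> \<longleftrightarrow> w \<in> B"
    by eventually_elim blast
qed

text \<open>A countable union of members whose measures approach the supremum has maximal measure; adding a
  further member to it cannot increase the measure, so that member is already contained up to a
  null set.\<close>

lemma (in finite_measure) ex_AE_largest_member:
  assumes sets: "\<A> \<subseteq> sets M" and "\<A> \<noteq> {}"
    and Un: "\<And>F :: nat \<Rightarrow> 'a set. range F \<subseteq> \<A> \<Longrightarrow> (\<Union>n. F n) \<in> \<A>"
  shows "\<exists>B\<in>\<A>. \<forall>A\<in>\<A>. AE w in M. w \<in> A \<longrightarrow> w \<in> B"
proof -
  let ?s = "SUP A\<in>\<A>. measure M A"
  have bdd: "bdd_above (measure M ` \<A>)"
    by (rule bdd_aboveI2[where M = "measure M (space M)"]) (rule bounded_measure)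
  have "\<exists>A\<in>\<A>. ?s - 1 / real (Suc n) < measure M A" for n
    using less_cSUP_iff[OF \<open>\<A> \<noteq> {}\<close> bdd, of "?s - 1 / real (Suc n)"] by simp
  then obtain F where F: "\<And>n. F n \<in> \<A>" "\<And>n. ?s - 1 / real (Suc n) < measure M (F n)"
    by metis
  define B where "B = (\<Union>n. F n)"
  have B: "B \<in> \<A>"
    unfolding B_def by (rule Un) (use F in auto)
  have "?s - 1 / real (Suc n) \<le> measure M B" for n
  proof -
    have "measure M (F n) \<le> measure M B"
      unfolding B_def using sets F(1) B B_def by (intro finite_measure_mono) auto
    then show ?thesis
      using F(2)[of n] by simp
  qed
  moreover have "(\<lambda>n. ?s - 1 / real (Suc n)) \<longlonglongrightarrow> ?s - 0"
    by (intro tendsto_diff tendsto_const LIMSEQ_Suc[OF lim_1_over_n])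
  ultimately have s_le: "?s \<le> measure M B"
    by (intro LIMSEQ_le_const2[where X = "\<lambda>n. ?s - 1 / real (Suc n)"]) auto
  have "AE w in M. w \<in> A \<longrightarrow> w \<in> B" if A: "A \<in> \<A>" for A
  proof -
    have [measurable]: "A \<in> sets M" "B \<in> sets M"
      using A B sets by auto
    have "(\<Union>n. case n of 0 \<Rightarrow> A | Suc _ \<Rightarrow> B) \<in> \<A>"
      by (rule Un) (use A B in \<open>auto split: nat.split\<close>)
    also have "(\<Union>n. case n of 0 \<Rightarrow> A | Suc _ \<Rightarrow> B) = A \<union> B"
      by (auto split: nat.splits intro: exI[of _ "0::nat"] exI[of _ "Suc 0"])
    finally have "measure M (A \<union> B) \<le> measure M B"
      using cSUP_upper[OF _ bdd, of "A \<union> B"] s_le by linarith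
    moreover have "measure M (A \<union> B) = measure M B + measure M (A - B)"
      using finite_measure_Union[of B "A - B"] by (simp add: Un_commute)
    ultimately have "measure M (A - B) = 0"
      using measure_nonneg[of M "A - B"] by linarith
    then have "A - B \<in> null_sets M"
      by (intro null_setsI) (simp_all add: emeasure_eq_measure)
    then show ?thesis
      by (rule AE_I') auto
  qed
  with B show ?thesis
    by blast
qed

section \<open>Membership regions\<close>

text \<open>The largest event on which \<open>x\<close> lies in the conditional set \<open>C\<close>. The definition refers to \<open>C\<close> only,
  and not to a representation \<open>C = V|A\<close>, which is not unique.\<close>

definition region :: "'w measure \<Rightarrow> ('w, 'v) cond_set \<Rightarrow> ('w \<Rightarrow> 'v) \<Rightarrow> 'w set" where
  "region N C x = ess_Union N {A' \<in> sets N. \<exists>v B. B \<in> sets N \<and> restr_elem N v B \<in> C \<and> A' \<subseteq> B \<and>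
     (AE w in N. w \<in> A' \<longrightarrow> x w = v w)}"

lemma glue_eq: "disjoint_family A \<Longrightarrow> w \<in> A k \<Longrightarrow> glue A x w = x k w"
proof -
  assume "disjoint_family A" "w \<in> A k"
  then have "\<And>j. w \<in> A j \<longleftrightarrow> j = k"
    unfolding disjoint_family_on_def by blast
  then show ?thesis
    by (simp add: glue_def Least_equality)
qed

lemma omega_partition_index: "omega_partition N A \<Longrightarrow> w \<in> space N \<Longrightarrow> \<exists>k. w \<in> A k"
  by (auto simp: omega_partition_def)

text \<open>Countably many measurable sets can be turned into a partition without losing members:
  the parts are the successive differences, and the complement of the union comes first.\<close>

lemma ex_partition_refining:
  assumes "range F \<subseteq> sets N"
  obtains P where "omega_partition N P" "P 0 = space N - (\<Union>n. F n)"
    "\<And>n. P (Suc n) \<subseteq> F n" "(\<Union>n. P (Suc n)) = (\<Union>n. F n)"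
proof -
  define P where "P n = (case n of 0 \<Rightarrow> space N - (\<Union>n. F n) | Suc m \<Rightarrow> disjointed F m)" for n
  have U: "(\<Union>n. disjointed F n) = (\<Union>n. F n)"
    by (rule UN_disjointed_eq)
  have sub: "(\<Union>n. F n) \<subseteq> space N"
    using sets.sets_into_space[of _ N] assms by blast
  have "omega_partition N P"
    unfolding omega_partition_def
  proof (intro conjI)
    have "P n \<in> sets N" for n
      using assms sets.range_disjointed_sets[OF assms]
      by (auto simp: P_def split: nat.split)
    then show "range P \<subseteq> sets N"
      by auto
    have dj: "disjointed F i \<inter> disjointed F j = {}" if "i \<noteq> j" for i j
      using disjoint_family_disjointed[of F] that by (auto simp: disjoint_family_on_def)
    have d0: "disjointed F i \<subseteq> (\<Union>n. F n)" for i
      using disjointed_subset[of F i] by blast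
    show "disjoint_family P"
      unfolding disjoint_family_on_def
    proof (intro ballI impI)
      fix m n :: nat assume "m \<noteq> n"
      then show "P m \<inter> P n = {}"
        using dj d0 by (cases m; cases n) (force simp: P_def)+
    qed
    show "(\<Union>k. P k) = space N"
    proof -
      have "(\<Union>k. P k) = P 0 \<union> (\<Union>k. P (Suc k))"
        by (subst UNIV_nat_eq) (simp add: image_image)
      then show ?thesis
        using U sub by (auto simp: P_def)
    qed
  qed
  moreover have "P (Suc n) \<subseteq> F n" for n
    by (simp add: P_def disjointed_subset)
  ultimately show thesis
    using that[of P] U by (simp add: P_def)
qed

lemma restr_elem_in_restr_set_iff:
  assumes "A \<in> sets N" "B \<in> sets N"
  shows "restr_elem N x B \<in> restr_set N V A \<longleftrightarrow>
    (AE w in N. w \<in> A \<longleftrightarrow> w \<in> B) \<and> (\<exists>v\<in>V. AE w in N. w \<in> A \<longrightarrow> x w = v w)"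
proof -
  have "restr_elem N x B = restr_elem N v A \<longleftrightarrow>
      (AE w in N. w \<in> A \<longleftrightarrow> w \<in> B) \<and> (AE w in N. w \<in> A \<longrightarrow> x w = v w)" for v
  proof -
    have "(AE w in N. w \<in> B \<inter> A \<longrightarrow> x w = v w) \<longleftrightarrow> (AE w in N. w \<in> A \<longrightarrow> x w = v w)"
      if "AE w in N. w \<in> A \<longleftrightarrow> w \<in> B"
      using that by (intro iffI; elim AE_mp[OF _ AE_mp]) (auto elim!: eventually_mono)
    moreover have "(AE w in N. w \<in> A \<longleftrightarrow> w \<in> B) \<longleftrightarrow> (AE w in N. w \<in> B \<longleftrightarrow> w \<in> A)"
      by (simp add: eq_commute)
    ultimately show ?thesis
      unfolding restr_elem_eq_iff[OF assms(2,1)] by blast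
  qed
  then show ?thesis
    unfolding restr_set_def by auto
qed

locale stable_space = finite_measure N for N :: "'w measure" +
  fixes X :: "('w \<Rightarrow> 'v) set"
  assumes stable: "stable_set N X"
begin

lemma nonempty: "X \<noteq> {}"
  using stable by (simp add: stable_set_def)

lemma glue_in: "omega_partition N A \<Longrightarrow> (\<And>k. x k \<in> V) \<Longrightarrow> stable_set N V \<Longrightarrow> glue A x \<in> V"
  unfolding stable_set_def by blast

text \<open>The events below \<open>A\<close> on which \<open>x\<close> agrees with some element of \<open>V\<close> are closed under countable unions,
  since the witnesses can be glued by stability. So the essential union that defines the region is
  itself such an event, and has a witness in \<open>V\<close>.\<close>

lemma
  assumes V: "stable_set N V" and A: "A \<in> sets N"
  shows region_sets: "region N (restr_set N V A) x \<in> sets N"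
    and region_subset: "AE w in N. w \<in> region N (restr_set N V A) x \<longrightarrow> w \<in> A"
    and region_witness: "\<exists>v\<in>V. AE w in N. w \<in> region N (restr_set N V A) x \<longrightarrow> x w = v w"
    and region_largest: "\<And>B v. \<lbrakk>B \<in> sets N; v \<in> V; AE w in N. w \<in> B \<longrightarrow> w \<in> A;
        AE w in N. w \<in> B \<longrightarrow> x w = v w\<rbrakk> \<Longrightarrow> AE w in N. w \<in> B \<longrightarrow> w \<in> region N (restr_set N V A) x"
proof -
  define \<A> where "\<A> = {B \<in> sets N. (AE w in N. w \<in> B \<longrightarrow> w \<in> A) \<and> (\<exists>v\<in>V. AE w in N. w \<in> B \<longrightarrow> x w = v w)}"
  have "\<exists>B\<in>\<A>. \<forall>C\<in>\<A>. AE w in N. w \<in> C \<longrightarrow> w \<in> B"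
  proof (rule ex_AE_largest_member)
    show "\<A> \<subseteq> sets N" "\<A> \<noteq> {}"
      using V by (auto simp: \<A>_def stable_set_def intro!: exI[of _ "{}"])
    fix F :: "nat \<Rightarrow> 'w set"
    assume F: "range F \<subseteq> \<A>"
    then have FS: "range F \<subseteq> sets N"
      by (auto simp: \<A>_def)
    from F have "\<exists>v\<in>V. AE w in N. w \<in> F n \<longrightarrow> x w = v w" for n
      by (auto simp: \<A>_def)
    then obtain v where v: "\<And>n. v n \<in> V" "\<And>n. AE w in N. w \<in> F n \<longrightarrow> x w = v n w"
      by metis
    obtain P where P: "omega_partition N P" "\<And>n. P (Suc n) \<subseteq> F n" "(\<Union>n. P (Suc n)) = (\<Union>n. F n)"
      using ex_partition_refining[OF FS] by metis
    let ?u = "glue P (\<lambda>n. v (n - 1))"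
    have "?u \<in> V"
      using P V v by (intro glue_in) auto
    moreover have "AE w in N. \<forall>n. w \<in> F n \<longrightarrow> x w = v n w"
      using v(2) by (simp add: AE_all_countable)
    then have "AE w in N. w \<in> (\<Union>n. F n) \<longrightarrow> x w = ?u w"
    proof eventually_elim
      case (elim w)
      show ?case
      proof
        assume "w \<in> (\<Union>n. F n)"
        then obtain n where n: "w \<in> P (Suc n)"
          using P(3) by blast
        then show "x w = ?u w"
          using elim P(2)[of n] glue_eq[of P w "Suc n" "\<lambda>n. v (n - 1)"] P(1) by (auto simp: omega_partition_def)
      qed
    qed
    moreover have "AE w in N. w \<in> F n \<longrightarrow> w \<in> A" for n
      using F unfolding \<A>_def by blast
    then have "AE w in N. \<forall>n. w \<in> F n \<longrightarrow> w \<in> A"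
      unfolding AE_all_countable by blast
    then have "AE w in N. w \<in> (\<Union>n. F n) \<longrightarrow> w \<in> A"
      by eventually_elim auto
    ultimately show "(\<Union>n. F n) \<in> \<A>"
      using FS by (auto simp: \<A>_def)
  qed
  then obtain B where B: "B \<in> \<A>" "\<And>C. C \<in> \<A> \<Longrightarrow> AE w in N. w \<in> C \<longrightarrow> w \<in> B"
    by blast
  define \<B> where "\<B> = {A' \<in> sets N. \<exists>v B. B \<in> sets N \<and> restr_elem N v B \<in> restr_set N V A \<and> A' \<subseteq> B \<and>
     (AE w in N. w \<in> A' \<longrightarrow> x w = v w)}"
  have BA_sub: "C \<in> \<A>" if CB: "C \<in> \<B>" for C
  proof -
    obtain u D where C: "C \<in> sets N" "D \<in> sets N" "restr_elem N u D \<in> restr_set N V A" "C \<subseteq> D"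
      "AE w in N. w \<in> C \<longrightarrow> x w = u w"
      using CB unfolding \<B>_def by blast
    then have D: "AE w in N. w \<in> A \<longleftrightarrow> w \<in> D"
      using restr_elem_in_restr_set_iff A by blast
    obtain v where v: "v \<in> V" "AE w in N. w \<in> A \<longrightarrow> u w = v w"
      using C restr_elem_in_restr_set_iff A by blast
    have "AE w in N. w \<in> C \<longrightarrow> w \<in> A"
      using D by eventually_elim (use C in auto)
    moreover have "AE w in N. w \<in> C \<longrightarrow> x w = v w"
      using D v(2) C(5) by eventually_elim (use C in auto)
    ultimately show ?thesis
      using C(1) v(1) unfolding \<A>_def by blast
  qed
  moreover have "B \<inter> A \<in> \<B>"
  proof -
    obtain v where "v \<in> V" "AE w in N. w \<in> B \<longrightarrow> x w = v w" and [measurable]: "B \<in> sets N"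
      using B(1) unfolding \<A>_def by blast
    moreover from this(2) have "AE w in N. w \<in> B \<inter> A \<longrightarrow> x w = v w"
      by eventually_elim simp
    moreover have "restr_elem N v A \<in> restr_set N V A"
      using \<open>v \<in> V\<close> by (simp add: restr_set_def)
    ultimately show ?thesis
      using A unfolding \<B>_def by blast
  qed
  moreover have BA: "AE w in N. w \<in> B \<longrightarrow> w \<in> B \<inter> A"
  proof -
    have "AE w in N. w \<in> B \<longrightarrow> w \<in> A"
      using B(1) unfolding \<A>_def by blast
    then show ?thesis
      by eventually_elim simp
  qed
  ultimately have "AE w in N. w \<in> C \<longrightarrow> w \<in> B \<inter> A" if "C \<in> \<B>" for C
  proof -
    have "AE w in N. w \<in> C \<longrightarrow> w \<in> B"
      using B(2) BA_sub that by blast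
    then show ?thesis
      using BA by eventually_elim auto
  qed
  moreover have "\<B> \<subseteq> sets N"
    by (auto simp: \<B>_def)
  ultimately have R: "ess_Union N \<B> \<in> sets N" "AE w in N. w \<in> ess_Union N \<B> \<longleftrightarrow> w \<in> B \<inter> A"
    using ess_Union_attained[of \<B> N "B \<inter> A"] \<open>B \<inter> A \<in> \<B>\<close> by blast+
  have reg: "region N (restr_set N V A) x = ess_Union N \<B>"
    by (simp add: region_def \<B>_def)
  show "region N (restr_set N V A) x \<in> sets N"
    using R reg by simp
  show "AE w in N. w \<in> region N (restr_set N V A) x \<longrightarrow> w \<in> A"
    using R(2) unfolding reg by eventually_elim auto
  obtain v where "v \<in> V" and v: "AE w in N. w \<in> B \<longrightarrow> x w = v w"
    using B(1) unfolding \<A>_def by blast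
  have "AE w in N. w \<in> region N (restr_set N V A) x \<longrightarrow> x w = v w"
    using R(2) v unfolding reg by eventually_elim auto
  with \<open>v \<in> V\<close> show "\<exists>v\<in>V. AE w in N. w \<in> region N (restr_set N V A) x \<longrightarrow> x w = v w"
    by blast
  fix C u assume "C \<in> sets N" "u \<in> V" "AE w in N. w \<in> C \<longrightarrow> w \<in> A" "AE w in N. w \<in> C \<longrightarrow> x w = u w"
  then have "C \<in> \<A>"
    unfolding \<A>_def by blast
  from B(2)[OF this] BA R(2) show "AE w in N. w \<in> C \<longrightarrow> w \<in> region N (restr_set N V A) x"
    unfolding reg by eventually_elim auto
qed

end

section \<open>Conditional sets and local maps\<close>

text \<open>Where \<open>x\<close> and \<open>y\<close> agree, so do \<open>\<phi> x\<close> and \<open>\<phi> y\<close>; one inclusion suffices, by exchanging \<open>x\<close> and \<open>y\<close>.\<close>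

definition local_map :: "'w measure \<Rightarrow> ('w \<Rightarrow> 'v) set \<Rightarrow> (('w \<Rightarrow> 'v) \<Rightarrow> 'w set) \<Rightarrow> bool" where
  "local_map N X \<phi> \<longleftrightarrow> (\<forall>x\<in>X. \<phi> x \<in> sets N) \<and>
     (\<forall>x\<in>X. \<forall>y\<in>X. \<forall>B\<in>sets N. (AE w in N. w \<in> B \<longrightarrow> x w = y w) \<longrightarrow>
        (AE w in N. w \<in> B \<longrightarrow> w \<in> \<phi> x \<longrightarrow> w \<in> \<phi> y))"

text \<open>The conditional set with membership regions \<open>\<phi> x\<close>: it lives on the largest of these regions, and
  consists there of the \<open>x\<close> for which \<open>\<phi> x\<close> is largest.\<close>

definition cond_set_of :: "'w measure \<Rightarrow> ('w \<Rightarrow> 'v) set \<Rightarrow> (('w \<Rightarrow> 'v) \<Rightarrow> 'w set) \<Rightarrow> ('w, 'v) cond_set" where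
  "cond_set_of N X \<phi> = (let D = ess_Union N (\<phi> ` X) in
     restr_set N {x \<in> X. AE w in N. w \<in> D \<longrightarrow> w \<in> \<phi> x} D)"

lemma local_mapD:
  assumes "local_map N X \<phi>" "x \<in> X" "y \<in> X" "B \<in> sets N" "AE w in N. w \<in> B \<longrightarrow> x w = y w"
  shows "AE w in N. w \<in> B \<longrightarrow> w \<in> \<phi> x \<longrightarrow> w \<in> \<phi> y"
  using assms unfolding local_map_def by blast

lemma local_map_sets: "local_map N X \<phi> \<Longrightarrow> x \<in> X \<Longrightarrow> \<phi> x \<in> sets N"
  unfolding local_map_def by blast

lemma local_map_glue:
  assumes "local_map N X \<phi>" "omega_partition N A" "\<And>k. x k \<in> X" "glue A x \<in> X"
  shows "AE w in N. \<forall>k. w \<in> A k \<longrightarrow> w \<in> \<phi> (glue A x) \<longleftrightarrow> w \<in> \<phi> (x k)"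
  unfolding AE_all_countable
proof
  fix k
  have A: "A k \<in> sets N" "disjoint_family A"
    using assms(2) by (auto simp: omega_partition_def)
  have "AE w in N. w \<in> A k \<longrightarrow> glue A x w = x k w" "AE w in N. w \<in> A k \<longrightarrow> x k w = glue A x w"
    using glue_eq[OF A(2), of _ k x] by auto
  from local_mapD[OF assms(1,4) assms(3) A(1) this(1)] local_mapD[OF assms(1) assms(3,4) A(1) this(2)]
  show "AE w in N. w \<in> A k \<longrightarrow> w \<in> \<phi> (glue A x) \<longleftrightarrow> w \<in> \<phi> (x k)"
    by eventually_elim blast
qed

context stable_space
begin

lemma ex_two_piece_glue:
  assumes "stable_set N V" "B \<in> sets N" "u \<in> V" "v \<in> V"
  obtains z where "z \<in> V" "AE w in N. w \<in> B \<longrightarrow> z w = u w" "AE w in N. w \<notin> B \<longrightarrow> z w = v w"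
proof -
  obtain P where P: "omega_partition N P" "P 0 = space N - (\<Union>n::nat. B)"
    "\<And>n. P (Suc n) \<subseteq> B" "(\<Union>n. P (Suc n)) = (\<Union>n::nat. B)"
    by (rule ex_partition_refining[of "\<lambda>_. B" N]) (use assms(2) in auto)
  define z where "z = glue P (\<lambda>n. if n = 0 then v else u)"
  have dj: "disjoint_family P"
    using P(1) by (simp add: omega_partition_def)
  have "z \<in> V"
    unfolding z_def using P(1) assms by (intro glue_in) auto
  moreover have "z w = u w" if "w \<in> B" for w
  proof -
    have "w \<in> (\<Union>n. P (Suc n))"
      unfolding P(4) using that by blast
    then obtain n where "w \<in> P (Suc n)"
      by blast
    then show ?thesis
      using glue_eq[OF dj, of w "Suc n" "\<lambda>n. if n = 0 then v else u"] by (simp add: z_def)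
  qed
  moreover have "z w = v w" if "w \<in> space N" "w \<notin> B" for w
    using glue_eq[OF dj, of w 0 "\<lambda>n. if n = 0 then v else u"] P(2) that by (simp add: z_def)
  ultimately show thesis
    by (intro that[of z]) auto
qed

text \<open>Regions are computed by exhibiting an event with a witness that contains every other such event.\<close>

lemma region_eqI:
  assumes V: "stable_set N V" and A: "A \<in> sets N" and D: "D \<in> sets N" "AE w in N. w \<in> D \<longrightarrow> w \<in> A"
    and v: "v \<in> V" "AE w in N. w \<in> D \<longrightarrow> x w = v w"
    and largest: "\<And>B v. \<lbrakk>B \<in> sets N; v \<in> V; AE w in N. w \<in> B \<longrightarrow> w \<in> A; AE w in N. w \<in> B \<longrightarrow> x w = v w\<rbrakk>
      \<Longrightarrow> AE w in N. w \<in> B \<longrightarrow> w \<in> D"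
  shows "AE w in N. w \<in> region N (restr_set N V A) x \<longleftrightarrow> w \<in> D"
proof -
  obtain u where u: "u \<in> V" "AE w in N. w \<in> region N (restr_set N V A) x \<longrightarrow> x w = u w"
    using region_witness[OF V A] by blast
  from largest[OF region_sets[OF V A] u(1) region_subset[OF V A] u(2)] region_largest[OF V A D(1) v(1) D(2) v(2)]
  show ?thesis
    by eventually_elim blast
qed

lemma restr_elem_in_iff_region:
  assumes V: "stable_set N V" and A: "A \<in> sets N" and B: "B \<in> sets N" "AE w in N. w \<in> B \<longrightarrow> w \<in> A"
  shows "restr_elem N x B \<in> restr_set N V B \<longleftrightarrow> (AE w in N. w \<in> B \<longrightarrow> w \<in> region N (restr_set N V A) x)"
proof
  assume "restr_elem N x B \<in> restr_set N V B"
  then obtain v where "v \<in> V" "AE w in N. w \<in> B \<longrightarrow> x w = v w"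
    using restr_elem_in_restr_set_iff[OF B(1) B(1)] by blast
  then show "AE w in N. w \<in> B \<longrightarrow> w \<in> region N (restr_set N V A) x"
    using region_largest[OF V A B(1) _ B(2)] by blast
next
  assume B_sub: "AE w in N. w \<in> B \<longrightarrow> w \<in> region N (restr_set N V A) x"
  obtain u where u: "u \<in> V" "AE w in N. w \<in> region N (restr_set N V A) x \<longrightarrow> x w = u w"
    using region_witness[OF V A] by blast
  from B_sub u(2) have "AE w in N. w \<in> B \<longrightarrow> x w = u w"
    by eventually_elim blast
  with u(1) show "restr_elem N x B \<in> restr_set N V B"
    unfolding restr_elem_in_restr_set_iff[OF B(1) B(1)] by auto
qed

lemma cond_powerE:
  assumes "C \<in> cond_power N X"
  obtains V A where "V \<subseteq> X" "stable_set N V" "A \<in> sets N" "C = restr_set N V A"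
  using assms unfolding cond_power_def stable_subsets_def by blast

lemma region_in_sets: "C \<in> cond_power N X \<Longrightarrow> region N C x \<in> sets N"
  using region_sets by (auto elim!: cond_powerE)

lemma local_map_region:
  assumes "C \<in> cond_power N X"
  shows "local_map N Y (region N C)"
  unfolding local_map_def
proof (intro conjI ballI impI)
  fix x y :: "'w \<Rightarrow> 'v" and B assume B: "B \<in> sets N" "AE w in N. w \<in> B \<longrightarrow> x w = y w"
  obtain V A where V: "stable_set N V" and A: "A \<in> sets N" and C: "C = restr_set N V A"
    using assms by (rule cond_powerE)
  obtain v where v: "v \<in> V" "AE w in N. w \<in> region N C x \<longrightarrow> x w = v w"
    using region_witness[OF V A] unfolding C by blast
  have "AE w in N. w \<in> B \<inter> region N C x \<longrightarrow> w \<in> A"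
    using region_subset[OF V A, of x] unfolding C by eventually_elim blast
  moreover have "AE w in N. w \<in> B \<inter> region N C x \<longrightarrow> y w = v w"
    using v(2) B(2) by eventually_elim auto
  ultimately have "AE w in N. w \<in> B \<inter> region N C x \<longrightarrow> w \<in> region N C y"
    by (intro region_largest[OF V A _ v(1), folded C] sets.Int B(1) region_in_sets[OF assms])
  then show "AE w in N. w \<in> B \<longrightarrow> w \<in> region N C x \<longrightarrow> w \<in> region N C y"
    by eventually_elim blast
qed (rule region_in_sets[OF assms])

lemma region_of_element:
  assumes V: "stable_set N V" and A: "A \<in> sets N" and "v \<in> V"
  shows "AE w in N. w \<in> region N (restr_set N V A) v \<longleftrightarrow> w \<in> A"
  by (rule region_eqI[OF V A A _ \<open>v \<in> V\<close>]) auto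

text \<open>An element \<open>v\<close> of \<open>V\<close> has region \<open>A\<close> in \<open>V|A\<close>, so an inclusion of regions, applied to the elements of
  \<open>V\<close>, recovers the inclusion of conditional sets.\<close>

lemma cond_le_iff_region:
  assumes C: "C \<in> cond_power N X" and D: "D \<in> cond_power N X"
  shows "cond_le N X C D \<longleftrightarrow> (\<forall>x\<in>X. AE w in N. w \<in> region N C x \<longrightarrow> w \<in> region N D x)"
proof
  assume "cond_le N X C D"
  then obtain V W A B where V: "V \<subseteq> X" "stable_set N V" and W: "stable_set N W"
    and A: "A \<in> sets N" and B: "B \<in> sets N"
    and eq: "C = restr_set N V A" "D = restr_set N W B"
    and AB: "AE w in N. w \<in> A \<longrightarrow> w \<in> B" and sub: "restr_set N V A \<subseteq> restr_set N W A"
    unfolding cond_le_def stable_subsets_def by blast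
  show "\<forall>x\<in>X. AE w in N. w \<in> region N C x \<longrightarrow> w \<in> region N D x"
  proof
    fix x
    obtain v where v: "v \<in> V" "AE w in N. w \<in> region N C x \<longrightarrow> x w = v w"
      using region_witness[OF V(2) A] unfolding eq by blast
    have "restr_elem N v A \<in> restr_set N W A"
      using sub v(1) unfolding restr_set_def by blast
    then obtain u where u: "u \<in> W" "AE w in N. w \<in> A \<longrightarrow> v w = u w"
      using restr_elem_in_restr_set_iff[OF A A] by blast
    have CA: "AE w in N. w \<in> region N C x \<longrightarrow> w \<in> A"
      using region_subset[OF V(2) A] unfolding eq .
    then have "AE w in N. w \<in> region N C x \<longrightarrow> w \<in> B"
      using AB by eventually_elim blast
    moreover have "AE w in N. w \<in> region N C x \<longrightarrow> x w = u w"
      using CA v(2) u(2) by eventually_elim auto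
    ultimately show "AE w in N. w \<in> region N C x \<longrightarrow> w \<in> region N D x"
      by (intro region_largest[OF W B region_in_sets[OF C] u(1), folded eq(2)])
  qed
next
  assume le: "\<forall>x\<in>X. AE w in N. w \<in> region N C x \<longrightarrow> w \<in> region N D x"
  obtain V A where V: "V \<subseteq> X" "stable_set N V" and A: "A \<in> sets N" and Ceq: "C = restr_set N V A"
    using C by (rule cond_powerE)
  obtain W B where W: "W \<subseteq> X" "stable_set N W" and B: "B \<in> sets N" and Deq: "D = restr_set N W B"
    using D by (rule cond_powerE)
  have AD: "AE w in N. w \<in> A \<longrightarrow> w \<in> region N D v" if "v \<in> V" for v
  proof -
    have "AE w in N. w \<in> region N C v \<longrightarrow> w \<in> region N D v"
      using le V(1) that by blast
    then show ?thesis
      using region_of_element[OF V(2) A that] unfolding Ceq by eventually_elim blast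
  qed
  obtain v0 where "v0 \<in> V"
    using V(2) by (auto simp: stable_set_def)
  have AB: "AE w in N. w \<in> A \<longrightarrow> w \<in> B"
    using AD[OF \<open>v0 \<in> V\<close>] region_subset[OF W(2) B, of v0] unfolding Deq by eventually_elim blast
  have "restr_set N V A \<subseteq> restr_set N W A"
    unfolding restr_set_def[of N V]
    using restr_elem_in_iff_region[OF W(2) B A AB] AD unfolding Deq by blast
  with V W A B AB Ceq Deq show "cond_le N X C D"
    unfolding cond_le_def stable_subsets_def by blast
qed

lemma cond_set_eqI:
  assumes C: "C \<in> cond_power N X" and D: "D \<in> cond_power N X"
    and eq: "\<And>x. x \<in> X \<Longrightarrow> AE w in N. w \<in> region N C x \<longleftrightarrow> w \<in> region N D x"
  shows "C = D"
proof -
  obtain V A where V: "V \<subseteq> X" "stable_set N V" and A: "A \<in> sets N" and Ceq: "C = restr_set N V A"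
    using C by (rule cond_powerE)
  obtain W B where W: "W \<subseteq> X" "stable_set N W" and B: "B \<in> sets N" and Deq: "D = restr_set N W B"
    using D by (rule cond_powerE)
  obtain v0 where v0: "v0 \<in> V"
    using V(2) by (auto simp: stable_set_def)
  obtain w0 where w0: "w0 \<in> W"
    using W(2) by (auto simp: stable_set_def)
  have eqV: "AE w in N. w \<in> region N C v \<longleftrightarrow> w \<in> region N D v" if "v \<in> V" for v
    using eq V(1) that by blast
  have eqW: "AE w in N. w \<in> region N C v \<longleftrightarrow> w \<in> region N D v" if "v \<in> W" for v
    using eq W(1) that by blast
  have rV: "AE w in N. w \<in> region N C v \<longleftrightarrow> w \<in> A" if "v \<in> V" for v
    using region_of_element[OF V(2) A that] unfolding Ceq .
  have rW: "AE w in N. w \<in> region N D v \<longleftrightarrow> w \<in> B" if "v \<in> W" for v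
    using region_of_element[OF W(2) B that] unfolding Deq .
  have AB: "AE w in N. w \<in> A \<longleftrightarrow> w \<in> B"
    using rV[OF v0] eqV[OF v0] region_subset[OF W(2) B, of v0, folded Deq]
      rW[OF w0] eqW[OF w0] region_subset[OF V(2) A, of w0, folded Ceq]
    by eventually_elim blast
  have VA: "restr_elem N x A = restr_elem N x B" for x
    unfolding restr_elem_eq_iff[OF A B] using AB by auto
  have "restr_set N V A \<subseteq> restr_set N W B"
  proof -
    have "restr_elem N v B \<in> restr_set N W B" if "v \<in> V" for v
    proof -
      have "AE w in N. w \<in> B \<longrightarrow> w \<in> region N D v"
        using rV[OF that] eqV[OF that] AB by eventually_elim blast
      then show ?thesis
        using restr_elem_in_iff_region[OF W(2) B B] unfolding Deq by auto
    qed
    then show ?thesis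
      unfolding restr_set_def[of N V] VA by blast
  qed
  moreover have "restr_set N W B \<subseteq> restr_set N V A"
  proof -
    have "restr_elem N v A \<in> restr_set N V A" if "v \<in> W" for v
    proof -
      have "AE w in N. w \<in> A \<longrightarrow> w \<in> region N C v"
        using rW[OF that] eqW[OF that] AB by eventually_elim blast
      then show ?thesis
        using restr_elem_in_iff_region[OF V(2) A A] unfolding Ceq by auto
    qed
    then show ?thesis
      unfolding restr_set_def[of N W] VA[symmetric] by blast
  qed
  ultimately show ?thesis
    unfolding Ceq Deq by blast
qed

text \<open>The supremum of all regions is the region of a single element, by gluing elements along a
  partition. This is where stability of \<open>X\<close> enters.\<close>

lemma local_map_attains_sup:
  assumes \<phi>: "local_map N X \<phi>"
  obtains x0 where "x0 \<in> X" "\<And>x. x \<in> X \<Longrightarrow> AE w in N. w \<in> \<phi> x \<longrightarrow> w \<in> \<phi> x0"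
proof -
  define \<A> where "\<A> = {A \<in> sets N. \<exists>x\<in>X. AE w in N. w \<in> A \<longrightarrow> w \<in> \<phi> x}"
  have "\<exists>B\<in>\<A>. \<forall>A\<in>\<A>. AE w in N. w \<in> A \<longrightarrow> w \<in> B"
  proof (rule ex_AE_largest_member)
    show "\<A> \<subseteq> sets N"
      by (auto simp: \<A>_def)
    show "\<A> \<noteq> {}"
      using nonempty by (auto simp: \<A>_def intro!: exI[of _ "{}"])
    fix F :: "nat \<Rightarrow> 'w set"
    assume F: "range F \<subseteq> \<A>"
    then have FS: "range F \<subseteq> sets N"
      by (auto simp: \<A>_def)
    from F have "\<exists>x\<in>X. AE w in N. w \<in> F n \<longrightarrow> w \<in> \<phi> x" for n
      unfolding \<A>_def by blast
    then obtain x where x: "\<And>n. x n \<in> X" "\<And>n. AE w in N. w \<in> F n \<longrightarrow> w \<in> \<phi> (x n)"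
      by metis
    obtain P where P: "omega_partition N P" "\<And>n. P (Suc n) \<subseteq> F n" "(\<Union>n. P (Suc n)) = (\<Union>n. F n)"
      using ex_partition_refining[OF FS] by metis
    let ?u = "glue P (\<lambda>n. x (n - 1))"
    have u: "?u \<in> X"
      using P stable x by (intro glue_in) auto
    have "AE w in N. \<forall>n. w \<in> F n \<longrightarrow> w \<in> \<phi> (x n)"
      unfolding AE_all_countable using x(2) by blast
    then have "AE w in N. w \<in> (\<Union>n. F n) \<longrightarrow> w \<in> \<phi> ?u"
      using local_map_glue[OF \<phi> P(1) x(1) u]
    proof eventually_elim
      case (elim w)
      show ?case
      proof
        assume "w \<in> (\<Union>n. F n)"
        then obtain n where n: "w \<in> P (Suc n)"
          using P(3) by blast
        then have "w \<in> \<phi> ?u \<longleftrightarrow> w \<in> \<phi> (x n)"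
          using elim(2)[rule_format, OF n] by simp
        then show "w \<in> \<phi> ?u"
          using elim(1) n P(2)[of n] by blast
      qed
    qed
    moreover have "(\<Union>n. F n) \<in> sets N"
      using FS by blast
    ultimately show "(\<Union>n. F n) \<in> \<A>"
      using u unfolding \<A>_def by blast
  qed
  then obtain B where B: "B \<in> \<A>" "\<And>A. A \<in> \<A> \<Longrightarrow> AE w in N. w \<in> A \<longrightarrow> w \<in> B"
    by blast
  then obtain x0 where x0: "x0 \<in> X" "AE w in N. w \<in> B \<longrightarrow> w \<in> \<phi> x0"
    unfolding \<A>_def by blast
  have "AE w in N. w \<in> \<phi> x \<longrightarrow> w \<in> \<phi> x0" if "x \<in> X" for x
  proof -
    have "\<phi> x \<in> \<A>"
      unfolding \<A>_def using that local_map_sets[OF \<phi>] by auto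
    from B(2)[OF this] x0(2) show ?thesis
      by eventually_elim blast
  qed
  with x0(1) show thesis
    by (rule that)
qed

text \<open>To see that \<open>x\<close> is in the set on \<open>\<phi> x\<close>, replace it off \<open>\<phi> x\<close> by an element \<open>x0\<close> of largest region: by
  locality the result has region \<open>D\<close> and so belongs to the set. The event \<open>D\<close> is kept as a parameter,
  because it is given by an essential union of another family in the definition of preimages.\<close>

lemma
  assumes \<phi>: "local_map N X \<phi>" and D: "D \<in> sets N"
    and sub: "\<And>x. x \<in> X \<Longrightarrow> AE w in N. w \<in> \<phi> x \<longrightarrow> w \<in> D"
    and x0: "x0 \<in> X" "AE w in N. w \<in> D \<longrightarrow> w \<in> \<phi> x0"
  shows realization_in: "restr_set N {x \<in> X. AE w in N. w \<in> D \<longrightarrow> w \<in> \<phi> x} D \<in> cond_power N X" (is "?C \<in> _")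
    and region_realization: "\<And>x. x \<in> X \<Longrightarrow>
      AE w in N. w \<in> region N (restr_set N {x \<in> X. AE w in N. w \<in> D \<longrightarrow> w \<in> \<phi> x} D) x \<longleftrightarrow> w \<in> \<phi> x"
proof -
  let ?V = "{x \<in> X. AE w in N. w \<in> D \<longrightarrow> w \<in> \<phi> x}"
  have V: "stable_set N ?V"
    unfolding stable_set_def
  proof (intro conjI allI impI)
    show "?V \<noteq> {}"
      using x0 by blast
    fix A and x :: "nat \<Rightarrow> 'w \<Rightarrow> 'v" assume "omega_partition N A \<and> (\<forall>k. x k \<in> ?V)"
    then have A: "omega_partition N A" and x: "\<And>k. x k \<in> X" "\<And>k. AE w in N. w \<in> D \<longrightarrow> w \<in> \<phi> (x k)"
      by auto
    have g: "glue A x \<in> X"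
      using A x(1) stable by (rule glue_in)
    have "AE w in N. \<forall>k. w \<in> D \<longrightarrow> w \<in> \<phi> (x k)"
      unfolding AE_all_countable using x(2) by blast
    with local_map_glue[OF \<phi> A x(1) g] AE_space have "AE w in N. w \<in> D \<longrightarrow> w \<in> \<phi> (glue A x)"
      by eventually_elim (use omega_partition_index[OF A] in blast)
    with g show "glue A x \<in> ?V"
      by blast
  qed
  then show "?C \<in> cond_power N X"
    using D unfolding cond_power_def stable_subsets_def by blast
  fix x assume x: "x \<in> X"
  obtain z where z: "z \<in> X" "AE w in N. w \<in> \<phi> x \<longrightarrow> z w = x w" "AE w in N. w \<notin> \<phi> x \<longrightarrow> z w = x0 w"
    using ex_two_piece_glue[OF stable local_map_sets[OF \<phi> x] x x0(1)] by blast
  show "AE w in N. w \<in> region N ?C x \<longleftrightarrow> w \<in> \<phi> x"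
  proof (rule region_eqI[OF V D local_map_sets[OF \<phi> x] sub[OF x]])
    have 1: "AE w in N. w \<in> \<phi> x \<longrightarrow> x w = z w"
      using z(2) by eventually_elim simp
    have 2: "AE w in N. w \<in> space N - \<phi> x \<longrightarrow> x0 w = z w"
      using z(3) by eventually_elim simp
    show "AE w in N. w \<in> \<phi> x \<longrightarrow> x w = z w"
      by (rule 1)
    have "AE w in N. w \<in> D \<longrightarrow> w \<in> \<phi> z"
      using local_mapD[OF \<phi> x z(1) local_map_sets[OF \<phi> x] 1] x0(2) AE_space
        local_mapD[OF \<phi> x0(1) z(1) sets.compl_sets[OF local_map_sets[OF \<phi> x]] 2]
      by eventually_elim blast
    then show "z \<in> ?V"
      using z(1) by blast
    fix B v assume B: "B \<in> sets N" and v: "v \<in> ?V"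
      and BD: "AE w in N. w \<in> B \<longrightarrow> w \<in> D" and eq: "AE w in N. w \<in> B \<longrightarrow> x w = v w"
    have eq': "AE w in N. w \<in> B \<longrightarrow> v w = x w"
      using eq by eventually_elim simp
    have vX: "v \<in> X" and vD: "AE w in N. w \<in> D \<longrightarrow> w \<in> \<phi> v"
      using v by auto
    show "AE w in N. w \<in> B \<longrightarrow> w \<in> \<phi> x"
      using local_mapD[OF \<phi> vX x B eq'] vD BD by eventually_elim blast
  qed
qed

text \<open>Together with \<open>cond_set_eqI\<close> this makes conditional sets and local maps modulo null sets equivalent.\<close>

lemma
  assumes \<phi>: "local_map N X \<phi>"
  shows cond_set_of_in: "cond_set_of N X \<phi> \<in> cond_power N X"
    and region_cond_set_of: "\<And>x. x \<in> X \<Longrightarrow> AE w in N. w \<in> region N (cond_set_of N X \<phi>) x \<longleftrightarrow> w \<in> \<phi> x"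
proof -
  obtain x0 where x0: "x0 \<in> X" "\<And>x. x \<in> X \<Longrightarrow> AE w in N. w \<in> \<phi> x \<longrightarrow> w \<in> \<phi> x0"
    using local_map_attains_sup[OF \<phi>] by blast
  let ?D = "ess_Union N (\<phi> ` X)"
  have D: "?D \<in> sets N" "AE w in N. w \<in> ?D \<longleftrightarrow> w \<in> \<phi> x0"
    using ess_Union_attained[of "\<phi> ` X" N "\<phi> x0"] local_map_sets[OF \<phi>] x0 by blast+
  have 1: "AE w in N. w \<in> \<phi> x \<longrightarrow> w \<in> ?D" if "x \<in> X" for x
    using D(2) x0(2)[OF that] by eventually_elim blast
  have 2: "AE w in N. w \<in> ?D \<longrightarrow> w \<in> \<phi> x0"
    using D(2) by eventually_elim blast
  show "cond_set_of N X \<phi> \<in> cond_power N X"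
    unfolding cond_set_of_def Let_def by (rule realization_in[OF \<phi> D(1) 1 x0(1) 2])
  show "\<And>x. x \<in> X \<Longrightarrow> AE w in N. w \<in> region N (cond_set_of N X \<phi>) x \<longleftrightarrow> w \<in> \<phi> x"
    unfolding cond_set_of_def Let_def by (rule region_realization[OF \<phi> D(1) 1 x0(1) 2])
qed

lemma cond_set_eq_of_region:
  assumes "C \<in> cond_power N X" "local_map N X \<phi>" "\<And>x. x \<in> X \<Longrightarrow> AE w in N. w \<in> region N C x \<longleftrightarrow> w \<in> \<phi> x"
  shows "C = cond_set_of N X \<phi>"
proof (rule cond_set_eqI[OF assms(1) cond_set_of_in[OF assms(2)]])
  fix x assume "x \<in> X"
  from assms(3)[OF this] region_cond_set_of[OF assms(2) this]
  show "AE w in N. w \<in> region N C x \<longleftrightarrow> w \<in> region N (cond_set_of N X \<phi>) x"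
    by eventually_elim blast
qed

end

section \<open>The Boolean operations on regions\<close>

lemma local_map_const: "A \<in> sets N \<Longrightarrow> local_map N X (\<lambda>_. A)"
  by (simp add: local_map_def)

lemma local_map_compl:
  assumes "local_map N X \<phi>"
  shows "local_map N X (\<lambda>x. space N - \<phi> x)"
  unfolding local_map_def
proof (intro conjI ballI impI)
  fix x y B assume *: "x \<in> X" "y \<in> X" "B \<in> sets N" and eq: "AE w in N. w \<in> B \<longrightarrow> x w = y w"
  have "AE w in N. w \<in> B \<longrightarrow> y w = x w"
    using eq by eventually_elim simp
  from local_mapD[OF assms *(2,1,3) this]
  show "AE w in N. w \<in> B \<longrightarrow> w \<in> space N - \<phi> x \<longrightarrow> w \<in> space N - \<phi> y"
    by eventually_elim blast
qed (use local_map_sets[OF assms] in blast)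

lemma local_map_UN:
  assumes "countable I" "\<And>i. i \<in> I \<Longrightarrow> local_map N X (\<phi> i)"
  shows "local_map N X (\<lambda>x. \<Union>i\<in>I. \<phi> i x)"
  unfolding local_map_def
proof (intro conjI ballI impI)
  fix x y B assume *: "x \<in> X" "y \<in> X" "B \<in> sets N" "AE w in N. w \<in> B \<longrightarrow> x w = y w"
  have "AE w in N. \<forall>i\<in>I. w \<in> B \<longrightarrow> w \<in> \<phi> i x \<longrightarrow> w \<in> \<phi> i y"
    unfolding AE_ball_countable[OF assms(1)] using local_mapD[OF assms(2) *] by blast
  then show "AE w in N. w \<in> B \<longrightarrow> w \<in> (\<Union>i\<in>I. \<phi> i x) \<longrightarrow> w \<in> (\<Union>i\<in>I. \<phi> i y)"
    by eventually_elim blast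
qed (use local_map_sets[OF assms(2)] assms(1) in blast)

lemma local_map_Int:
  assumes "local_map N X \<phi>" "local_map N X \<psi>"
  shows "local_map N X (\<lambda>x. \<phi> x \<inter> \<psi> x)"
  unfolding local_map_def
proof (intro conjI ballI impI)
  fix x y B assume *: "x \<in> X" "y \<in> X" "B \<in> sets N" "AE w in N. w \<in> B \<longrightarrow> x w = y w"
  from local_mapD[OF assms(1) *] local_mapD[OF assms(2) *]
  show "AE w in N. w \<in> B \<longrightarrow> w \<in> \<phi> x \<inter> \<psi> x \<longrightarrow> w \<in> \<phi> y \<inter> \<psi> y"
    by eventually_elim blast
qed (use local_map_sets[OF assms(1)] local_map_sets[OF assms(2)] in blast)

lemma local_map_Un:
  assumes "local_map N X \<phi>" "local_map N X \<psi>"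
  shows "local_map N X (\<lambda>x. \<phi> x \<union> \<psi> x)"
  unfolding local_map_def
proof (intro conjI ballI impI)
  fix x y B assume *: "x \<in> X" "y \<in> X" "B \<in> sets N" "AE w in N. w \<in> B \<longrightarrow> x w = y w"
  from local_mapD[OF assms(1) *] local_mapD[OF assms(2) *]
  show "AE w in N. w \<in> B \<longrightarrow> w \<in> \<phi> x \<union> \<psi> x \<longrightarrow> w \<in> \<phi> y \<union> \<psi> y"
    by eventually_elim blast
qed (use local_map_sets[OF assms(1)] local_map_sets[OF assms(2)] in blast)

context stable_space
begin

lemma cond_set_of_cong:
  assumes "local_map N X \<phi>" "local_map N X \<psi>" "\<And>x. x \<in> X \<Longrightarrow> AE w in N. w \<in> \<phi> x \<longleftrightarrow> w \<in> \<psi> x"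
  shows "cond_set_of N X \<phi> = cond_set_of N X \<psi>"
proof (rule cond_set_eq_of_region[OF cond_set_of_in[OF assms(1)] assms(2)])
  fix x assume "x \<in> X"
  from assms(3)[OF this] region_cond_set_of[OF assms(1) this]
  show "AE w in N. w \<in> region N (cond_set_of N X \<phi>) x \<longleftrightarrow> w \<in> \<psi> x"
    by eventually_elim blast
qed

lemma cond_le_antisym:
  assumes "C \<in> cond_power N X" "D \<in> cond_power N X" "cond_le N X C D" "cond_le N X D C"
  shows "C = D"
proof (rule cond_set_eqI[OF assms(1,2)])
  fix x assume "x \<in> X"
  then have "AE w in N. w \<in> region N C x \<longrightarrow> w \<in> region N D x" "AE w in N. w \<in> region N D x \<longrightarrow> w \<in> region N C x"
    using assms(3,4) unfolding cond_le_iff_region[OF assms(1,2)] cond_le_iff_region[OF assms(2,1)] by blast+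
  then show "AE w in N. w \<in> region N C x \<longleftrightarrow> w \<in> region N D x"
    by eventually_elim blast
qed

text \<open>Suprema in \<^const>\<open>cond_order\<close> are chosen by Hilbert's operator among least upper bounds, of which
  there is at most one by antisymmetry.\<close>

lemma Sup_eqI:
  assumes "\<C> \<subseteq> cond_power N X" "C \<in> cond_power N X" "\<And>D. D \<in> \<C> \<Longrightarrow> cond_le N X D C"
    "\<And>U. U \<in> cond_power N X \<Longrightarrow> (\<And>D. D \<in> \<C> \<Longrightarrow> cond_le N X D U) \<Longrightarrow> cond_le N X C U"
  shows "\<Squnion>\<^bsub>cond_order N X\<^esub> \<C> = C"
proof -
  have U: "Upper (cond_order N X) \<C> = {U \<in> cond_power N X. \<forall>D\<in>\<C>. cond_le N X D U}"
    using assms(1) unfolding Upper_def cond_order_def by auto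
  have "least (cond_order N X) C (Upper (cond_order N X) \<C>)"
    unfolding U unfolding least_def cond_order_def using assms by auto
  moreover have "D = C" if "least (cond_order N X) D (Upper (cond_order N X) \<C>)" for D
  proof (rule cond_le_antisym)
    show "D \<in> cond_power N X" "C \<in> cond_power N X" "cond_le N X D C" "cond_le N X C D"
      using that assms unfolding U unfolding least_def cond_order_def by auto
  qed
  ultimately show ?thesis
    unfolding Lattice.sup_def by (rule some_equality)
qed

lemma Inf_eqI:
  assumes "\<C> \<subseteq> cond_power N X" "C \<in> cond_power N X" "\<And>D. D \<in> \<C> \<Longrightarrow> cond_le N X C D"
    "\<And>U. U \<in> cond_power N X \<Longrightarrow> (\<And>D. D \<in> \<C> \<Longrightarrow> cond_le N X U D) \<Longrightarrow> cond_le N X U C"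
  shows "\<Sqinter>\<^bsub>cond_order N X\<^esub> \<C> = C"
proof -
  have U: "Lower (cond_order N X) \<C> = {U \<in> cond_power N X. \<forall>D\<in>\<C>. cond_le N X U D}"
    using assms(1) unfolding Lower_def cond_order_def by auto
  have "greatest (cond_order N X) C (Lower (cond_order N X) \<C>)"
    unfolding U unfolding greatest_def cond_order_def using assms by auto
  moreover have "D = C" if "greatest (cond_order N X) D (Lower (cond_order N X) \<C>)" for D
  proof (rule cond_le_antisym)
    show "D \<in> cond_power N X" "C \<in> cond_power N X" "cond_le N X D C" "cond_le N X C D"
      using that assms unfolding U unfolding greatest_def cond_order_def by auto
  qed
  ultimately show ?thesis
    unfolding Lattice.inf_def by (rule some_equality)
qed

lemma Sup_eq_cond_set_of:
  assumes I: "countable I" and C: "\<And>i. i \<in> I \<Longrightarrow> C i \<in> cond_power N X"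
  shows "\<Squnion>\<^bsub>cond_order N X\<^esub> (C ` I) = cond_set_of N X (\<lambda>x. \<Union>i\<in>I. region N (C i) x)"
proof (rule Sup_eqI)
  let ?\<phi> = "\<lambda>x. \<Union>i\<in>I. region N (C i) x"
  have \<phi>: "local_map N X ?\<phi>"
    using I local_map_region[OF C] by (rule local_map_UN)
  show "C ` I \<subseteq> cond_power N X"
    using C by blast
  show in_power: "cond_set_of N X ?\<phi> \<in> cond_power N X"
    using \<phi> by (rule cond_set_of_in)
  fix D assume "D \<in> C ` I"
  then obtain i where i: "i \<in> I" "D = C i"
    by blast
  show "cond_le N X D (cond_set_of N X ?\<phi>)"
    unfolding i(2) cond_le_iff_region[OF C[OF i(1)] in_power]
  proof
    fix x assume "x \<in> X"
    from region_cond_set_of[OF \<phi> this]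
    show "AE w in N. w \<in> region N (C i) x \<longrightarrow> w \<in> region N (cond_set_of N X ?\<phi>) x"
      by eventually_elim (use i(1) in blast)
  qed
next
  let ?\<phi> = "\<lambda>x. \<Union>i\<in>I. region N (C i) x"
  have \<phi>: "local_map N X ?\<phi>"
    using I local_map_region[OF C] by (rule local_map_UN)
  fix U assume U: "U \<in> cond_power N X" "\<And>D. D \<in> C ` I \<Longrightarrow> cond_le N X D U"
  show "cond_le N X (cond_set_of N X ?\<phi>) U"
    unfolding cond_le_iff_region[OF cond_set_of_in[OF \<phi>] U(1)]
  proof
    fix x assume x: "x \<in> X"
    have "AE w in N. w \<in> region N (C i) x \<longrightarrow> w \<in> region N U x" if "i \<in> I" for i
      using U(2)[of "C i"] x that unfolding cond_le_iff_region[OF C[OF that] U(1)] by blast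
    then have "AE w in N. \<forall>i\<in>I. w \<in> region N (C i) x \<longrightarrow> w \<in> region N U x"
      unfolding AE_ball_countable[OF I] by blast
    with region_cond_set_of[OF \<phi> x]
    show "AE w in N. w \<in> region N (cond_set_of N X ?\<phi>) x \<longrightarrow> w \<in> region N U x"
      by eventually_elim blast
  qed
qed

lemma join_eq_cond_set_of:
  assumes "C \<in> cond_power N X" "D \<in> cond_power N X"
  shows "C \<squnion>\<^bsub>cond_order N X\<^esub> D = cond_set_of N X (\<lambda>x. region N C x \<union> region N D x)"
proof -
  have "C \<squnion>\<^bsub>cond_order N X\<^esub> D = \<Squnion>\<^bsub>cond_order N X\<^esub> ((\<lambda>b. if b then C else D) ` UNIV)"
    by (simp add: join_def UNIV_bool insert_commute)
  also have "\<dots> = cond_set_of N X (\<lambda>x. \<Union>b\<in>UNIV. region N (if b then C else D) x)"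
    using assms by (intro Sup_eq_cond_set_of) auto
  also have "(\<lambda>x. \<Union>b\<in>UNIV. region N (if b then C else D) x) = (\<lambda>x. region N C x \<union> region N D x)"
    by (auto simp: UNIV_bool)
  finally show ?thesis .
qed

lemma meet_eq_cond_set_of:
  assumes C: "C \<in> cond_power N X" and D: "D \<in> cond_power N X"
  shows "C \<sqinter>\<^bsub>cond_order N X\<^esub> D = cond_set_of N X (\<lambda>x. region N C x \<inter> region N D x)"
proof -
  let ?\<phi> = "\<lambda>x. region N C x \<inter> region N D x"
  have \<phi>: "local_map N X ?\<phi>"
    using local_map_region[OF C] local_map_region[OF D] by (rule local_map_Int)
  note P = cond_set_of_in[OF \<phi>]
  show ?thesis
    unfolding meet_def
  proof (rule Inf_eqI)
    show "{C, D} \<subseteq> cond_power N X"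
      using C D by blast
    show "cond_set_of N X ?\<phi> \<in> cond_power N X"
      by (rule P)
    have "cond_le N X (cond_set_of N X ?\<phi>) C"
      unfolding cond_le_iff_region[OF P C]
    proof
      fix x assume "x \<in> X"
      from region_cond_set_of[OF \<phi> this]
      show "AE w in N. w \<in> region N (cond_set_of N X ?\<phi>) x \<longrightarrow> w \<in> region N C x"
        by eventually_elim blast
    qed
    moreover have "cond_le N X (cond_set_of N X ?\<phi>) D"
      unfolding cond_le_iff_region[OF P D]
    proof
      fix x assume "x \<in> X"
      from region_cond_set_of[OF \<phi> this]
      show "AE w in N. w \<in> region N (cond_set_of N X ?\<phi>) x \<longrightarrow> w \<in> region N D x"
        by eventually_elim blast
    qed
    ultimately show "cond_le N X (cond_set_of N X ?\<phi>) B" if "B \<in> {C, D}" for B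
      using that by blast
    fix U assume U: "U \<in> cond_power N X" "\<And>B. B \<in> {C, D} \<Longrightarrow> cond_le N X U B"
    show "cond_le N X U (cond_set_of N X ?\<phi>)"
      unfolding cond_le_iff_region[OF U(1) P]
    proof
      fix x assume x: "x \<in> X"
      have "AE w in N. w \<in> region N U x \<longrightarrow> w \<in> region N C x"
        using U(2)[of C] x unfolding cond_le_iff_region[OF U(1) C] by blast
      moreover have "AE w in N. w \<in> region N U x \<longrightarrow> w \<in> region N D x"
        using U(2)[of D] x unfolding cond_le_iff_region[OF U(1) D] by blast
      ultimately show "AE w in N. w \<in> region N U x \<longrightarrow> w \<in> region N (cond_set_of N X ?\<phi>) x"
        using region_cond_set_of[OF \<phi> x] by eventually_elim blast
    qed
  qed
qed

lemma restr_set_full_in: "A \<in> sets N \<Longrightarrow> restr_set N X A \<in> cond_power N X"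
  unfolding cond_power_def stable_subsets_def using stable by blast

lemma restr_set_full_eq_cond_set_of:
  assumes "A \<in> sets N"
  shows "restr_set N X A = cond_set_of N X (\<lambda>_. A)"
  by (intro cond_set_eq_of_region restr_set_full_in region_of_element local_map_const stable assms)

lemma cond_full_eq_cond_set_of: "cond_full N X = cond_set_of N X (\<lambda>_. space N)"
  unfolding cond_full_def by (rule restr_set_full_eq_cond_set_of) simp

lemma cond_empty_eq_cond_set_of: "cond_empty N X = cond_set_of N X (\<lambda>_. {})"
  unfolding cond_empty_def by (rule restr_set_full_eq_cond_set_of) simp

lemma cond_set_of_eq_iff:
  assumes "local_map N X \<phi>" "local_map N X \<psi>"
  shows "cond_set_of N X \<phi> = cond_set_of N X \<psi> \<longleftrightarrow> (\<forall>x\<in>X. AE w in N. w \<in> \<phi> x \<longleftrightarrow> w \<in> \<psi> x)"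
proof
  assume eq: "cond_set_of N X \<phi> = cond_set_of N X \<psi>"
  show "\<forall>x\<in>X. AE w in N. w \<in> \<phi> x \<longleftrightarrow> w \<in> \<psi> x"
  proof
    fix x assume x: "x \<in> X"
    from region_cond_set_of[OF assms(1) x] region_cond_set_of[OF assms(2) x]
    show "AE w in N. w \<in> \<phi> x \<longleftrightarrow> w \<in> \<psi> x"
      unfolding eq by eventually_elim blast
  qed
qed (intro cond_set_of_cong assms, blast)

lemma cond_disjoint_iff_region:
  assumes C: "C \<in> cond_power N X" and D: "D \<in> cond_power N X"
  shows "cond_disjoint N X C D \<longleftrightarrow> (\<forall>x\<in>X. AE w in N. \<not> (w \<in> region N C x \<and> w \<in> region N D x))"
  unfolding cond_disjoint_def meet_eq_cond_set_of[OF assms] cond_empty_eq_cond_set_of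
  by (subst cond_set_of_eq_iff[OF local_map_Int[OF local_map_region[OF C] local_map_region[OF D]]
      local_map_const]) auto

text \<open>Having join \<open>X\<close> and meet \<open>{*}\<close> with \<open>C\<close> says that the regions are complementary events, so there is
  exactly one complement.\<close>

lemma cond_compl_eq_cond_set_of:
  assumes C: "C \<in> cond_power N X"
  shows "cond_compl N X C = cond_set_of N X (\<lambda>x. space N - region N C x)"
  unfolding cond_compl_def
proof (rule the_equality)
  let ?\<phi> = "\<lambda>x. space N - region N C x"
  have \<phi>: "local_map N X ?\<phi>"
    using local_map_region[OF C] by (rule local_map_compl)
  note P = cond_set_of_in[OF \<phi>]
  have char: "(C \<squnion>\<^bsub>cond_order N X\<^esub> D = cond_full N X \<and> C \<sqinter>\<^bsub>cond_order N X\<^esub> D = cond_empty N X) \<longleftrightarrow>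
      (\<forall>x\<in>X. AE w in N. w \<in> region N D x \<longleftrightarrow> w \<in> ?\<phi> x)" if D: "D \<in> cond_power N X" for D
  proof -
    have un: "local_map N X (\<lambda>x. region N C x \<union> region N D x)"
      by (intro local_map_Un local_map_region C D)
    have "C \<squnion>\<^bsub>cond_order N X\<^esub> D = cond_full N X \<longleftrightarrow>
        (\<forall>x\<in>X. AE w in N. w \<in> region N C x \<union> region N D x \<longleftrightarrow> w \<in> space N)"
      unfolding join_eq_cond_set_of[OF C D] cond_full_eq_cond_set_of
      by (rule cond_set_of_eq_iff[OF un local_map_const]) simp
    moreover have "C \<sqinter>\<^bsub>cond_order N X\<^esub> D = cond_empty N X \<longleftrightarrow>
        (\<forall>x\<in>X. AE w in N. \<not> (w \<in> region N C x \<and> w \<in> region N D x))"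
      using cond_disjoint_iff_region[OF C D] unfolding cond_disjoint_def .
    moreover have "((AE w in N. w \<in> region N C x \<union> region N D x \<longleftrightarrow> w \<in> space N) \<and>
        (AE w in N. \<not> (w \<in> region N C x \<and> w \<in> region N D x))) \<longleftrightarrow>
        (AE w in N. w \<in> region N D x \<longleftrightarrow> w \<in> ?\<phi> x)" for x
    proof (intro iffI conjI; (elim conjE)?)
      assume "AE w in N. w \<in> region N C x \<union> region N D x \<longleftrightarrow> w \<in> space N"
        "AE w in N. \<not> (w \<in> region N C x \<and> w \<in> region N D x)"
      with AE_space show "AE w in N. w \<in> region N D x \<longleftrightarrow> w \<in> ?\<phi> x"
        by eventually_elim blast
    next
      assume *: "AE w in N. w \<in> region N D x \<longleftrightarrow> w \<in> ?\<phi> x"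
      show "AE w in N. w \<in> region N C x \<union> region N D x \<longleftrightarrow> w \<in> space N"
        using * AE_space by eventually_elim blast
      show "AE w in N. \<not> (w \<in> region N C x \<and> w \<in> region N D x)"
        using * by eventually_elim blast
    qed
    ultimately show ?thesis
      by blast
  qed
  show "cond_set_of N X ?\<phi> \<in> cond_power N X \<and>
      C \<squnion>\<^bsub>cond_order N X\<^esub> cond_set_of N X ?\<phi> = cond_full N X \<and>
      C \<sqinter>\<^bsub>cond_order N X\<^esub> cond_set_of N X ?\<phi> = cond_empty N X"
    using P char[OF P] region_cond_set_of[OF \<phi>] by blast
  fix D assume D: "D \<in> cond_power N X \<and> C \<squnion>\<^bsub>cond_order N X\<^esub> D = cond_full N X \<and>
      C \<sqinter>\<^bsub>cond_order N X\<^esub> D = cond_empty N X"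
  then show "D = cond_set_of N X ?\<phi>"
    using char[of D] by (intro cond_set_eq_of_region \<phi>) blast+
qed

text \<open>Gluing along \<open>P\<close> the gluings along \<open>A\<close> is the same as gluing along \<open>A\<close> the gluings along \<open>P\<close>.\<close>

lemma glue_sets_stable:
  assumes A: "omega_partition N A" and V: "\<And>k. V k \<in> stable_subsets N X"
  shows "glue_sets A V \<in> stable_subsets N X"
proof -
  have VX: "V k \<subseteq> X" and Vs: "stable_set N (V k)" for k
    using V[of k] by (auto simp: stable_subsets_def)
  have "\<exists>v. v \<in> V k" for k
    using Vs[of k] by (auto simp: stable_set_def)
  then obtain v where v: "\<And>k. v k \<in> V k"
    by metis
  have "glue A x \<in> X" if "\<And>k. x k \<in> V k" for x
    using A VX that stable by (intro glue_in) blast+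
  then have "glue_sets A V \<subseteq> X"
    unfolding glue_sets_def by blast
  moreover have "stable_set N (glue_sets A V)"
    unfolding stable_set_def
  proof (intro conjI allI impI)
    show "glue_sets A V \<noteq> {}"
      using v unfolding glue_sets_def by blast
    fix P and x :: "nat \<Rightarrow> 'w \<Rightarrow> 'v" assume P: "omega_partition N P \<and> (\<forall>k. x k \<in> glue_sets A V)"
    then have "\<forall>n. \<exists>y. x n = glue A y \<and> (\<forall>k. y k \<in> V k)"
      unfolding glue_sets_def by blast
    then obtain y where y: "\<And>n. x n = glue A (y n)" "\<And>n k. y n k \<in> V k"
      by metis
    have "glue P x = glue A (\<lambda>k. glue P (\<lambda>n. y n k))"
      unfolding y(1)[abs_def] by (simp add: glue_def y(1))
    moreover have "glue P (\<lambda>n. y n k) \<in> V k" for k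
      using P y(2) Vs by (intro glue_in) auto
    ultimately show "glue P x \<in> glue_sets A V"
      unfolding glue_sets_def by blast
  qed
  ultimately show ?thesis
    unfolding stable_subsets_def by blast
qed

lemma region_glue_sets:
  assumes A: "omega_partition N A" and V: "\<And>k. V k \<in> stable_subsets N X" and B: "\<And>k. B k \<in> sets N"
  shows "AE w in N. w \<in> region N (restr_set N (glue_sets A V) (\<Union>k. A k \<inter> B k)) x \<longleftrightarrow>
    w \<in> (\<Union>k. A k \<inter> region N (restr_set N (V k) (B k)) x)"
proof -
  have As: "A k \<in> sets N" for k
    using A by (auto simp: omega_partition_def)
  have dj: "disjoint_family A"
    using A by (simp add: omega_partition_def)
  have Vs: "stable_set N (V k)" for k
    using V[of k] by (simp add: stable_subsets_def)
  let ?R = "\<lambda>k. region N (restr_set N (V k) (B k)) x"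
  have Rs: "?R k \<in> sets N" for k
    by (rule region_sets[OF Vs B])
  have "\<exists>v\<in>V k. AE w in N. w \<in> ?R k \<longrightarrow> x w = v w" for k
    by (rule region_witness[OF Vs B])
  then obtain v where v: "\<And>k. v k \<in> V k" "\<And>k. AE w in N. w \<in> ?R k \<longrightarrow> x w = v k w"
    by metis
  show ?thesis
  proof (rule region_eqI)
    show "stable_set N (glue_sets A V)"
      using glue_sets_stable[OF A V] by (simp add: stable_subsets_def)
    show "(\<Union>k. A k \<inter> B k) \<in> sets N" "(\<Union>k. A k \<inter> ?R k) \<in> sets N"
      by (intro sets.countable_UN'' countableI_type sets.Int As B Rs)+
    have "AE w in N. \<forall>k. w \<in> ?R k \<longrightarrow> w \<in> B k"
      unfolding AE_all_countable using region_subset[OF Vs B] by blast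
    then show "AE w in N. w \<in> (\<Union>k. A k \<inter> ?R k) \<longrightarrow> w \<in> (\<Union>k. A k \<inter> B k)"
      by eventually_elim blast
    show "glue A v \<in> glue_sets A V"
      using v(1) unfolding glue_sets_def by blast
    have "AE w in N. \<forall>k. w \<in> ?R k \<longrightarrow> x w = v k w"
      unfolding AE_all_countable using v(2) by blast
    then show "AE w in N. w \<in> (\<Union>k. A k \<inter> ?R k) \<longrightarrow> x w = glue A v w"
      by eventually_elim (auto simp: glue_eq[OF dj])
    fix D u assume D: "D \<in> sets N" "AE w in N. w \<in> D \<longrightarrow> w \<in> (\<Union>k. A k \<inter> B k)"
      and u: "u \<in> glue_sets A V" "AE w in N. w \<in> D \<longrightarrow> x w = u w"
    obtain y where y: "u = glue A y" "\<And>k. y k \<in> V k"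
      using u(1) unfolding glue_sets_def by blast
    have "AE w in N. w \<in> D \<inter> A k \<longrightarrow> w \<in> ?R k" for k
    proof (rule region_largest[OF Vs B _ y(2)])
      show "D \<inter> A k \<in> sets N"
        using D As by blast
      have "w \<in> B k" if w: "w \<in> A k" "w \<in> (\<Union>k. A k \<inter> B k)" for w
      proof -
        obtain j where "w \<in> A j" "w \<in> B j"
          using w(2) by blast
        moreover have "j = k"
          using disjoint_family_onD[OF dj UNIV_I UNIV_I, of j k] w(1) \<open>w \<in> A j\<close> by blast
        ultimately show ?thesis
          by simp
      qed
      with D(2) show "AE w in N. w \<in> D \<inter> A k \<longrightarrow> w \<in> B k"
        by (auto elim!: eventually_mono)
      show "AE w in N. w \<in> D \<inter> A k \<longrightarrow> x w = y k w"
        using u(2) by eventually_elim (auto simp: y(1) glue_eq[OF dj])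
    qed
    then have "AE w in N. \<forall>k. w \<in> D \<inter> A k \<longrightarrow> w \<in> ?R k"
      unfolding AE_all_countable by blast
    then show "AE w in N. w \<in> D \<longrightarrow> w \<in> (\<Union>k. A k \<inter> ?R k)"
      using D(2) by eventually_elim blast
  qed
qed

lemma glue_in_cond_power:
  assumes "omega_partition N A" "\<And>k. V k \<in> stable_subsets N X" "\<And>k. B k \<in> sets N"
  shows "restr_set N (glue_sets A V) (\<Union>k. A k \<inter> B k) \<in> cond_power N X"
proof -
  have "A k \<in> sets N" for k
    using assms(1) by (auto simp: omega_partition_def)
  then have "(\<Union>k. A k \<inter> B k) \<in> sets N"
    by (intro sets.countable_UN'' countableI_type sets.Int assms(3))
  with glue_sets_stable[of A V, OF assms(1,2)] show ?thesis
    unfolding cond_power_def by blast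
qed

end

section \<open>Conditional sets given by product-measurable sets\<close>

definition graph_cond :: "'w measure \<Rightarrow> 'e measure \<Rightarrow> ('w \<times> 'e) set \<Rightarrow> ('w, 'e) cond_set" where
  "graph_cond N E H = cond_set_of N (measurable N E) (\<lambda>x. {w \<in> space N. (w, x w) \<in> H})"

lemma measurable_glue:
  assumes A: "omega_partition N A" and x: "\<And>k. x k \<in> measurable N E"
  shows "glue A x \<in> measurable N E"
proof (rule measurableI)
  have dj: "disjoint_family A" and As: "\<And>k. A k \<in> sets N"
    using A by (auto simp: omega_partition_def)
  show "glue A x w \<in> space E" if "w \<in> space N" for w
    using measurable_space[OF x that] by (simp add: glue_def)
  fix F assume F: "F \<in> sets E"
  have "glue A x -` F \<inter> space N = (\<Union>k. A k \<inter> (x k -` F \<inter> space N))"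
  proof (intro Set.set_eqI iffI)
    fix w assume "w \<in> glue A x -` F \<inter> space N"
    moreover from this obtain k where "w \<in> A k"
      using omega_partition_index[OF A] by blast
    ultimately show "w \<in> (\<Union>k. A k \<inter> (x k -` F \<inter> space N))"
      using glue_eq[OF dj, of w k x] by auto
  next
    fix w assume "w \<in> (\<Union>k. A k \<inter> (x k -` F \<inter> space N))"
    then obtain k where "w \<in> A k" "x k w \<in> F" "w \<in> space N"
      by blast
    then show "w \<in> glue A x -` F \<inter> space N"
      using glue_eq[OF dj, of w k x] by auto
  qed
  also have "\<dots> \<in> sets N"
    by (intro sets.countable_UN'' countableI_type sets.Int As measurable_sets[OF x F])
  finally show "glue A x -` F \<inter> space N \<in> sets N" .
qed

text \<open>Stable sets are nonempty; the constant functions into \<open>E\<close> witness this once \<open>E\<close> has a point.\<close>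

locale L0m_space = finite_measure N for N :: "'w measure" +
  fixes E :: "'e measure"
  assumes space_E: "space E \<noteq> {}"

sublocale L0m_space \<subseteq> stable_space N "measurable N E"
proof
  obtain e where "e \<in> space E"
    using space_E by blast
  then have "(\<lambda>_. e) \<in> measurable N E"
    by simp
  then show "stable_set N (measurable N E)"
    unfolding stable_set_def using measurable_glue by blast
qed

context L0m_space
begin

lemma graph_section_sets:
  assumes "H \<in> sets (N \<Otimes>\<^sub>M E)" "x \<in> measurable N E"
  shows "{w \<in> space N. (w, x w) \<in> H} \<in> sets N"
proof -
  have "(\<lambda>w. (w, x w)) \<in> measurable N (N \<Otimes>\<^sub>M E)"
    using assms(2) by (intro measurable_Pair measurable_ident) simp_all
  from measurable_sets[OF this assms(1)] show ?thesis
    by (simp add: vimage_def Int_def conj_commute)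
qed

lemma local_map_graph:
  assumes "H \<in> sets (N \<Otimes>\<^sub>M E)"
  shows "local_map N (measurable N E) (\<lambda>x. {w \<in> space N. (w, x w) \<in> H})"
  unfolding local_map_def
proof (intro conjI ballI impI)
  show "{w \<in> space N. (w, x w) \<in> H} \<in> sets N" if "x \<in> measurable N E" for x
    using assms that by (rule graph_section_sets)
qed (auto elim!: eventually_mono)

lemma graph_cond_in:
  "H \<in> sets (N \<Otimes>\<^sub>M E) \<Longrightarrow> graph_cond N E H \<in> cond_power N (measurable N E)"
  unfolding graph_cond_def by (intro cond_set_of_in local_map_graph)

lemma region_graph_cond:
  assumes "H \<in> sets (N \<Otimes>\<^sub>M E)" "x \<in> measurable N E"
  shows "AE w in N. w \<in> region N (graph_cond N E H) x \<longleftrightarrow> (w, x w) \<in> H"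
  using region_cond_set_of[OF local_map_graph[OF assms(1)] assms(2)] AE_space
  unfolding graph_cond_def[symmetric] by eventually_elim simp

lemma eq_graph_condI:
  assumes "C \<in> cond_power N (measurable N E)" "H \<in> sets (N \<Otimes>\<^sub>M E)"
    "\<And>x. x \<in> measurable N E \<Longrightarrow> AE w in N. w \<in> region N C x \<longleftrightarrow> (w, x w) \<in> H"
  shows "C = graph_cond N E H"
proof (rule cond_set_eqI[OF assms(1) graph_cond_in[OF assms(2)]])
  fix x assume "x \<in> measurable N E"
  from assms(3)[OF this] region_graph_cond[OF assms(2) this]
  show "AE w in N. w \<in> region N C x \<longleftrightarrow> w \<in> region N (graph_cond N E H) x"
    by eventually_elim blast
qed

lemma Sup_graph_cond:
  assumes I: "countable I" and H: "\<And>i. i \<in> I \<Longrightarrow> H i \<in> sets (N \<Otimes>\<^sub>M E)"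
  shows "\<Squnion>\<^bsub>cond_order N (measurable N E)\<^esub> ((\<lambda>i. graph_cond N E (H i)) ` I) = graph_cond N E (\<Union>i\<in>I. H i)"
proof -
  let ?\<phi> = "\<lambda>x. \<Union>i\<in>I. region N (graph_cond N E (H i)) x"
  have \<phi>: "local_map N (measurable N E) ?\<phi>"
    by (intro local_map_UN I local_map_region graph_cond_in H)
  have "cond_set_of N (measurable N E) ?\<phi> = graph_cond N E (\<Union>i\<in>I. H i)"
  proof (rule eq_graph_condI[OF cond_set_of_in[OF \<phi>]])
    show "(\<Union>i\<in>I. H i) \<in> sets (N \<Otimes>\<^sub>M E)"
      by (intro sets.countable_UN'' I H)
    fix x assume x: "x \<in> measurable N E"
    have "AE w in N. \<forall>i\<in>I. w \<in> region N (graph_cond N E (H i)) x \<longleftrightarrow> (w, x w) \<in> H i"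
      unfolding AE_ball_countable[OF I] using region_graph_cond[OF H x] by blast
    with region_cond_set_of[OF \<phi> x]
    show "AE w in N. w \<in> region N (cond_set_of N (measurable N E) ?\<phi>) x \<longleftrightarrow> (w, x w) \<in> (\<Union>i\<in>I. H i)"
      by eventually_elim blast
  qed
  then show ?thesis
    by (subst Sup_eq_cond_set_of[OF I graph_cond_in[OF H]])
qed

lemma compl_graph_cond:
  assumes H: "H \<in> sets (N \<Otimes>\<^sub>M E)"
  shows "cond_compl N (measurable N E) (graph_cond N E H) = graph_cond N E (space (N \<Otimes>\<^sub>M E) - H)"
  unfolding cond_compl_eq_cond_set_of[OF graph_cond_in[OF H]]
proof (rule eq_graph_condI)
  have \<phi>: "local_map N (measurable N E) (\<lambda>x. space N - region N (graph_cond N E H) x)"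
    by (intro local_map_compl local_map_region graph_cond_in H)
  show "cond_set_of N (measurable N E) (\<lambda>x. space N - region N (graph_cond N E H) x) \<in> cond_power N (measurable N E)"
    using \<phi> by (rule cond_set_of_in)
  fix x assume x: "x \<in> measurable N E"
  from region_cond_set_of[OF \<phi> x] region_graph_cond[OF H x] AE_space
  show "AE w in N. w \<in> region N (cond_set_of N (measurable N E) (\<lambda>x. space N - region N (graph_cond N E H) x)) x
      \<longleftrightarrow> (w, x w) \<in> space (N \<Otimes>\<^sub>M E) - H"
    by eventually_elim (auto simp: space_pair_measure measurable_space[OF x])
qed (use H in auto)

lemma full_eq_graph_cond: "cond_full N (measurable N E) = graph_cond N E (space (N \<Otimes>\<^sub>M E))"
  unfolding cond_full_eq_cond_set_of graph_cond_def
  by (intro cond_set_of_cong local_map_const local_map_graph) (auto simp: space_pair_measure dest: measurable_space)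

lemma disjoint_graph_cond:
  assumes "H \<in> sets (N \<Otimes>\<^sub>M E)" "K \<in> sets (N \<Otimes>\<^sub>M E)" "H \<inter> K = {}"
  shows "cond_disjoint N (measurable N E) (graph_cond N E H) (graph_cond N E K)"
  unfolding cond_disjoint_iff_region[OF graph_cond_in[OF assms(1)] graph_cond_in[OF assms(2)]]
proof
  fix x assume x: "x \<in> measurable N E"
  from region_graph_cond[OF assms(1) x] region_graph_cond[OF assms(2) x]
  show "AE w in N. \<not> (w \<in> region N (graph_cond N E H) x \<and> w \<in> region N (graph_cond N E K) x)"
    by eventually_elim (use assms(3) in blast)
qed

lemma glue_graph_cond:
  assumes A: "omega_partition N A" and V: "\<And>k. V k \<in> stable_subsets N (measurable N E)"
    and B: "\<And>k. B k \<in> sets N" and H: "\<And>k. H k \<in> sets (N \<Otimes>\<^sub>M E)"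
    and eq: "\<And>k. restr_set N (V k) (B k) = graph_cond N E (H k)"
  shows "restr_set N (glue_sets A V) (\<Union>k. A k \<inter> B k) = graph_cond N E (\<Union>k. (A k \<times> space E) \<inter> H k)"
proof (rule eq_graph_condI[OF glue_in_cond_power[OF A V B]])
  have As: "A k \<in> sets N" for k
    using A by (auto simp: omega_partition_def)
  show "(\<Union>k. (A k \<times> space E) \<inter> H k) \<in> sets (N \<Otimes>\<^sub>M E)"
    by (intro sets.countable_UN'' countableI_type sets.Int H pair_measureI As sets.top)
  fix x assume x: "x \<in> measurable N E"
  have "AE w in N. \<forall>k. w \<in> region N (graph_cond N E (H k)) x \<longleftrightarrow> (w, x w) \<in> H k"
    unfolding AE_all_countable using region_graph_cond[OF H x] by blast
  with region_glue_sets[OF A V B, where x = x] AE_space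
  show "AE w in N. w \<in> region N (restr_set N (glue_sets A V) (\<Union>k. A k \<inter> B k)) x \<longleftrightarrow>
      (w, x w) \<in> (\<Union>k. (A k \<times> space E) \<inter> H k)"
    by eventually_elim (use measurable_space[OF x] in \<open>auto simp: eq\<close>)
qed

text \<open>To find a witness on the region of \<open>x\<close>, continue \<open>x\<close> outside of it by a step function that takes on
  each \<open>A k\<close> a constant value in \<open>F k\<close>; where \<open>F k\<close> is empty, no condition restricts that value.\<close>

lemma L0m_glue_eq_graph_cond:
  assumes A: "omega_partition N A" and F: "\<And>k. F k \<in> sets E" and B: "B \<in> sets N"
  shows "L0m_glue N E A F B = graph_cond N E (\<Union>k. (A k \<inter> B) \<times> F k)"
  unfolding L0m_glue_def
proof (rule eq_graph_condI)
  have As: "A k \<in> sets N" for k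
    using A by (auto simp: omega_partition_def)
  have dj: "disjoint_family A"
    using A by (simp add: omega_partition_def)
  have index_unique: "j = k" if "w \<in> A j" "w \<in> A k" for w j k
    using disjoint_family_onD[OF dj UNIV_I UNIV_I, of j k] that by blast
  let ?V = "{x \<in> measurable N E. \<forall>k. F k \<noteq> {} \<longrightarrow> (AE w in N. w \<in> A k \<longrightarrow> x w \<in> F k)}"
  let ?D = "(\<Union>k\<in>{k. F k \<noteq> {}}. A k) \<inter> B"
  let ?H = "\<Union>k. (A k \<inter> B) \<times> F k"
  have D: "?D \<in> sets N"
    by (intro sets.Int sets.countable_UN'' countableI_type As B)
  show H: "?H \<in> sets (N \<Otimes>\<^sub>M E)"
    by (intro sets.countable_UN'' countableI_type pair_measureI sets.Int As B F)
  obtain e0 where e0: "e0 \<in> space E"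
    using space_E by blast
  have "\<exists>e. e \<in> space E \<and> (F k \<noteq> {} \<longrightarrow> e \<in> F k)" for k
    using e0 sets.sets_into_space[OF F, of k] by blast
  then obtain e where e: "\<And>k. e k \<in> space E" "\<And>k. F k \<noteq> {} \<Longrightarrow> e k \<in> F k"
    by metis
  define u where "u = glue A (\<lambda>k _. e k)"
  have uX: "u \<in> measurable N E"
    unfolding u_def by (intro measurable_glue A measurable_const e)
  have u: "u w = e k" if "w \<in> A k" for w k
    unfolding u_def using glue_eq[OF dj that, of "\<lambda>k _. e k"] .
  have uV: "u \<in> ?V"
    using uX u e(2) by auto
  have V: "stable_set N ?V"
    unfolding stable_set_def
  proof (intro conjI allI impI)
    show "?V \<noteq> {}"
      using uV by blast
    fix P and x :: "nat \<Rightarrow> 'w \<Rightarrow> 'e" assume *: "omega_partition N P \<and> (\<forall>k. x k \<in> ?V)"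
    then have P: "omega_partition N P" and xX: "\<And>n. x n \<in> measurable N E"
      by auto
    have "AE w in N. w \<in> A k \<longrightarrow> glue P x w \<in> F k" if "F k \<noteq> {}" for k
    proof -
      have "AE w in N. \<forall>n. w \<in> A k \<longrightarrow> x n w \<in> F k"
        unfolding AE_all_countable using * that by blast
      then show ?thesis
        by eventually_elim (simp add: glue_def)
    qed
    moreover have "glue P x \<in> measurable N E"
      using P xX by (rule measurable_glue)
    ultimately show "glue P x \<in> ?V"
      by blast
  qed
  show "restr_set N ?V ?D \<in> cond_power N (measurable N E)"
    unfolding cond_power_def stable_subsets_def using V D by blast
  fix x assume x: "x \<in> measurable N E"
  have S: "{w \<in> space N. (w, x w) \<in> ?H} \<in> sets N"
    using H x by (rule graph_section_sets)
  obtain z where z: "z \<in> measurable N E" "AE w in N. w \<in> {w \<in> space N. (w, x w) \<in> ?H} \<longrightarrow> z w = x w"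
    "AE w in N. w \<notin> {w \<in> space N. (w, x w) \<in> ?H} \<longrightarrow> z w = u w"
    using ex_two_piece_glue[OF stable S x uX] by blast
  have "AE w in N. w \<in> region N (restr_set N ?V ?D) x \<longleftrightarrow> w \<in> {w \<in> space N. (w, x w) \<in> ?H}"
  proof (rule region_eqI[OF V D S])
    show "AE w in N. w \<in> {w \<in> space N. (w, x w) \<in> ?H} \<longrightarrow> w \<in> ?D"
      by (rule AE_I2) blast
    show "AE w in N. w \<in> {w \<in> space N. (w, x w) \<in> ?H} \<longrightarrow> x w = z w"
      using z(2) by eventually_elim simp
    have "AE w in N. w \<in> A k \<longrightarrow> z w \<in> F k" if k: "F k \<noteq> {}" for k
      using z(2,3)
    proof eventually_elim
      case (elim w)
      show ?case
      proof
        assume w: "w \<in> A k"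
        show "z w \<in> F k"
        proof (cases "w \<in> {w \<in> space N. (w, x w) \<in> ?H}")
          case True
          then obtain j where "w \<in> A j" "x w \<in> F j"
            by blast
          then have "x w \<in> F k"
            using index_unique[of w j k] w by blast
          then show ?thesis
            using elim(1) True by simp
        next
          case False
          then have "z w = e k"
            using elim(2) u[OF w] by simp
          then show ?thesis
            using e(2)[OF k] by simp
        qed
      qed
    qed
    then show "z \<in> ?V"
      using z(1) by blast
    fix C v assume C: "C \<in> sets N" "AE w in N. w \<in> C \<longrightarrow> w \<in> ?D"
      and v: "v \<in> ?V" "AE w in N. w \<in> C \<longrightarrow> x w = v w"
    have "AE w in N. \<forall>k. F k \<noteq> {} \<longrightarrow> w \<in> A k \<longrightarrow> v w \<in> F k"
      unfolding AE_all_countable using v(1) by auto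
    with C(2) v(2) AE_space show "AE w in N. w \<in> C \<longrightarrow> w \<in> {w \<in> space N. (w, x w) \<in> ?H}"
      by eventually_elim auto
  qed
  with AE_space show "AE w in N. w \<in> region N (restr_set N ?V ?D) x \<longleftrightarrow> (w, x w) \<in> ?H"
    by eventually_elim simp
qed

lemma omega_partition_trivial: "omega_partition N (\<lambda>k. if k = 0 then space N else {})"
  by (auto simp: omega_partition_def disjoint_family_on_def)

lemma L0m_glue_const_eq_graph_cond:
  assumes "F \<in> sets E" "B \<in> sets N"
  shows "L0m_glue N E (\<lambda>k. if k = 0 then space N else {}) (\<lambda>_. F) B = graph_cond N E (B \<times> F)"
proof -
  have "(\<Union>k::nat. ((if k = 0 then space N else {}) \<inter> B) \<times> F) = B \<times> F"
    using sets.sets_into_space[OF assms(2)] by (auto split: if_splits)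
  then show ?thesis
    by (subst L0m_glue_eq_graph_cond[OF omega_partition_trivial assms]) simp
qed

text \<open>All operations on conditional sets correspond to measurable operations on the subsets of the
  product; concatenation corresponds to the union of the parts cut out by the cylinders over \<open>A k\<close>.\<close>

lemma stable_sigma_algebra_graphs:
  "stable_sigma_algebra N (measurable N E) (graph_cond N E ` sets (N \<Otimes>\<^sub>M E))"
  unfolding stable_sigma_algebra_def stable_collection_def
proof (intro conjI allI impI ballI)
  let ?\<H> = "graph_cond N E ` sets (N \<Otimes>\<^sub>M E)"
  show "?\<H> \<subseteq> cond_power N (measurable N E)"
    using graph_cond_in by blast
  show "?\<H> \<noteq> {}"
    by auto
  show "cond_full N (measurable N E) \<in> ?\<H>"
    unfolding full_eq_graph_cond by blast
  show "cond_compl N (measurable N E) C \<in> ?\<H>" if "C \<in> ?\<H>" for C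
    using that by (auto simp: compl_graph_cond)
  fix C :: "nat \<Rightarrow> ('w, 'e) cond_set" assume "range C \<subseteq> ?\<H>"
  then have "\<forall>k. \<exists>H. H \<in> sets (N \<Otimes>\<^sub>M E) \<and> C k = graph_cond N E H"
    by blast
  then obtain H where H: "\<And>k. H k \<in> sets (N \<Otimes>\<^sub>M E)" "\<And>k. C k = graph_cond N E (H k)"
    by metis
  have "\<Squnion>\<^bsub>cond_order N (measurable N E)\<^esub> (range C) = graph_cond N E (\<Union>k. H k)"
    using Sup_graph_cond[of UNIV H] H(1) by (simp add: H(2)[abs_def])
  moreover have "(\<Union>k. H k) \<in> sets (N \<Otimes>\<^sub>M E)"
    by (intro sets.countable_UN'' countableI_type H(1))
  ultimately show "\<Squnion>\<^bsub>cond_order N (measurable N E)\<^esub> (range C) \<in> ?\<H>"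
    by blast
next
  let ?\<H> = "graph_cond N E ` sets (N \<Otimes>\<^sub>M E)"
  fix A V and B :: "nat \<Rightarrow> 'w set" assume *: "omega_partition N A \<and> (\<forall>k. V k \<in> stable_subsets N (measurable N E) \<and>
    B k \<in> sets N \<and> restr_set N (V k) (B k) \<in> ?\<H>)"
  then have A: "omega_partition N A" and V: "\<And>k. V k \<in> stable_subsets N (measurable N E)"
    and B: "\<And>k. B k \<in> sets N" and "\<forall>k. \<exists>H. H \<in> sets (N \<Otimes>\<^sub>M E) \<and> restr_set N (V k) (B k) = graph_cond N E H"
    by blast+
  then obtain H where H: "\<And>k. H k \<in> sets (N \<Otimes>\<^sub>M E)" "\<And>k. restr_set N (V k) (B k) = graph_cond N E (H k)"
    by metis
  have As: "A k \<in> sets N" for k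
    using A by (auto simp: omega_partition_def)
  have "(\<Union>k. (A k \<times> space E) \<inter> H k) \<in> sets (N \<Otimes>\<^sub>M E)"
    by (intro sets.countable_UN'' countableI_type sets.Int H(1) pair_measureI As sets.top)
  then show "restr_set N (glue_sets A V) (\<Union>k. A k \<inter> B k) \<in> ?\<H>"
    unfolding glue_graph_cond[OF A V B H] by blast
qed

text \<open>Rectangles are in the ring, and the sets \<open>H\<close> whose conditional set is in \<open>\<X>\<close> are closed under
  complements and countable unions.\<close>

lemma graph_cond_in_stable_sigma_algebra:
  assumes \<X>: "stable_sigma_algebra N (measurable N E) \<X>" and ring: "L0m_ring N E \<subseteq> \<X>"
    and H: "H \<in> sets (N \<Otimes>\<^sub>M E)"
  shows "graph_cond N E H \<in> \<X>"
proof -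
  have H': "H \<in> sigma_sets (space N \<times> space E) {A \<times> F |A F. A \<in> sets N \<and> F \<in> sets E}"
    using H by (simp add: sets_pair_measure)
  then show ?thesis
  proof induction
    case (Basic K)
    then obtain A F where K: "K = A \<times> F" "A \<in> sets N" "F \<in> sets E"
      by blast
    have "graph_cond N E K \<in> L0m_ring N E"
      unfolding K(1) L0m_glue_const_eq_graph_cond[OF K(3,2), symmetric] L0m_ring_def
      using omega_partition_trivial K(2,3) by blast
    then show ?case
      using ring by blast
  next
    case Empty
    have "graph_cond N E ({} \<times> {}) \<in> L0m_ring N E"
      unfolding L0m_glue_const_eq_graph_cond[OF sets.empty_sets sets.empty_sets, symmetric] L0m_ring_def
      using omega_partition_trivial by blast
    then show ?case
      using ring by auto
  next
    case (Compl K)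
    then have "K \<in> sets (N \<Otimes>\<^sub>M E)"
      by (simp add: sets_pair_measure)
    then have "graph_cond N E (space N \<times> space E - K) = cond_compl N (measurable N E) (graph_cond N E K)"
      by (simp add: compl_graph_cond space_pair_measure)
    then show ?case
      using Compl.IH \<X> unfolding stable_sigma_algebra_def by simp
  next
    case (Union K)
    then have K: "K i \<in> sets (N \<Otimes>\<^sub>M E)" for i
      by (simp add: sets_pair_measure)
    have "range (\<lambda>i. graph_cond N E (K i)) \<subseteq> \<X>"
      using Union.IH by blast
    then have "\<Squnion>\<^bsub>cond_order N (measurable N E)\<^esub> (range (\<lambda>i. graph_cond N E (K i))) \<in> \<X>"
      using \<X> unfolding stable_sigma_algebra_def by blast
    then show ?case
      using Sup_graph_cond[of UNIV K] K by simp
  qed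
qed

lemma L0m_sigma_eq_graphs: "L0m_sigma N E = graph_cond N E ` sets (N \<Otimes>\<^sub>M E)"
proof
  have "L0m_ring N E \<subseteq> graph_cond N E ` sets (N \<Otimes>\<^sub>M E)"
  proof
    fix C assume "C \<in> L0m_ring N E"
    then obtain A F B where C: "C = L0m_glue N E A F B" and *: "omega_partition N A" "range F \<subseteq> sets E" "B \<in> sets N"
      unfolding L0m_ring_def by blast
    have As: "A k \<in> sets N" for k
      using *(1) by (auto simp: omega_partition_def)
    have F: "F k \<in> sets E" for k
      using *(2) by blast
    have "(\<Union>k. (A k \<inter> B) \<times> F k) \<in> sets (N \<Otimes>\<^sub>M E)"
      by (intro sets.countable_UN'' countableI_type pair_measureI sets.Int As F *)
    then show "C \<in> graph_cond N E ` sets (N \<Otimes>\<^sub>M E)"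
      unfolding C L0m_glue_eq_graph_cond[OF *(1) F *(3)] by blast
  qed
  then show "L0m_sigma N E \<subseteq> graph_cond N E ` sets (N \<Otimes>\<^sub>M E)"
    unfolding L0m_sigma_def stable_sigma_def using stable_sigma_algebra_graphs by blast
  show "graph_cond N E ` sets (N \<Otimes>\<^sub>M E) \<subseteq> L0m_sigma N E"
    unfolding L0m_sigma_def stable_sigma_def using graph_cond_in_stable_sigma_algebra by blast
qed

end

section \<open>Stable measurability of composition\<close>

text \<open>The ball with centre \<open>x\<close> and radius \<open>r\<close> comes from the set of all \<open>(w, t)\<close> with \<open>\<bar>x w - t\<bar> < r w\<close>. It
  is nonempty because it contains \<open>x\<close>, which has region \<open>\<Omega>\<close> as \<open>r > 0\<close>.\<close>

lemma (in finite_measure) stable_borel_subset_graphs: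
  "stable_borel M \<subseteq> graph_cond M borel ` sets (M \<Otimes>\<^sub>M borel)"
proof -
  interpret L0m_space M "borel :: real measure"
    by unfold_locales simp
  have "restr_set M {y \<in> borel_measurable M. AE w in M. \<bar>x w - y w\<bar> < r w} (space M)
      \<in> graph_cond M borel ` sets (M \<Otimes>\<^sub>M borel)" (is "restr_set M ?V _ \<in> _")
    if x: "x \<in> borel_measurable M" and r: "r \<in> borel_measurable M" and pos: "AE w in M. 0 < r w"
    for x r :: "'a \<Rightarrow> real"
  proof -
    let ?H = "{p \<in> space (M \<Otimes>\<^sub>M borel). \<bar>x (fst p) - snd p\<bar> < r (fst p)}"
    let ?\<phi> = "\<lambda>y. {w \<in> space M. (w, y w) \<in> ?H}"
    have H: "?H \<in> sets (M \<Otimes>\<^sub>M borel)"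
      using x r by measurable
    have \<phi>: "local_map M (borel_measurable M) ?\<phi>"
      using H by (rule local_map_graph)
    have V: "?V = {y \<in> borel_measurable M. AE w in M. w \<in> space M \<longrightarrow> w \<in> ?\<phi> y}"
      by (intro Collect_cong conj_cong refl AE_cong) (simp add: space_pair_measure)
    have sub: "AE w in M. w \<in> ?\<phi> y \<longrightarrow> w \<in> space M" for y
      by auto
    have centre: "AE w in M. w \<in> space M \<longrightarrow> w \<in> ?\<phi> x"
      using pos by eventually_elim (simp add: space_pair_measure)
    have "restr_set M ?V (space M) = graph_cond M borel ?H"
    proof (rule eq_graph_condI)
      show "restr_set M ?V (space M) \<in> cond_power M (borel_measurable M)"
        unfolding V by (rule realization_in[OF \<phi> sets.top sub x centre])
      show "?H \<in> sets (M \<Otimes>\<^sub>M borel)"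
        by (rule H)
      fix y :: "'a \<Rightarrow> real" assume y: "y \<in> borel_measurable M"
      have "AE w in M. w \<in> region M (restr_set M ?V (space M)) y \<longleftrightarrow> w \<in> ?\<phi> y"
        unfolding V by (rule region_realization[OF \<phi> sets.top sub x centre y])
      with AE_space show "AE w in M. w \<in> region M (restr_set M ?V (space M)) y \<longleftrightarrow> (w, y w) \<in> ?H"
        by eventually_elim simp
    qed
    with H show ?thesis
      by blast
  qed
  then show ?thesis
    unfolding stable_borel_def stable_sigma_def using stable_sigma_algebra_graphs by blast
qed

context L0m_space
begin

text \<open>The region of \<open>x\<close> in the preimage is the region of \<open>f \<circ> x\<close> in \<open>W|A\<close>. The event on which the preimage
  lives is an essential union over all \<open>x\<close>, attained at an \<open>x0\<close> of largest region.\<close>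

lemma stable_preimage_eq_graph_cond:
  fixes f :: "'e \<Rightarrow> 'u"
  assumes f: "f \<in> measurable E E'" and W: "W \<in> stable_subsets N (measurable N E')" and A: "A \<in> sets N"
    and K: "K \<in> sets (N \<Otimes>\<^sub>M E')" and eq: "restr_set N W A = graph_cond N E' K"
  shows "stable_preimage N (measurable N E) (\<lambda>x w. f (x w)) W A =
    graph_cond N E {p \<in> space (N \<Otimes>\<^sub>M E). (fst p, f (snd p)) \<in> K}" (is "_ = graph_cond N E ?H")
proof -
  obtain e where e: "e \<in> space E"
    using space_E by blast
  interpret E': L0m_space N E'
    by unfold_locales (use measurable_space[OF f e] in blast)
  have Ws: "stable_set N W"
    using W by (simp add: stable_subsets_def)
  have H: "?H \<in> sets (N \<Otimes>\<^sub>M E)"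
    using f K by measurable
  let ?\<phi> = "\<lambda>x. {w \<in> space N. (w, x w) \<in> ?H}"
  have \<phi>: "local_map N (measurable N E) ?\<phi>"
    using H by (rule local_map_graph)
  have reg: "AE w in N. w \<in> region N (restr_set N W A) (\<lambda>w. f (x w)) \<longleftrightarrow> w \<in> ?\<phi> x" if x: "x \<in> measurable N E" for x
    using E'.region_graph_cond[OF K measurable_compose[OF x f]] AE_space unfolding eq
    by eventually_elim (simp add: space_pair_measure measurable_space[OF x])
  have mem: "restr_elem N (\<lambda>w. f (x w)) B \<in> restr_set N W B \<longleftrightarrow> (AE w in N. w \<in> B \<longrightarrow> w \<in> ?\<phi> x)"
    if x: "x \<in> measurable N E" and B: "B \<in> sets N" "AE w in N. w \<in> B \<longrightarrow> w \<in> A" for x B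
  proof -
    have "(AE w in N. w \<in> B \<longrightarrow> w \<in> region N (restr_set N W A) (\<lambda>w. f (x w))) \<longleftrightarrow> (AE w in N. w \<in> B \<longrightarrow> w \<in> ?\<phi> x)"
      using reg[OF x] by (intro iffI; elim AE_mp[OF _ AE_mp]) (auto elim!: eventually_mono)
    then show ?thesis
      using E'.restr_elem_in_iff_region[OF Ws A B] by simp
  qed
  have \<phi>A: "AE w in N. w \<in> ?\<phi> x \<longrightarrow> w \<in> A" if "x \<in> measurable N E" for x
    using reg[OF that] E'.region_subset[OF Ws A] by eventually_elim blast
  obtain x0 where x0: "x0 \<in> measurable N E" "\<And>x. x \<in> measurable N E \<Longrightarrow> AE w in N. w \<in> ?\<phi> x \<longrightarrow> w \<in> ?\<phi> x0"
    using local_map_attains_sup[OF \<phi>] by blast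
  define \<A> where "\<A> = {A' \<in> sets N. A' \<subseteq> A \<and> (\<exists>x\<in>measurable N E. restr_elem N (\<lambda>w. f (x w)) A' \<in> restr_set N W A')}"
  define C where "C = ess_Union N \<A>"
  have \<A>: "B \<in> \<A> \<longleftrightarrow> B \<in> sets N \<and> B \<subseteq> A \<and> (\<exists>x\<in>measurable N E. AE w in N. w \<in> B \<longrightarrow> w \<in> ?\<phi> x)" for B
  proof -
    have "restr_elem N (\<lambda>w. f (x w)) B \<in> restr_set N W B \<longleftrightarrow> (AE w in N. w \<in> B \<longrightarrow> w \<in> ?\<phi> x)"
      if "x \<in> measurable N E" "B \<in> sets N" "B \<subseteq> A" for x
      using that by (intro mem AE_I2) auto
    then show ?thesis
      unfolding \<A>_def by blast
  qed
  have "?\<phi> x0 \<inter> A \<in> \<A>"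
    unfolding \<A> using local_map_sets[OF \<phi> x0(1)] A x0(1) by auto
  moreover have "AE w in N. w \<in> B \<longrightarrow> w \<in> ?\<phi> x0 \<inter> A" if B: "B \<in> \<A>" for B
  proof -
    obtain x where x: "x \<in> measurable N E" "AE w in N. w \<in> B \<longrightarrow> w \<in> ?\<phi> x"
      using B unfolding \<A> by blast
    show ?thesis
      using x(2) x0(2)[OF x(1)] \<phi>A[OF x(1)] by eventually_elim blast
  qed
  moreover have "\<A> \<subseteq> sets N"
    unfolding \<A>_def by blast
  ultimately have C: "C \<in> sets N" "AE w in N. w \<in> C \<longleftrightarrow> w \<in> ?\<phi> x0 \<inter> A"
    unfolding C_def using ess_Union_attained[of \<A> N "?\<phi> x0 \<inter> A"] by blast+
  have CA: "AE w in N. w \<in> C \<longrightarrow> w \<in> A"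
    using C(2) by eventually_elim blast
  have C_upper: "AE w in N. w \<in> ?\<phi> x \<longrightarrow> w \<in> C" if "x \<in> measurable N E" for x
    using C(2) x0(2)[OF that] \<phi>A[OF that] by eventually_elim blast
  have C_attained: "AE w in N. w \<in> C \<longrightarrow> w \<in> ?\<phi> x0"
    using C(2) by eventually_elim blast
  have "{x \<in> measurable N E. restr_elem N (\<lambda>w. f (x w)) C \<in> restr_set N W C} =
      {x \<in> measurable N E. AE w in N. w \<in> C \<longrightarrow> w \<in> ?\<phi> x}"
    using mem[OF _ C(1) CA] by blast
  then have "stable_preimage N (measurable N E) (\<lambda>x w. f (x w)) W A =
      restr_set N {x \<in> measurable N E. AE w in N. w \<in> C \<longrightarrow> w \<in> ?\<phi> x} C"
    unfolding stable_preimage_def \<A>_def[symmetric] C_def[symmetric] Let_def by simp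
  also have "\<dots> = graph_cond N E ?H"
  proof (rule eq_graph_condI[OF _ H])
    show "restr_set N {x \<in> measurable N E. AE w in N. w \<in> C \<longrightarrow> w \<in> ?\<phi> x} C \<in> cond_power N (measurable N E)"
      by (rule realization_in[OF \<phi> C(1) C_upper x0(1) C_attained])
    fix x assume x: "x \<in> measurable N E"
    have "AE w in N. w \<in> region N (restr_set N {x \<in> measurable N E. AE w in N. w \<in> C \<longrightarrow> w \<in> ?\<phi> x} C) x
        \<longleftrightarrow> w \<in> ?\<phi> x"
      by (rule region_realization[OF \<phi> C(1) C_upper x0(1) C_attained x])
    with AE_space show "AE w in N. w \<in> region N (restr_set N {x \<in> measurable N E. AE w in N. w \<in> C \<longrightarrow> w \<in> ?\<phi> x} C) x
        \<longleftrightarrow> (w, x w) \<in> ?H"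
      by eventually_elim simp
  qed
  finally show ?thesis .
qed

lemma stably_measurable_comp:
  assumes f: "f \<in> borel_measurable E"
  shows "stably_measurable N (measurable N E) (L0m_sigma N E) (borel_measurable N) (stable_borel N)
    (\<lambda>x w. f (x w))"
  unfolding stably_measurable_def
proof (intro conjI ballI impI)
  show "stable_fun N (measurable N E) (borel_measurable N) (\<lambda>x w. f (x w))"
    unfolding stable_fun_def
  proof (intro conjI ballI allI impI)
    show "(\<lambda>x w. f (x w)) ` measurable N E \<subseteq> borel_measurable N"
      using measurable_compose[OF _ f] by blast
  qed (auto simp: glue_def elim!: eventually_mono)
  fix W A assume W: "W \<in> stable_subsets N (borel_measurable N)" and A: "A \<in> sets N"
    and "restr_set N W A \<in> stable_borel N"
  then obtain K where K: "K \<in> sets (N \<Otimes>\<^sub>M borel)" "restr_set N W A = graph_cond N borel K"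
    using stable_borel_subset_graphs by blast
  have "{p \<in> space (N \<Otimes>\<^sub>M E). (fst p, f (snd p)) \<in> K} \<in> sets (N \<Otimes>\<^sub>M E)"
    using f K(1) by measurable
  then show "stable_preimage N (measurable N E) (\<lambda>x w. f (x w)) W A \<in> L0m_sigma N E"
    unfolding stable_preimage_eq_graph_cond[OF f W A K] L0m_sigma_eq_graphs by blast
qed

text \<open>The event in the definition of the stable indicator is the membership region, now expressed
  through a representation \<open>V|A\<close>.\<close>

lemma stable_indicator_eq_region:
  assumes V: "stable_set N V" and A: "A \<in> sets N"
  shows "AE w in N. stable_indicator N V A x w = indicator (region N (restr_set N V A) x) w"
proof -
  let ?R = "region N (restr_set N V A) x"
  define \<A> where "\<A> = {A' \<in> sets N. A' \<subseteq> A \<and> restr_elem N x A' \<in> restr_set N V A'}"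
  have \<A>: "B \<in> \<A> \<longleftrightarrow> B \<in> sets N \<and> B \<subseteq> A \<and> (AE w in N. w \<in> B \<longrightarrow> w \<in> ?R)" for B
    unfolding \<A>_def using restr_elem_in_iff_region[OF V A, of B x] by (auto simp: subset_iff)
  have "?R \<inter> A \<in> \<A>"
    unfolding \<A> using region_sets[OF V A] A by auto
  moreover have "AE w in N. w \<in> B \<longrightarrow> w \<in> ?R \<inter> A" if "B \<in> \<A>" for B
  proof -
    have "B \<subseteq> A" "AE w in N. w \<in> B \<longrightarrow> w \<in> ?R"
      using that unfolding \<A> by auto
    from this(2) show ?thesis
      by eventually_elim (use \<open>B \<subseteq> A\<close> in blast)
  qed
  moreover have "\<A> \<subseteq> sets N"
    unfolding \<A>_def by blast
  ultimately have "AE w in N. w \<in> ess_Union N \<A> \<longleftrightarrow> w \<in> ?R \<inter> A"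
    using ess_Union_attained[of \<A> N "?R \<inter> A"] by blast
  with region_subset[OF V A, of x] show ?thesis
    unfolding stable_indicator_def \<A>_def[symmetric] by eventually_elim (auto simp: indicator_def)
qed

end

section \<open>The stable conditional distribution as a conditional probability\<close>

context sigma_finite_subalgebra
begin

text \<open>Conditional monotone convergence: both sides have the same integral over each event of the
  subalgebra, by the ordinary monotone convergence theorem.\<close>

lemma nn_cond_exp_SUP:
  fixes f :: "nat \<Rightarrow> 'a \<Rightarrow> ennreal"
  assumes mono: "\<And>n. AE w in M. f n w \<le> f (Suc n) w" and f [measurable]: "\<And>n. f n \<in> borel_measurable M"
  shows "AE w in M. (SUP n. nn_cond_exp M F (f n) w) = nn_cond_exp M F (\<lambda>w. SUP n. f n w) w"
proof (rule nn_cond_exp_charact)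
  fix A assume A: "A \<in> sets F"
  then have [measurable]: "A \<in> sets M"
    using subalg by (auto simp: subalgebra_def)
  have [measurable]: "(indicator A :: 'a \<Rightarrow> ennreal) \<in> borel_measurable F"
    using A by simp
  have "(\<integral>\<^sup>+w\<in>A. (SUP n. f n w) \<partial>M) = (\<integral>\<^sup>+w. (SUP n. indicator A w * f n w) \<partial>M)"
    by (simp add: SUP_mult_left_ennreal mult.commute)
  also have "\<dots> = (SUP n. \<integral>\<^sup>+w. indicator A w * f n w \<partial>M)"
  proof (rule nn_integral_monotone_convergence_SUP_AE)
    show "AE w in M. indicator A w * f n w \<le> indicator A w * f (Suc n) w" for n
      using mono[of n] by eventually_elim (rule mult_left_mono, simp_all)
  qed measurable
  also have "\<dots> = (SUP n. \<integral>\<^sup>+w. indicator A w * nn_cond_exp M F (f n) w \<partial>M)"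
    by (subst nn_cond_exp_intg) auto
  also have "\<dots> = (\<integral>\<^sup>+w. (SUP n. indicator A w * nn_cond_exp M F (f n) w) \<partial>M)"
  proof (rule nn_integral_monotone_convergence_SUP_AE[symmetric])
    show "AE w in M. indicator A w * nn_cond_exp M F (f n) w \<le> indicator A w * nn_cond_exp M F (f (Suc n)) w" for n
      using nn_cond_exp_mono[OF mono f f, of n] by eventually_elim (rule mult_left_mono, simp_all)
  qed measurable
  also have "\<dots> = (\<integral>\<^sup>+w\<in>A. (SUP n. nn_cond_exp M F (f n) w) \<partial>M)"
    by (simp add: SUP_mult_left_ennreal mult.commute)
  finally show "(\<integral>\<^sup>+w\<in>A. (SUP n. f n w) \<partial>M) = (\<integral>\<^sup>+w\<in>A. (SUP n. nn_cond_exp M F (f n) w) \<partial>M)" .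
qed measurable

lemma nn_cond_exp_zero: "AE w in M. nn_cond_exp M F (\<lambda>_. 0) w = 0"
  using nn_cond_exp_F_meas[of "\<lambda>_. 0"] by (auto elim!: eventually_mono)

lemma nn_cond_exp_sum_lessThan:
  fixes f :: "nat \<Rightarrow> 'a \<Rightarrow> ennreal"
  assumes f [measurable]: "\<And>k. f k \<in> borel_measurable M"
  shows "AE w in M. (\<Sum>k<n. nn_cond_exp M F (f k) w) = nn_cond_exp M F (\<lambda>w. \<Sum>k<n. f k w) w"
proof (induction n)
  case 0
  show ?case
    using nn_cond_exp_zero by (auto elim!: eventually_mono)
next
  case (Suc n)
  have "(\<lambda>w. \<Sum>k<n. f k w) \<in> borel_measurable M"
    by measurable
  from nn_cond_exp_sum[OF this f[of n]] Suc.IH show ?case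
    by eventually_elim simp
qed

lemma nn_cond_exp_suminf:
  fixes f :: "nat \<Rightarrow> 'a \<Rightarrow> ennreal"
  assumes f [measurable]: "\<And>k. f k \<in> borel_measurable M"
  shows "AE w in M. (\<Sum>k. nn_cond_exp M F (f k) w) = nn_cond_exp M F (\<lambda>w. \<Sum>k. f k w) w"
proof -
  have "AE w in M. \<forall>n. (\<Sum>k<n. nn_cond_exp M F (f k) w) = nn_cond_exp M F (\<lambda>w. \<Sum>k<n. f k w) w"
    unfolding AE_all_countable using nn_cond_exp_sum_lessThan[of f, OF f] by blast
  moreover have "AE w in M. (SUP n. nn_cond_exp M F (\<lambda>w. \<Sum>k<n. f k w) w) =
      nn_cond_exp M F (\<lambda>w. SUP n. \<Sum>k<n. f k w) w"
    by (rule nn_cond_exp_SUP) auto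
  ultimately show ?thesis
    by eventually_elim (simp add: suminf_eq_SUP)
qed

lemma nn_cond_exp_le_1:
  assumes [measurable]: "f \<in> borel_measurable M" and "\<And>w. f w \<le> 1"
  shows "AE w in M. nn_cond_exp M F f w \<le> 1"
proof -
  have "AE w in M. nn_cond_exp M F f w \<le> nn_cond_exp M F (\<lambda>_. 1) w"
    by (rule nn_cond_exp_mono) (use assms in auto)
  moreover have "AE w in M. 1 = nn_cond_exp M F (\<lambda>_. 1) w"
    by (rule nn_cond_exp_F_meas) simp
  ultimately show ?thesis
    by eventually_elim simp
qed

lemma real_cond_exp_indicator:
  assumes [measurable]: "A \<in> sets M"
  shows "AE w in M. ennreal (real_cond_exp M F (indicator A) w) = nn_cond_exp M F (indicator A) w"
proof -
  have le_1: "AE w in M. nn_cond_exp M F (indicator A) w \<le> 1"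
    by (rule nn_cond_exp_le_1) (auto simp: indicator_def)
  have pos: "(\<lambda>w. ennreal (indicator A w)) = indicator A"
    by (auto simp: indicator_def)
  have neg: "(\<lambda>w. ennreal (- indicator A w)) = (\<lambda>_. 0)"
    by (rule ext) (simp add: ennreal_neg)
  from le_1 nn_cond_exp_zero show ?thesis
    unfolding real_cond_exp_def pos neg
  proof eventually_elim
    case (elim w)
    have "nn_cond_exp M F (indicator A) w < \<infinity>"
      using elim(1) by (rule le_less_trans) simp
    then show ?case
      using elim(2) by simp
  qed
qed

end

locale stable_cond_dist = prob_space M for M :: "'w measure" +
  fixes G :: "'w measure" and E :: "'e measure" and \<xi> :: "'w \<Rightarrow> 'e"
    and \<nu> :: "('w, 'e) cond_set \<Rightarrow> 'w \<Rightarrow> ennreal"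
  assumes subalgebra: "subalgebra M G" and \<xi> [measurable]: "\<xi> \<in> measurable M E"
    and dist: "stable_cond_distribution M G E \<xi> \<nu>"
begin

abbreviation N :: "'w measure" where "N \<equiv> restr_to_subalg M G"

end

sublocale stable_cond_dist \<subseteq> sigma_finite_subalgebra M G
  by (intro finite_measure_subalgebra_is_sigma_finite finite_measure_subalgebra.intro
      finite_measure_subalgebra_axioms.intro subalgebra finite_measure_axioms)

sublocale stable_cond_dist \<subseteq> N: L0m_space N E
proof (rule L0m_space.intro)
  show "finite_measure N"
    by (intro finite_measure_restr_to_subalg subalgebra finite_measure_axioms)
  show "L0m_space_axioms E"
    using not_empty measurable_space[OF \<xi>] by unfold_locales blast
qed

context stable_cond_dist
begin

lemma space_N: "space N = space M"
  by (rule space_restr_to_subalg)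

lemma measurable_N_iff: "f \<in> measurable N L \<longleftrightarrow> f \<in> measurable G L"
  using measurable_in_subalg[OF subalgebra, of f L] measurable_in_subalg'[OF subalgebra, of f L] by blast

lemma measurable_N_imp_M: "f \<in> measurable N L \<Longrightarrow> f \<in> measurable M L"
  unfolding measurable_N_iff by (rule measurable_from_subalg[OF subalgebra])

lemma AE_N_imp_M: "AE w in N. P w \<Longrightarrow> AE w in M. P w"
  by (rule AE_restr_to_subalg[OF subalgebra])

text \<open>The converse of \<open>AE_N_imp_M\<close> needs a \<open>\<G>\<close>-measurable event: the space \<open>N\<close> need not be complete.\<close>

lemma AE_M_imp_N:
  assumes "AE w in M. P w" "{w \<in> space N. P w} \<in> sets N"
  shows "AE w in N. P w"
proof (rule AE_restr_to_subalg2[OF subalgebra assms(1)])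
  show "P \<in> measurable G (count_space UNIV)"
    using assms(2) unfolding measurable_N_iff[symmetric] by (simp add: pred_def)
qed

lemma nn_cond_exp_measurable_N: "nn_cond_exp M G f \<in> borel_measurable N"
  unfolding measurable_N_iff by simp

lemma measurable_graph_\<xi> [measurable]: "(\<lambda>w. (w, \<xi> w)) \<in> measurable M (N \<Otimes>\<^sub>M E)"
proof (rule measurable_Pair)
  have "(\<lambda>w. w) \<in> measurable N N"
    by simp
  then show "(\<lambda>w. w) \<in> measurable M N"
    by (rule measurable_N_imp_M)
qed (rule \<xi>)

lemma stable_prob: "stable_prob_measure N (measurable N E) (L0m_sigma N E) \<nu>"
  using dist unfolding stable_cond_distribution_def Let_def by blast

lemma stable_meas: "stable_measure N (measurable N E) (L0m_sigma N E) \<nu>"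
  using stable_prob unfolding stable_prob_measure_def by blast

lemma graph_cond_in_sigma: "H \<in> sets (N \<Otimes>\<^sub>M E) \<Longrightarrow> graph_cond N E H \<in> L0m_sigma N E"
  unfolding N.L0m_sigma_eq_graphs by blast

lemma \<nu>_measurable:
  assumes "H \<in> sets (N \<Otimes>\<^sub>M E)"
  shows "\<nu> (graph_cond N E H) \<in> borel_measurable N"
  using stable_meas graph_cond_in_sigma[OF assms] unfolding stable_measure_def by blast

lemma \<nu>_UN:
  fixes H :: "nat \<Rightarrow> ('w \<times> 'e) set"
  assumes H: "\<And>k. H k \<in> sets (N \<Otimes>\<^sub>M E)" and dj: "disjoint_family H"
  shows "AE w in M. \<nu> (graph_cond N E (\<Union>k. H k)) w = (\<Sum>k. \<nu> (graph_cond N E (H k)) w)"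
proof (rule AE_N_imp_M)
  let ?C = "\<lambda>k. graph_cond N E (H k)"
  have M2: "\<forall>C :: nat \<Rightarrow> ('w, 'e) cond_set. range C \<subseteq> L0m_sigma N E \<and>
      (\<forall>i j. i \<noteq> j \<longrightarrow> cond_disjoint N (measurable N E) (C i) (C j)) \<longrightarrow>
      (AE w in N. \<nu> (\<Squnion>\<^bsub>cond_order N (measurable N E)\<^esub> (range C)) w = (\<Sum>k. \<nu> (C k) w))"
    using stable_meas unfolding stable_measure_def by blast
  have "range ?C \<subseteq> L0m_sigma N E"
    using graph_cond_in_sigma[OF H] by blast
  moreover have "cond_disjoint N (measurable N E) (?C i) (?C j)" if "i \<noteq> j" for i j
    using disjoint_family_onD[OF dj UNIV_I UNIV_I that] by (rule N.disjoint_graph_cond[OF H H])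
  ultimately have "AE w in N. \<nu> (\<Squnion>\<^bsub>cond_order N (measurable N E)\<^esub> (range ?C)) w = (\<Sum>k. \<nu> (?C k) w)"
    using M2 by blast
  then show "AE w in N. \<nu> (graph_cond N E (\<Union>k. H k)) w = (\<Sum>k. \<nu> (?C k) w)"
    using N.Sup_graph_cond[of UNIV H] H by simp
qed

text \<open>The event on which \<open>graph_cond N E H\<close> lives is the region of any of its elements, and is therefore
  contained in \<open>A\<close>; off this event, \<open>\<nu>\<close> vanishes by the definition of a stable measure.\<close>

lemma \<nu>_outside:
  assumes H: "H \<in> sets (N \<Otimes>\<^sub>M E)" and A: "A \<in> sets N" "H \<subseteq> A \<times> space E"
  shows "AE w in M. w \<notin> A \<longrightarrow> \<nu> (graph_cond N E H) w = 0"
proof (rule AE_N_imp_M)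
  obtain V B where V: "V \<subseteq> measurable N E" "stable_set N V" and B: "B \<in> sets N"
    and eq: "graph_cond N E H = restr_set N V B"
    using N.graph_cond_in[OF H] by (rule N.cond_powerE)
  have M1: "\<forall>V\<in>stable_subsets N (measurable N E). \<forall>A\<in>sets N. restr_set N V A \<in> L0m_sigma N E \<longrightarrow>
        (AE w in N. w \<notin> A \<longrightarrow> \<nu> (restr_set N V A) w = 0)"
    using stable_meas unfolding stable_measure_def by blast
  have "AE w in N. w \<notin> B \<longrightarrow> \<nu> (graph_cond N E H) w = 0"
    using M1 V B graph_cond_in_sigma[OF H] unfolding eq stable_subsets_def by blast
  moreover obtain v where v: "v \<in> V"
    using V(2) by (auto simp: stable_set_def)
  have vX: "v \<in> measurable N E"
    using v V(1) by blast
  have "AE w in N. w \<in> B \<longrightarrow> w \<in> A"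
    using N.region_of_element[OF V(2) B v] N.region_graph_cond[OF H vX] unfolding eq
    by eventually_elim (use A(2) in blast)
  ultimately show "AE w in N. w \<notin> A \<longrightarrow> \<nu> (graph_cond N E H) w = 0"
    by eventually_elim blast
qed

lemma \<nu>_empty: "AE w in M. \<nu> (graph_cond N E {}) w = 0"
  using \<nu>_outside[of "{}" "{}"] by simp

lemma \<nu>_Un:
  assumes H: "H \<in> sets (N \<Otimes>\<^sub>M E)" and K: "K \<in> sets (N \<Otimes>\<^sub>M E)" and "H \<inter> K = {}"
  shows "AE w in M. \<nu> (graph_cond N E (H \<union> K)) w = \<nu> (graph_cond N E H) w + \<nu> (graph_cond N E K) w"
proof -
  let ?F = "binaryset H K"
  have F: "?F k \<in> sets (N \<Otimes>\<^sub>M E)" for k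
    using H K by (auto simp: binaryset_def)
  have "disjoint_family ?F"
    using assms(3) by (auto simp: disjoint_family_on_def binaryset_def)
  from \<nu>_UN[OF F this] \<nu>_empty show ?thesis
  proof eventually_elim
    case (elim w)
    have "(\<Sum>k. \<nu> (graph_cond N E (?F k)) w) = (\<Sum>k\<in>{0, 1}. \<nu> (graph_cond N E (?F k)) w)"
      using elim(2) by (intro suminf_finite) (auto simp: binaryset_def)
    also have "\<dots> = \<nu> (graph_cond N E H) w + \<nu> (graph_cond N E K) w"
      by (simp add: binaryset_def)
    finally show ?case
      using elim(1) by (simp add: UN_binaryset_eq)
  qed
qed

lemma \<nu>_space: "AE w in M. \<nu> (graph_cond N E (space (N \<Otimes>\<^sub>M E))) w = 1"
  using stable_prob unfolding stable_prob_measure_def N.full_eq_graph_cond by (blast intro: AE_N_imp_M)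

text \<open>Split \<open>L\<^sup>0(F)\<close>, whose measure is the conditional probability of \<open>\<xi> \<in> F\<close>, into the rectangles over \<open>A\<close>
  and over its complement. On \<open>A\<close> the second summand vanishes, off \<open>A\<close> the first does.\<close>

lemma \<nu>_rectangle:
  assumes A: "A \<in> sets N" and F: "F \<in> sets E"
  shows "AE w in M. \<nu> (graph_cond N E (A \<times> F)) w = nn_cond_exp M G (\<lambda>v. indicator (A \<times> F) (v, \<xi> v)) w"
proof -
  have [measurable]: "(indicator A :: 'w \<Rightarrow> ennreal) \<in> borel_measurable G" "A \<in> sets M"
    "\<xi> -` F \<inter> space M \<in> sets M"
    using A measurable_sets[OF \<xi> F] subalgebra
    by (auto simp: sets_restr_to_subalg[OF subalgebra] subalgebra_def)
  have sets: "A \<times> F \<in> sets (N \<Otimes>\<^sub>M E)" "(space N - A) \<times> F \<in> sets (N \<Otimes>\<^sub>M E)"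
    using A F by auto
  have sub: "A \<times> F \<subseteq> A \<times> space E" "(space N - A) \<times> F \<subseteq> (space N - A) \<times> space E"
    using sets.sets_into_space[OF F] by auto
  let ?B = "\<xi> -` F \<inter> space M"
  have "L0m_cond N E F = graph_cond N E (space N \<times> F)"
    unfolding L0m_cond_def by (rule N.L0m_glue_const_eq_graph_cond[OF F]) simp
  moreover have "A \<times> F \<union> (space N - A) \<times> F = space N \<times> F"
    using sets.sets_into_space[OF A] by auto
  ultimately have L0m: "L0m_cond N E F = graph_cond N E (A \<times> F \<union> (space N - A) \<times> F)"
    by simp
  have "AE w in M. real_cond_exp M G (\<lambda>v. indicator F (\<xi> v)) w = real_cond_exp M G (indicator ?B) w"
    using F by (intro real_cond_exp_cong) (auto simp: indicator_def)
  moreover have "AE w in M. ennreal (real_cond_exp M G (\<lambda>v. indicator F (\<xi> v)) w) = \<nu> (L0m_cond N E F) w"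
    using dist F unfolding stable_cond_distribution_def Let_def by blast
  moreover have "AE w in M. ennreal (real_cond_exp M G (indicator ?B) w) = nn_cond_exp M G (indicator ?B) w"
    by (rule real_cond_exp_indicator) measurable
  ultimately have cond: "AE w in M. nn_cond_exp M G (indicator ?B) w = \<nu> (L0m_cond N E F) w"
    by eventually_elim simp
  have split: "AE w in M. \<nu> (L0m_cond N E F) w =
      \<nu> (graph_cond N E (A \<times> F)) w + \<nu> (graph_cond N E ((space N - A) \<times> F)) w"
    unfolding L0m by (rule \<nu>_Un[OF sets]) auto
  have on_A: "AE w in M. w \<notin> A \<longrightarrow> \<nu> (graph_cond N E (A \<times> F)) w = 0"
    by (rule \<nu>_outside[OF sets(1) A sub(1)])
  have off_A: "AE w in M. w \<notin> space N - A \<longrightarrow> \<nu> (graph_cond N E ((space N - A) \<times> F)) w = 0"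
    by (rule \<nu>_outside[OF sets(2) _ sub(2)]) (use A in auto)
  have "AE w in M. indicator A w * nn_cond_exp M G (indicator ?B) w =
      nn_cond_exp M G (\<lambda>v. indicator A v * indicator ?B v) w"
    by (rule nn_cond_exp_prod) measurable
  moreover have "AE w in M. nn_cond_exp M G (\<lambda>v. indicator A v * indicator ?B v) w =
      nn_cond_exp M G (\<lambda>v. indicator (A \<times> F) (v, \<xi> v)) w"
  proof (rule nn_cond_exp_cong)
    show "(\<lambda>v. indicator (A \<times> F) (v, \<xi> v) :: ennreal) \<in> borel_measurable M"
      by (rule measurable_compose[OF measurable_graph_\<xi>]) (use sets(1) in measurable)
    show "(\<lambda>v. indicator A v * indicator ?B v :: ennreal) \<in> borel_measurable M"
      by measurable
    show "AE w in M. indicator A w * indicator ?B w = (indicator (A \<times> F) (w, \<xi> w) :: ennreal)"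
      by (intro AE_I2) (simp add: indicator_def)
  qed
  ultimately show ?thesis
    using cond split on_A off_A AE_space
    by eventually_elim (auto simp: space_N indicator_def split: if_splits)
qed

lemma indicator_graph_measurable:
  assumes "H \<in> sets (N \<Otimes>\<^sub>M E)"
  shows "(\<lambda>v. indicator H (v, \<xi> v) :: ennreal) \<in> borel_measurable M"
  by (rule measurable_compose[OF measurable_graph_\<xi>]) (use assms in measurable)

text \<open>Both sides are countably additive in \<open>H\<close> and have total mass one, so agreement on the
  intersection-stable generator of rectangles suffices.\<close>

lemma \<nu>_eq_nn_cond_exp:
  assumes "H \<in> sets (N \<Otimes>\<^sub>M E)"
  shows "AE w in M. \<nu> (graph_cond N E H) w = nn_cond_exp M G (\<lambda>v. indicator H (v, \<xi> v)) w"
proof -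
  have gen: "sigma_sets (space N \<times> space E) {A \<times> F |A F. A \<in> sets N \<and> F \<in> sets E} = sets (N \<Otimes>\<^sub>M E)"
    by (simp add: sets_pair_measure)
  have "H \<in> sigma_sets (space N \<times> space E) {A \<times> F |A F. A \<in> sets N \<and> F \<in> sets E}"
    using assms unfolding gen .
  with Int_stable_pair_measure_generator[of N E] pair_measure_closed[of N E] show ?thesis
  proof (induction rule: sigma_sets_induct_disjoint)
    case (basic K)
    then show ?case
      using \<nu>_rectangle by blast
  next
    case empty
    show ?case
      using \<nu>_empty nn_cond_exp_zero by eventually_elim simp
  next
    case (compl K)
    then have K: "K \<in> sets (N \<Otimes>\<^sub>M E)"
      unfolding gen by blast
    let ?L = "space (N \<Otimes>\<^sub>M E) - K"
    have L: "?L \<in> sets (N \<Otimes>\<^sub>M E)"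
      using K by auto
    have KL: "K \<union> ?L = space (N \<Otimes>\<^sub>M E)"
      using sets.sets_into_space[OF K] by blast
    have 1: "AE w in M. \<nu> (graph_cond N E (K \<union> ?L)) w = \<nu> (graph_cond N E K) w + \<nu> (graph_cond N E ?L) w"
      by (rule \<nu>_Un[OF K L]) blast
    have "AE w in M. nn_cond_exp M G (\<lambda>v. indicator K (v, \<xi> v)) w + nn_cond_exp M G (\<lambda>v. indicator ?L (v, \<xi> v)) w =
        nn_cond_exp M G (\<lambda>v. indicator K (v, \<xi> v) + indicator ?L (v, \<xi> v)) w"
      by (rule nn_cond_exp_sum[OF indicator_graph_measurable[OF K] indicator_graph_measurable[OF L]])
    moreover have "AE w in M. nn_cond_exp M G (\<lambda>v. indicator K (v, \<xi> v) + indicator ?L (v, \<xi> v)) w =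
        nn_cond_exp M G (\<lambda>_. 1) w"
    proof (rule nn_cond_exp_cong)
      show "AE w in M. indicator K (w, \<xi> w) + indicator ?L (w, \<xi> w) = (1 :: ennreal)"
        using measurable_space[OF \<xi>] by (intro AE_I2) (auto simp: indicator_def space_pair_measure space_N)
    qed (intro borel_measurable_add indicator_graph_measurable K L, simp)
    moreover have "AE w in M. 1 = nn_cond_exp M G (\<lambda>_. 1) w"
      by (rule nn_cond_exp_F_meas) simp
    moreover have "AE w in M. nn_cond_exp M G (\<lambda>v. indicator K (v, \<xi> v)) w \<le> 1"
      by (rule nn_cond_exp_le_1[OF indicator_graph_measurable[OF K]]) (simp add: indicator_def)
    ultimately have "AE w in M. \<nu> (graph_cond N E ?L) w = nn_cond_exp M G (\<lambda>v. indicator ?L (v, \<xi> v)) w"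
      using 1[unfolded KL] \<nu>_space compl.IH
    proof eventually_elim
      case (elim w)
      let ?a = "nn_cond_exp M G (\<lambda>v. indicator K (v, \<xi> v)) w"
      have "?a + \<nu> (graph_cond N E ?L) w = ?a + nn_cond_exp M G (\<lambda>v. indicator ?L (v, \<xi> v)) w"
        using elim by simp
      moreover have "?a \<noteq> \<infinity>"
        using elim(4) by (auto simp: top_unique)
      ultimately show ?case
        by (simp only: ennreal_add_left_cancel) simp
    qed
    then show ?case
      by (simp add: space_pair_measure)
  next
    case (union K)
    then have K: "K i \<in> sets (N \<Otimes>\<^sub>M E)" for i
      unfolding gen by blast
    have "AE w in M. \<forall>i. \<nu> (graph_cond N E (K i)) w = nn_cond_exp M G (\<lambda>v. indicator (K i) (v, \<xi> v)) w"
      unfolding AE_all_countable using union.IH by blast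
    with \<nu>_UN[OF K union.hyps(1)] nn_cond_exp_suminf[of "\<lambda>i v. indicator (K i) (v, \<xi> v)", OF indicator_graph_measurable[OF K]]
    show ?case
      by eventually_elim (simp add: suminf_indicator[OF union.hyps(1)])
  qed
qed

text \<open>This transfers almost sure statements from the \<open>\<G>\<close>-measurable functions to \<open>\<xi>\<close>, although \<open>\<xi>\<close> need
  not be \<open>\<G>\<close>-measurable: if each \<open>x\<close> avoids \<open>H\<close> almost surely, then \<open>H\<close> defines the empty conditional set, which has measure
  zero.\<close>

lemma AE_graph_of_sections:
  assumes H: "H \<in> sets (N \<Otimes>\<^sub>M E)" and null: "\<And>x. x \<in> measurable N E \<Longrightarrow> AE w in N. (w, x w) \<notin> H"
  shows "AE w in M. (w, \<xi> w) \<notin> H"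
proof -
  have "graph_cond N E H = graph_cond N E {}"
    unfolding graph_cond_def
  proof (rule N.cond_set_of_cong[OF N.local_map_graph[OF H] N.local_map_graph])
    fix x assume "x \<in> measurable N E"
    from null[OF this] show "AE w in N. w \<in> {w \<in> space N. (w, x w) \<in> H} \<longleftrightarrow> w \<in> {w \<in> space N. (w, x w) \<in> {}}"
      by eventually_elim simp
  qed simp
  with \<nu>_empty have "AE w in M. \<nu> (graph_cond N E H) w = 0"
    by simp
  with \<nu>_eq_nn_cond_exp[OF H] have "AE w in M. nn_cond_exp M G (\<lambda>v. indicator H (v, \<xi> v)) w = 0"
    by eventually_elim simp
  then have "(\<integral>\<^sup>+w. 1 * nn_cond_exp M G (\<lambda>v. indicator H (v, \<xi> v)) w \<partial>M) = 0"
    by (subst nn_integral_0_iff_AE) auto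
  also have "(\<integral>\<^sup>+w. 1 * nn_cond_exp M G (\<lambda>v. indicator H (v, \<xi> v)) w \<partial>M) =
      (\<integral>\<^sup>+w. 1 * indicator H (w, \<xi> w) \<partial>M)"
    by (rule nn_cond_exp_intg) (simp_all add: indicator_graph_measurable[OF H])
  finally have "AE w in M. indicator H (w, \<xi> w) = (0 :: ennreal)"
    using indicator_graph_measurable[OF H] by (simp add: nn_integral_0_iff_AE)
  then show ?thesis
    by eventually_elim (simp add: indicator_eq_0_iff)
qed

end

section \<open>Stable integrals as conditional expectations\<close>

lemma SUP_ereal_eq_imp_SUP_ennreal_eq:
  assumes "incseq a" "(SUP n. ereal (a n)) = ereal b"
  shows "(SUP n. ennreal (a n)) = ennreal b"
proof -
  have "incseq (\<lambda>n. ereal (a n))"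
    using assms(1) by (simp add: incseq_def)
  from LIMSEQ_SUP[OF this] have "a \<longlonglongrightarrow> b"
    unfolding assms(2) by simp
  then have "(\<lambda>n. ennreal (a n)) \<longlonglongrightarrow> ennreal b"
    by (rule tendsto_ennrealI)
  moreover have "incseq (\<lambda>n. ennreal (a n))"
    using assms(1) by (simp add: incseq_def ennreal_leI)
  ultimately show ?thesis
    using LIMSEQ_SUP LIMSEQ_unique by blast
qed

context stable_cond_dist
begin

lemma elementary_integral_eq:
  fixes r :: "nat \<Rightarrow> 'w \<Rightarrow> real" and H :: "nat \<Rightarrow> ('w \<times> 'e) set"
  assumes r: "\<And>k. r k \<in> borel_measurable N" and H: "\<And>k. H k \<in> sets (N \<Otimes>\<^sub>M E)"
  shows "AE w in M. (\<Sum>k\<le>n. ennreal (r k w) * \<nu> (graph_cond N E (H k)) w) =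
    nn_cond_exp M G (\<lambda>v. \<Sum>k\<le>n. ennreal (r k v) * indicator (H k) (v, \<xi> v)) w"
proof -
  have r_G: "(\<lambda>v. ennreal (r k v)) \<in> borel_measurable G" for k
    using r[of k] unfolding measurable_N_iff by measurable
  have r_M: "(\<lambda>v. ennreal (r k v)) \<in> borel_measurable M" for k
    using measurable_N_imp_M[OF r[of k]] by measurable
  have "AE w in M. ennreal (r k w) * \<nu> (graph_cond N E (H k)) w =
      nn_cond_exp M G (\<lambda>v. ennreal (r k v) * indicator (H k) (v, \<xi> v)) w" for k
    using nn_cond_exp_prod[OF r_G indicator_graph_measurable[OF H], of k k] \<nu>_eq_nn_cond_exp[OF H, of k]
    by eventually_elim simp
  then have "AE w in M. \<forall>k. ennreal (r k w) * \<nu> (graph_cond N E (H k)) w =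
      nn_cond_exp M G (\<lambda>v. ennreal (r k v) * indicator (H k) (v, \<xi> v)) w"
    unfolding AE_all_countable by blast
  moreover have "AE w in M. (\<Sum>k<Suc n. nn_cond_exp M G (\<lambda>v. ennreal (r k v) * indicator (H k) (v, \<xi> v)) w) =
      nn_cond_exp M G (\<lambda>v. \<Sum>k<Suc n. ennreal (r k v) * indicator (H k) (v, \<xi> v)) w"
    by (intro nn_cond_exp_sum_lessThan borel_measurable_times_ennreal r_M indicator_graph_measurable H)
  ultimately show ?thesis
    unfolding lessThan_Suc_atMost by eventually_elim simp
qed

text \<open>The pieces \<open>V k|A k\<close> come from product-measurable sets \<open>H k\<close>, and \<open>\<gamma> = \<Sum> r k 1\<^bsub>H k\<^esub>\<close>.\<close>

lemma elementary_integral_as_graph: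
  assumes "has_elementary_integral N (measurable N E) (L0m_sigma N E) \<nu> g I"
  shows "\<exists>\<gamma> :: 'w \<times> 'e \<Rightarrow> real. \<gamma> \<in> borel_measurable (N \<Otimes>\<^sub>M E) \<and>
    (\<forall>x\<in>measurable N E. AE w in N. g x w = \<gamma> (w, x w)) \<and>
    (AE w in M. I w = nn_cond_exp M G (\<lambda>v. ennreal (\<gamma> (v, \<xi> v))) w)"
proof -
  obtain n :: nat and r V A where
    piece: "\<forall>k\<le>n. r k \<in> borel_measurable N \<and> (AE w in N. 0 \<le> r k w) \<and>
      V k \<in> stable_subsets N (measurable N E) \<and> A k \<in> sets N \<and> restr_set N (V k) (A k) \<in> L0m_sigma N E"
    and g: "\<forall>x\<in>measurable N E. AE w in N. g x w = (\<Sum>k\<le>n. r k w * stable_indicator N (V k) (A k) x w)"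
    and I: "AE w in N. I w = (\<Sum>k\<le>n. ennreal (r k w) * \<nu> (restr_set N (V k) (A k)) w)"
    using assms unfolding has_elementary_integral_def by blast
  have "\<exists>H. H \<in> sets (N \<Otimes>\<^sub>M E) \<and> (k \<le> n \<longrightarrow> restr_set N (V k) (A k) = graph_cond N E H)" for k
    using piece unfolding N.L0m_sigma_eq_graphs by (cases "k \<le> n") auto
  then obtain H where H: "\<And>k. H k \<in> sets (N \<Otimes>\<^sub>M E)"
    and VA: "\<And>k. k \<le> n \<Longrightarrow> restr_set N (V k) (A k) = graph_cond N E (H k)"
    by metis
  \<comment> \<open>The coefficients are only almost surely nonnegative, and nothing is known beyond the index \<open>n\<close>.\<close>
  define s where "s k = (if k \<le> n then \<lambda>w. max 0 (r k w) else (\<lambda>_. 0))" for k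
  have s: "s k \<in> borel_measurable N" for k
    using piece by (auto simp: s_def)
  have s_nonneg: "0 \<le> s k w" for k w
    by (simp add: s_def)
  have "AE w in N. k \<le> n \<longrightarrow> r k w = s k w" for k
    using piece by (cases "k \<le> n") (auto simp: s_def elim!: eventually_mono)
  then have rs: "AE w in N. \<forall>k\<le>n. r k w = s k w"
    unfolding AE_all_countable by blast
  define \<gamma> where "\<gamma> p = (\<Sum>k\<le>n. s k (fst p) * indicator (H k) p)" for p
  have \<gamma>: "\<gamma> \<in> borel_measurable (N \<Otimes>\<^sub>M E)"
    unfolding \<gamma>_def[abs_def] using s H by measurable
  moreover have "AE w in N. g x w = \<gamma> (w, x w)" if x: "x \<in> measurable N E" for x
  proof -
    have "AE w in N. k \<le> n \<longrightarrow> stable_indicator N (V k) (A k) x w = indicator (H k) (w, x w)" for k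
    proof (cases "k \<le> n")
      case True
      then have "stable_set N (V k)" "A k \<in> sets N"
        using piece by (auto simp: stable_subsets_def)
      from N.stable_indicator_eq_region[OF this, of x] N.region_graph_cond[OF H[of k] x] show ?thesis
        unfolding VA[OF True] by eventually_elim (simp add: indicator_def)
    qed simp
    then have "AE w in N. \<forall>k\<le>n. stable_indicator N (V k) (A k) x w = indicator (H k) (w, x w)"
      unfolding AE_all_countable by blast
    moreover have "AE w in N. g x w = (\<Sum>k\<le>n. r k w * stable_indicator N (V k) (A k) x w)"
      using g x by blast
    ultimately show ?thesis
      using rs by eventually_elim (simp add: \<gamma>_def)
  qed
  moreover have "AE w in M. I w = nn_cond_exp M G (\<lambda>v. ennreal (\<gamma> (v, \<xi> v))) w"
  proof -
    have \<gamma>_sum: "ennreal (\<gamma> (v, \<xi> v)) = (\<Sum>k\<le>n. ennreal (s k v) * indicator (H k) (v, \<xi> v))" for v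
    proof -
      have "ennreal (\<gamma> (v, \<xi> v)) = (\<Sum>k\<le>n. ennreal (s k v * indicator (H k) (v, \<xi> v)))"
        unfolding \<gamma>_def fst_conv using s_nonneg by (intro sum_ennreal[symmetric]) simp
      also have "\<dots> = (\<Sum>k\<le>n. ennreal (s k v) * indicator (H k) (v, \<xi> v))"
        by (intro sum.cong refl) (simp add: indicator_def)
      finally show ?thesis .
    qed
    have "AE w in M. (\<Sum>k\<le>n. ennreal (s k w) * \<nu> (graph_cond N E (H k)) w) =
        nn_cond_exp M G (\<lambda>v. ennreal (\<gamma> (v, \<xi> v))) w"
      unfolding \<gamma>_sum by (rule elementary_integral_eq[of s H n, OF s H])
    with AE_N_imp_M[OF I] AE_N_imp_M[OF rs] show ?thesis
      by eventually_elim (simp add: VA)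
  qed
  ultimately show ?thesis
    by blast
qed

text \<open>Every admissible sequence of elementary functions leads to the same integral: off a set \<open>H\<close> that
  each \<open>x\<close> avoids almost surely, the functions \<open>\<gamma> n\<close> on the product increase to \<open>f\<close>. Hence they do so along \<open>\<xi>\<close>, where
  conditional monotone convergence applies.\<close>

lemma stable_nn_integral_unique:
  assumes f: "f \<in> borel_measurable E"
    and I: "has_stable_nn_integral N (measurable N E) (L0m_sigma N E) \<nu> (\<lambda>x w. f (x w)) I"
  shows "AE w in M. I w = nn_cond_exp M G (\<lambda>v. ennreal (f (\<xi> v))) w"
proof -
  obtain g J where elem: "\<forall>n. has_elementary_integral N (measurable N E) (L0m_sigma N E) \<nu> (g n) (J n)"
    and inc: "\<forall>n. \<forall>x\<in>measurable N E. AE w in N. g n x w \<le> g (Suc n) x w"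
    and sup: "\<forall>x\<in>measurable N E. AE w in N. (SUP n. ereal (g n x w)) = ereal (f (x w))"
    and IJ: "AE w in N. I w = (SUP n. J n w)"
    using I unfolding has_stable_nn_integral_def by blast
  have "\<forall>n. \<exists>\<gamma> :: 'w \<times> 'e \<Rightarrow> real. \<gamma> \<in> borel_measurable (N \<Otimes>\<^sub>M E) \<and>
      (\<forall>x\<in>measurable N E. AE w in N. g n x w = \<gamma> (w, x w)) \<and>
      (AE w in M. J n w = nn_cond_exp M G (\<lambda>v. ennreal (\<gamma> (v, \<xi> v))) w)"
    using elem by (intro allI elementary_integral_as_graph) (rule spec)
  from choice[OF this] obtain \<gamma> :: "nat \<Rightarrow> 'w \<times> 'e \<Rightarrow> real" where
    \<gamma>_all: "\<forall>n. \<gamma> n \<in> borel_measurable (N \<Otimes>\<^sub>M E) \<and>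
      (\<forall>x\<in>measurable N E. AE w in N. g n x w = \<gamma> n (w, x w)) \<and>
      (AE w in M. J n w = nn_cond_exp M G (\<lambda>v. ennreal (\<gamma> n (v, \<xi> v))) w)"
    by (rule exE)
  have \<gamma> [measurable]: "\<gamma> n \<in> borel_measurable (N \<Otimes>\<^sub>M E)"
    and \<gamma>_g: "x \<in> measurable N E \<Longrightarrow> AE w in N. g n x w = \<gamma> n (w, x w)"
    and J: "AE w in M. J n w = nn_cond_exp M G (\<lambda>v. ennreal (\<gamma> n (v, \<xi> v))) w" for n x
    using spec[OF \<gamma>_all, of n] by blast+
  define H where "H = {p \<in> space (N \<Otimes>\<^sub>M E).
      \<not> ((\<forall>n. \<gamma> n p \<le> \<gamma> (Suc n) p) \<and> (SUP n. ereal (\<gamma> n p)) = ereal (f (snd p)))}"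
  have "H \<in> sets (N \<Otimes>\<^sub>M E)"
    unfolding H_def using f by measurable
  moreover have "AE w in N. (w, x w) \<notin> H" if x: "x \<in> measurable N E" for x
  proof -
    have "AE w in N. \<forall>n. g n x w = \<gamma> n (w, x w)"
      unfolding AE_all_countable using \<gamma>_g[OF x] by blast
    moreover have "AE w in N. \<forall>n. g n x w \<le> g (Suc n) x w"
      unfolding AE_all_countable using inc x by blast
    moreover have "AE w in N. (SUP n. ereal (g n x w)) = ereal (f (x w))"
      using sup x by blast
    ultimately show ?thesis
      by eventually_elim (simp add: H_def)
  qed
  ultimately have "AE w in M. (w, \<xi> w) \<notin> H"
    by (rule AE_graph_of_sections)
  then have conv: "AE w in M. incseq (\<lambda>n. \<gamma> n (w, \<xi> w)) \<and> (SUP n. ereal (\<gamma> n (w, \<xi> w))) = ereal (f (\<xi> w))"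
    using AE_space by eventually_elim
      (use measurable_space[OF \<xi>] in \<open>auto simp: H_def space_pair_measure space_N incseq_Suc_iff\<close>)
  have \<gamma>_M: "(\<lambda>v. ennreal (\<gamma> n (v, \<xi> v))) \<in> borel_measurable M" for n
    by measurable
  have f_M: "(\<lambda>v. ennreal (f (\<xi> v))) \<in> borel_measurable M"
    using f by measurable
  have "AE w in M. (SUP n. nn_cond_exp M G (\<lambda>v. ennreal (\<gamma> n (v, \<xi> v))) w) =
      nn_cond_exp M G (\<lambda>v. SUP n. ennreal (\<gamma> n (v, \<xi> v))) w"
  proof (rule nn_cond_exp_SUP[OF _ \<gamma>_M])
    show "AE w in M. ennreal (\<gamma> n (w, \<xi> w)) \<le> ennreal (\<gamma> (Suc n) (w, \<xi> w))" for n
      using conv by eventually_elim (auto simp: incseq_Suc_iff intro!: ennreal_leI)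
  qed
  moreover have "AE w in M. nn_cond_exp M G (\<lambda>v. SUP n. ennreal (\<gamma> n (v, \<xi> v))) w =
      nn_cond_exp M G (\<lambda>v. ennreal (f (\<xi> v))) w"
  proof (rule nn_cond_exp_cong)
    show "AE w in M. (SUP n. ennreal (\<gamma> n (w, \<xi> w))) = ennreal (f (\<xi> w))"
      using conv by eventually_elim (rule SUP_ereal_eq_imp_SUP_ennreal_eq, simp_all)
  qed (use \<gamma>_M f_M in measurable)
  moreover have "AE w in M. \<forall>n. J n w = nn_cond_exp M G (\<lambda>v. ennreal (\<gamma> n (v, \<xi> v))) w"
    unfolding AE_all_countable using J by blast
  ultimately show ?thesis
    using AE_N_imp_M[OF IJ] by eventually_elim simp
qed

lemma AE_N_eqI:
  fixes u v :: "'w \<Rightarrow> ennreal"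
  assumes "u \<in> borel_measurable N" "v \<in> borel_measurable N" "AE w in M. u w = v w"
  shows "AE w in N. u w = v w"
  using assms by (intro AE_M_imp_N) measurable

text \<open>The level sets of a simple function give a decomposition of \<open>X\<close> into the conditional sets
  \<open>L\<^sup>0({s = c})\<close>.\<close>

lemma has_elementary_integral_simple:
  fixes s :: "'e \<Rightarrow> real"
  assumes s: "simple_function E s" and nonneg: "\<And>e. e \<in> space E \<Longrightarrow> 0 \<le> s e"
  shows "has_elementary_integral N (measurable N E) (L0m_sigma N E) \<nu> (\<lambda>x w. s (x w))
    (nn_cond_exp M G (\<lambda>v. ennreal (s (\<xi> v))))"
proof -
  have fin: "finite (s ` space E)"
    using s by (rule simple_functionD)
  obtain c where c0: "bij_betw c {0..<card (s ` space E)} (s ` space E)"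
    using ex_bij_betw_nat_finite[OF fin] by blast
  obtain n where "card (s ` space E) = Suc n"
    using fin N.space_E by (metis card_gt_0_iff gr0_implies_Suc image_is_empty)
  then have c: "bij_betw c {..n} (s ` space E)"
    using c0 by (simp add: atLeast0LessThan lessThan_Suc_atMost)
  define H where "H k = space N \<times> (s -` {c k} \<inter> space E)" for k
  have H: "H k \<in> sets (N \<Otimes>\<^sub>M E)" for k
    unfolding H_def by (intro pair_measureI sets.top simple_functionD[OF s])
  have "\<forall>k. \<exists>V A. V \<in> stable_subsets N (measurable N E) \<and> A \<in> sets N \<and> graph_cond N E (H k) = restr_set N V A"
    using N.graph_cond_in[OF H] unfolding cond_power_def by blast
  then obtain V A where VA: "\<And>k. V k \<in> stable_subsets N (measurable N E)" "\<And>k. A k \<in> sets N"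
    "\<And>k. restr_set N (V k) (A k) = graph_cond N E (H k)"
    by metis
  have c_nonneg: "0 \<le> c k" if "k \<le> n" for k
  proof -
    have "c k \<in> s ` space E"
      using bij_betwE[OF c] that by simp
    then show ?thesis
      using nonneg by auto
  qed
  have sum_pieces: "(\<Sum>k\<le>n. c k * indicator (H k) (w, e)) = s e" if "w \<in> space N" "e \<in> space E" for w e
  proof -
    obtain k where k: "k \<le> n" "c k = s e"
      using c \<open>e \<in> space E\<close> unfolding bij_betw_def by (metis atMost_iff image_iff)
    have "(\<Sum>j\<le>n. c j * indicator (H j) (w, e)) = (\<Sum>j\<le>n. if j = k then c k else 0)"
    proof (rule sum.cong[OF refl])
      fix j assume "j \<in> {..n}"
      then have "c j = c k \<longleftrightarrow> j = k"
        using c k(1) unfolding bij_betw_def inj_on_def by auto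
      then show "c j * indicator (H j) (w, e) = (if j = k then c k else 0)"
        using that k(2) by (auto simp: H_def indicator_def)
    qed
    then show ?thesis
      using k by simp
  qed
  have disj: "H i \<inter> H j = {}" if "i \<le> n" "j \<le> n" "i \<noteq> j" for i j
    using c that unfolding bij_betw_def inj_on_def H_def by auto
  have cover: "(\<Union>k\<in>{..n}. H k) = space (N \<Otimes>\<^sub>M E)"
  proof -
    have "(\<Union>k\<in>{..n}. s -` {c k} \<inter> space E) = space E"
      using c unfolding bij_betw_def by blast
    then show ?thesis
      unfolding H_def space_pair_measure by blast
  qed
  have "\<forall>x\<in>measurable N E. AE w in N. s (x w) = (\<Sum>k\<le>n. c k * stable_indicator N (V k) (A k) x w)"
  proof
    fix x assume x: "x \<in> measurable N E"
    have "AE w in N. stable_indicator N (V k) (A k) x w = indicator (H k) (w, x w)" for k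
    proof -
      have "stable_set N (V k)"
        using VA(1)[of k] by (simp add: stable_subsets_def)
      from N.stable_indicator_eq_region[OF this VA(2)[of k], of x] N.region_graph_cond[OF H[of k] x] show ?thesis
        unfolding VA(3) by eventually_elim (simp add: indicator_def)
    qed
    then have "AE w in N. \<forall>k. stable_indicator N (V k) (A k) x w = indicator (H k) (w, x w)"
      unfolding AE_all_countable by blast
    with AE_space show "AE w in N. s (x w) = (\<Sum>k\<le>n. c k * stable_indicator N (V k) (A k) x w)"
      by eventually_elim (simp only: sum_pieces measurable_space[OF x])
  qed
  moreover have "AE w in N. nn_cond_exp M G (\<lambda>v. ennreal (s (\<xi> v))) w =
      (\<Sum>k\<le>n. ennreal (c k) * \<nu> (restr_set N (V k) (A k)) w)"
  proof (rule AE_N_eqI[OF nn_cond_exp_measurable_N])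
    have [measurable]: "\<nu> (graph_cond N E (H k)) \<in> borel_measurable N" for k
      by (rule \<nu>_measurable[OF H])
    show "(\<lambda>w. \<Sum>k\<le>n. ennreal (c k) * \<nu> (restr_set N (V k) (A k)) w) \<in> borel_measurable N"
      unfolding VA(3) by measurable
    have [measurable]: "s \<in> borel_measurable E"
      using s by (rule borel_measurable_simple_function)
    have "AE w in M. nn_cond_exp M G (\<lambda>v. ennreal (s (\<xi> v))) w =
        nn_cond_exp M G (\<lambda>v. \<Sum>k\<le>n. ennreal (c k) * indicator (H k) (v, \<xi> v)) w"
    proof (rule nn_cond_exp_cong)
      show "AE w in M. ennreal (s (\<xi> w)) = (\<Sum>k\<le>n. ennreal (c k) * indicator (H k) (w, \<xi> w))"
        using AE_space
      proof eventually_elim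
        case (elim w)
        have "ennreal (s (\<xi> w)) = ennreal (\<Sum>k\<le>n. c k * indicator (H k) (w, \<xi> w))"
          using sum_pieces[of w "\<xi> w"] measurable_space[OF \<xi> elim] elim by (simp add: space_N)
        also have "\<dots> = (\<Sum>k\<le>n. ennreal (c k * indicator (H k) (w, \<xi> w)))"
          using c_nonneg by (intro sum_ennreal[symmetric]) simp
        also have "\<dots> = (\<Sum>k\<le>n. ennreal (c k) * indicator (H k) (w, \<xi> w))"
          by (intro sum.cong refl) (simp add: indicator_def)
        finally show ?case .
      qed
      show "(\<lambda>v. \<Sum>k\<le>n. ennreal (c k) * indicator (H k) (v, \<xi> v)) \<in> borel_measurable M"
        by (intro borel_measurable_sum borel_measurable_times_ennreal indicator_graph_measurable H) simp
    qed measurable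
    moreover have "AE w in M. (\<Sum>k\<le>n. ennreal (c k) * \<nu> (graph_cond N E (H k)) w) =
        nn_cond_exp M G (\<lambda>v. \<Sum>k\<le>n. ennreal (c k) * indicator (H k) (v, \<xi> v)) w"
      by (rule elementary_integral_eq[of "\<lambda>k _. c k" H n]) (simp, rule H)
    ultimately show "AE w in M. nn_cond_exp M G (\<lambda>v. ennreal (s (\<xi> v))) w =
        (\<Sum>k\<le>n. ennreal (c k) * \<nu> (restr_set N (V k) (A k)) w)"
      unfolding VA(3) by eventually_elim simp
  qed
  moreover have "\<Squnion>\<^bsub>cond_order N (measurable N E)\<^esub> ((\<lambda>k. restr_set N (V k) (A k)) ` {..n}) =
      cond_full N (measurable N E)"
    unfolding VA(3) N.Sup_graph_cond[OF countable_finite[OF finite_atMost] H] cover N.full_eq_graph_cond ..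
  moreover have "\<forall>i\<le>n. \<forall>j\<le>n. i \<noteq> j \<longrightarrow>
      cond_disjoint N (measurable N E) (restr_set N (V i) (A i)) (restr_set N (V j) (A j))"
    unfolding VA(3) using N.disjoint_graph_cond[OF H H disj] by blast
  moreover have "\<forall>k\<le>n. (\<lambda>_. c k) \<in> borel_measurable N \<and> (AE w in N. 0 \<le> c k) \<and>
      V k \<in> stable_subsets N (measurable N E) \<and> A k \<in> sets N \<and> restr_set N (V k) (A k) \<in> L0m_sigma N E"
    using VA graph_cond_in_sigma[OF H] c_nonneg by auto
  ultimately show ?thesis
    unfolding has_elementary_integral_def
    by (intro exI[of _ n] exI[of _ "\<lambda>k _. c k"] exI[of _ V] exI[of _ A] conjI) blast+
qed

text \<open>Existence of the stable integral: simple functions increasing to \<open>f\<close> yield elementary functions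
  increasing to \<open>f \<circ> x\<close>.\<close>

lemma has_stable_nn_integral_comp:
  assumes f: "f \<in> borel_measurable E" and nonneg: "\<And>e. 0 \<le> f e"
  shows "has_stable_nn_integral N (measurable N E) (L0m_sigma N E) \<nu> (\<lambda>x w. f (x w))
    (nn_cond_exp M G (\<lambda>v. ennreal (f (\<xi> v))))"
proof -
  have "(\<lambda>e. ennreal (f e)) \<in> borel_measurable E"
    using f by measurable
  then obtain u where u: "\<And>n. simple_function E (u n)" "incseq u" "\<And>n e. u n e < \<infinity>"
    "\<And>e. (SUP n. u n e) = ennreal (f e)"
    by (rule borel_measurable_implies_simple_function_sequence') (auto simp: infinity_ennreal_def)
  define s where "s n e = enn2real (u n e)" for n e
  have simple: "simple_function E (s n)" for n
    unfolding s_def[abs_def] by (rule simple_function_compose1[OF u(1)])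
  have mono: "s n e \<le> s (Suc n) e" for n e
    unfolding s_def using u(2,3) by (intro enn2real_mono) (auto simp: incseq_Suc_iff le_fun_def infinity_ennreal_def)
  have SUP: "(SUP n. ereal (s n e)) = ereal (f e)" for e
  proof -
    have "incseq (\<lambda>n. u n e)"
      using u(2) by (auto simp: incseq_def le_fun_def)
    from LIMSEQ_SUP[OF this] have "(\<lambda>n. s n e) \<longlonglongrightarrow> f e"
      unfolding u(4) s_def using nonneg by (intro tendsto_enn2real)
    then have "(\<lambda>n. ereal (s n e)) \<longlonglongrightarrow> ereal (f e)"
      by simp
    moreover have "incseq (\<lambda>n. ereal (s n e))"
      using mono by (simp add: incseq_Suc_iff)
    ultimately show ?thesis
      using LIMSEQ_SUP LIMSEQ_unique by blast
  qed
  let ?J = "\<lambda>n. nn_cond_exp M G (\<lambda>v. ennreal (s n (\<xi> v)))"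
  have s_meas [measurable]: "s n \<in> borel_measurable E" for n
    using simple by (rule borel_measurable_simple_function)
  have "AE w in N. nn_cond_exp M G (\<lambda>v. ennreal (f (\<xi> v))) w = (SUP n. ?J n w)"
  proof (rule AE_N_eqI[OF nn_cond_exp_measurable_N])
    have [measurable]: "?J n \<in> borel_measurable N" for n
      by (rule nn_cond_exp_measurable_N)
    show "(\<lambda>w. SUP n. ?J n w) \<in> borel_measurable N"
      by measurable
    have "(SUP n. ennreal (s n e)) = ennreal (f e)" for e
      using SUP mono by (intro SUP_ereal_eq_imp_SUP_ennreal_eq) (simp_all add: incseq_Suc_iff)
    moreover have "AE w in M. (SUP n. ?J n w) = nn_cond_exp M G (\<lambda>v. SUP n. ennreal (s n (\<xi> v))) w"
      using mono by (intro nn_cond_exp_SUP AE_I2 ennreal_leI) measurable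
    ultimately show "AE w in M. nn_cond_exp M G (\<lambda>v. ennreal (f (\<xi> v))) w = (SUP n. ?J n w)"
      by (simp add: eq_commute)
  qed
  moreover have "has_elementary_integral N (measurable N E) (L0m_sigma N E) \<nu> (\<lambda>x w. s n (x w)) (?J n)" for n
    using simple by (rule has_elementary_integral_simple) (simp add: s_def)
  ultimately show ?thesis
    unfolding has_stable_nn_integral_def using nn_cond_exp_measurable_N mono SUP
    by (intro conjI exI[of _ "\<lambda>n x w. s n (x w)"] exI[of _ ?J]) auto
qed

lemma
  assumes f: "f \<in> borel_measurable E" and nonneg: "\<And>e. 0 \<le> f e"
  defines "I \<equiv> stable_nn_integral N (measurable N E) (L0m_sigma N E) \<nu> (\<lambda>x w. f (x w))"
  shows stable_nn_integral_measurable: "I \<in> borel_measurable N"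
    and stable_nn_integral_eq: "AE w in M. I w = nn_cond_exp M G (\<lambda>v. ennreal (f (\<xi> v))) w"
proof -
  have "\<exists>I. has_stable_nn_integral N (measurable N E) (L0m_sigma N E) \<nu> (\<lambda>x w. f (x w)) I"
    using has_stable_nn_integral_comp[OF f nonneg] by blast
  then have *: "has_stable_nn_integral N (measurable N E) (L0m_sigma N E) \<nu> (\<lambda>x w. f (x w)) I"
    unfolding I_def stable_nn_integral_def by (rule someI_ex)
  then show "I \<in> borel_measurable N"
    unfolding has_stable_nn_integral_def by blast
  show "AE w in M. I w = nn_cond_exp M G (\<lambda>v. ennreal (f (\<xi> v))) w"
    using f * by (rule stable_nn_integral_unique)
qed

lemma stable_nn_integral_finite:
  assumes f: "f \<in> borel_measurable E" and nonneg: "\<And>e. 0 \<le> f e" and int: "integrable M (\<lambda>w. f (\<xi> w))"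
  shows "AE w in N. stable_nn_integral N (measurable N E) (L0m_sigma N E) \<nu> (\<lambda>x w. f (x w)) w < \<infinity>"
    (is "AE w in N. ?I w < \<infinity>")
proof (rule AE_M_imp_N)
  let ?h = "\<lambda>v. ennreal (f (\<xi> v))"
  have h: "?h \<in> borel_measurable M"
    using f by measurable
  have "(\<integral>\<^sup>+w. 1 * nn_cond_exp M G ?h w \<partial>M) = (\<integral>\<^sup>+w. 1 * ?h w \<partial>M)"
    by (rule nn_cond_exp_intg[OF _ h]) simp
  also have "\<dots> < \<infinity>"
    using int nonneg by (simp add: integrable_iff_bounded)
  finally have "AE w in M. nn_cond_exp M G ?h w \<noteq> \<infinity>"
    by (intro nn_integral_PInf_AE) auto
  with stable_nn_integral_eq[OF f nonneg] show "AE w in M. ?I w < \<infinity>"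
    by eventually_elim (simp add: less_top)
  have [measurable]: "?I \<in> borel_measurable N"
    by (rule stable_nn_integral_measurable[OF f nonneg])
  show "{w \<in> space N. ?I w < \<infinity>} \<in> sets N"
    by measurable
qed

lemma comp_stable_integrable:
  assumes f: "f \<in> borel_measurable E" and int: "integrable M (\<lambda>w. f (\<xi> w))"
  shows "stable_integrable N (measurable N E) (L0m_sigma N E) \<nu> (\<lambda>x w. f (x w))"
proof -
  have "AE w in N. stable_nn_integral N (measurable N E) (L0m_sigma N E) \<nu> (\<lambda>x w. max 0 (f (x w))) w < \<infinity>"
    using f int by (intro stable_nn_integral_finite[where f = "\<lambda>e. max 0 (f e)"]) auto
  moreover have "AE w in N. stable_nn_integral N (measurable N E) (L0m_sigma N E) \<nu> (\<lambda>x w. max 0 (- f (x w))) w < \<infinity>"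
    using f int by (intro stable_nn_integral_finite[where f = "\<lambda>e. max 0 (- f e)"]) auto
  ultimately show ?thesis
    unfolding stable_integrable_def using N.stably_measurable_comp[OF f] by blast
qed

lemma stable_integral_eq_real_cond_exp:
  assumes f: "f \<in> borel_measurable E"
  shows "AE w in M. real_cond_exp M G (\<lambda>v. f (\<xi> v)) w =
    stable_integral N (measurable N E) (L0m_sigma N E) \<nu> (\<lambda>x w. f (x w)) w"
proof -
  have max_0: "ennreal (max 0 a) = ennreal a" for a
    by (simp add: max_def ennreal_neg)
  have "AE w in M. stable_nn_integral N (measurable N E) (L0m_sigma N E) \<nu> (\<lambda>x w. max 0 (f (x w))) w =
      nn_cond_exp M G (\<lambda>v. ennreal (max 0 (f (\<xi> v)))) w"
    using f by (intro stable_nn_integral_eq[where f = "\<lambda>e. max 0 (f e)"]) auto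
  moreover have "AE w in M. stable_nn_integral N (measurable N E) (L0m_sigma N E) \<nu> (\<lambda>x w. max 0 (- f (x w))) w =
      nn_cond_exp M G (\<lambda>v. ennreal (max 0 (- f (\<xi> v)))) w"
    using f by (intro stable_nn_integral_eq[where f = "\<lambda>e. max 0 (- f e)"]) auto
  ultimately show ?thesis
    unfolding real_cond_exp_def stable_integral_def max_0 by eventually_elim simp
qed

end

theorem theorem4p4:
  fixes M G :: "'w measure" and E :: "'e measure"
    and \<xi> :: "'w \<Rightarrow> 'e" and f :: "'e \<Rightarrow> real"
    and \<nu> :: "('w, 'e) cond_set \<Rightarrow> 'w \<Rightarrow> ennreal"
  assumes "prob_space M" and "complete_measure M"
    and "subalgebra M G"
    and "\<xi> \<in> measurable M E"
    and "stable_cond_distribution M G E \<xi> \<nu>"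
    and "f \<in> borel_measurable E"
    and "integrable M (\<lambda>w. f (\<xi> w))"
  shows "\<exists>f_hat :: ('w \<Rightarrow> 'e) \<Rightarrow> 'w \<Rightarrow> real.
    (\<forall>e\<in>space E. AE w in restr_to_subalg M G. f_hat (\<lambda>_. e) w = f e) \<and>
    stable_integrable (restr_to_subalg M G) (measurable (restr_to_subalg M G) E)
      (L0m_sigma (restr_to_subalg M G) E) \<nu> f_hat \<and>
    (AE w in M. real_cond_exp M G (\<lambda>v. f (\<xi> v)) w =
       stable_integral (restr_to_subalg M G) (measurable (restr_to_subalg M G) E)
         (L0m_sigma (restr_to_subalg M G) E) \<nu> f_hat w)"
proof -
  interpret stable_cond_dist M G E \<xi> \<nu>
    using assms(1,3-5) by (intro stable_cond_dist.intro stable_cond_dist_axioms.intro)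
  show ?thesis
    using comp_stable_integrable[OF assms(6,7)] stable_integral_eq_real_cond_exp[OF assms(6)]
    by (intro exI[of _ "\<lambda>x w. f (x w)"]) simp
qed

end
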